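(* Let $d>1$ and let $\overline f=(f_n)_{n\in\mathbb N}$ be a sequence of $C^1$ Anosov diffeomorphisms of $\mathbb T^d$ such that $\{f_n\}$ satisfies a common cone condition with $(d-1)$-dimensional stable cones (as defined in the context). If $f_n\in\mathrm{Diff}^2(\mathbb T^d)$ for all $n$ and $$\max\left\{\sup_n\|f_n\|_{C^2},\ \sup_n\|f_n^{-1}\|_{C^2}\right\}<\infty,$$ then the non-stationary stable bundle $E^s(\overline f)$ is $C^1$. If $f_n\in\mathrm{Diff}^3(\mathbb T^d)$ for all $n$ and $$\max\left\{\sup_n\|f_n\|_{C^3},\ \sup_n\|f_n^{-1}\|_{C^3}\right\}<\infty,$$ then $E^s(\overline f)$ is $C^{1+\beta}$ for some $\beta\in(0,1)$.
   Context: $\mathbb T^d$ carries its flat metric. The collection $\{f_n\}$ satisfies a common cone condition with $(d-1)$-dimensional stable cones if there are constants $0<\mu<1<\eta$ and, for each $x\in\mathbb T^d$, subspaces $E_x,F_x\subset T_x\mathbb T^d$ depending continuously on $x$ with $\dim E_x=d-1$, $\dim F_x=1$, $T_x\mathbb T^d=E_x\oplus F_x$, such that, writing $K^s(x)=\{v_1+v_2: v_1\in E_x, v_2\in F_x, |v_2|\le\mu|v_1|\}$ and $K^u(x)=\{v_1+v_2:v_1\in E_x,v_2\in F_x,|v_1|\le\mu|v_2|\}$, every $f=f_n$ satisfies: (1) $D_xf(K^u(x))\subseteq\mathrm{int}\,K^u(f(x))$ and $D_xf^{-1}(K^s(x))\subseteq\mathrm{int}\,K^s(f^{-1}(x))$,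 with the angles between image vectors and the boundaries of the target cones bounded away from zero uniformly; (2) $\|D_xf\,v\|\ge\eta\|v\|$ for $v\in K^u(x)$; (3) $\|D_xf^{-1}v\|\ge\eta\|v\|$ for $v\in K^s(x)$. For $x\in\mathbb T^d$, $E^s(x,\overline f)=\bigcap_{n=1}^\infty D_{f_n\circ\cdots\circ f_1(x)}(f_1^{-1}\circ\cdots\circ f_n^{-1})[K^s(f_n\circ\cdots\circ f_1(x))]$, which is a $(d-1)$-dimensional subspace of $T_x\mathbb T^d$ depending continuously on $x$; $E^s(\overline f)=\bigsqcup_x E^s(x,\overline f)$, and its regularity is that of the section $x\mapsto E^s(x,\overline f)$ of the Grassmannian bundle $\mathrm{Gr}_{d-1}(T\mathbb T^d)$. *)

theory Defs
  imports "HOL-Analysis.Analysis"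
begin

text \<open>The torus T^d = R^d / Z^d is handled through lifts to R^d = real^'n
  (flat metric = Euclidean norm). Tangent spaces are identified with R^d.\<close>

definition int_lattice :: "(real ^ 'n) set" where
  "int_lattice = {k. \<forall>i. k $ i \<in> \<int>}"

definition torus_lift :: "(real ^ 'n \<Rightarrow> real ^ 'n) \<Rightarrow> bool" where
  "torus_lift F \<longleftrightarrow> (\<forall>x k. k \<in> int_lattice \<longrightarrow> F (x + k) - F x \<in> int_lattice)"

definition C1_map :: "('a::real_normed_vector \<Rightarrow> 'b::real_normed_vector) \<Rightarrow> ('a \<Rightarrow> ('a \<Rightarrow>\<^sub>L 'b)) \<Rightarrow> bool" where
  "C1_map f Df \<longleftrightarrow> (\<forall>x. (f has_derivative blinfun_apply (Df x)) (at x)) \<and> continuous_on UNIV Df"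

abbreviation Dm :: "(real ^ 'n \<Rightarrow> real ^ 'n) \<Rightarrow> real ^ 'n \<Rightarrow> real ^ 'n \<Rightarrow> real ^ 'n" where
  "Dm f x \<equiv> frechet_derivative f (at x)"

text \<open>Orthogonal projection onto a subspace; used to give the Grassmannian its
  standard smooth structure (embedding of Gr_k(R^d) into the space of linear maps).\<close>
definition is_orth_proj :: "(real ^ 'n) set \<Rightarrow> (real ^ 'n \<Rightarrow> real ^ 'n) \<Rightarrow> bool" where
  "is_orth_proj E P \<longleftrightarrow> (\<forall>v. P v \<in> E) \<and> (\<forall>v. \<forall>w\<in>E. (v - P v) \<bullet> w = 0)"

definition continuous_subspace_field :: "(real ^ 'n \<Rightarrow> (real ^ 'n) set) \<Rightarrow> bool" where
  "continuous_subspace_field E \<longleftrightarrow>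
     (\<forall>x. subspace (E x)) \<and>
     (\<exists>P :: real ^ 'n \<Rightarrow> ((real ^ 'n) \<Rightarrow>\<^sub>L (real ^ 'n)).
        (\<forall>x. is_orth_proj (E x) (blinfun_apply (P x))) \<and> continuous_on UNIV P)"

definition C1_subspace_field :: "(real ^ 'n \<Rightarrow> (real ^ 'n) set) \<Rightarrow> bool" where
  "C1_subspace_field E \<longleftrightarrow>
     (\<forall>x. subspace (E x)) \<and>
     (\<exists>P DP. (\<forall>x. is_orth_proj (E x) (blinfun_apply (P x))) \<and> C1_map P DP)"

definition C1_holder_subspace_field :: "real \<Rightarrow> (real ^ 'n \<Rightarrow> (real ^ 'n) set) \<Rightarrow> bool" where
  "C1_holder_subspace_field \<beta> E \<longleftrightarrow>
     (\<forall>x. subspace (E x)) \<and>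
     (\<exists>P DP K. (\<forall>x. is_orth_proj (E x) (blinfun_apply (P x))) \<and> C1_map P DP \<and>
        (\<forall>x y. norm (DP x - DP y) \<le> K * dist x y powr \<beta>))"

text \<open>Anosov diffeomorphism (F lift of f, G lift of f^{-1}).\<close>
definition anosov :: "(real ^ 'n \<Rightarrow> real ^ 'n) \<Rightarrow> (real ^ 'n \<Rightarrow> real ^ 'n) \<Rightarrow> bool" where
  "anosov F G \<longleftrightarrow> (\<exists>Es Eu (C::real) (lam::real). C > 0 \<and> 0 < lam \<and> lam < 1 \<and>
     (\<forall>x. subspace (Es x) \<and> subspace (Eu x) \<and> Es x \<inter> Eu x = {0} \<and>
          (\<forall>v. \<exists>a\<in>Es x. \<exists>b\<in>Eu x. v = a + b) \<and>
          (\<forall>k\<in>int_lattice. Es (x + k) = Es x \<and> Eu (x + k) = Eu x) \<and>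
          Dm F x ` Es x = Es (F x) \<and> Dm F x ` Eu x = Eu (F x) \<and>
          (\<forall>m v. v \<in> Es x \<longrightarrow> norm (Dm (F ^^ m) x v) \<le> C * lam ^ m * norm v) \<and>
          (\<forall>m v. v \<in> Eu x \<longrightarrow> norm (Dm (G ^^ m) x v) \<le> C * lam ^ m * norm v)))"

definition cone_s :: "real \<Rightarrow> (real ^ 'n \<Rightarrow> (real ^ 'n) set) \<Rightarrow> (real ^ 'n \<Rightarrow> (real ^ 'n) set) \<Rightarrow> real ^ 'n \<Rightarrow> (real ^ 'n) set" where
  "cone_s \<mu> E Fs x = {v1 + v2 | v1 v2. v1 \<in> E x \<and> v2 \<in> Fs x \<and> norm v2 \<le> \<mu> * norm v1}"

definition cone_u :: "real \<Rightarrow> (real ^ 'n \<Rightarrow> (real ^ 'n) set) \<Rightarrow> (real ^ 'n \<Rightarrow> (real ^ 'n) set) \<Rightarrow> real ^ 'n \<Rightarrow> (real ^ 'n) set" where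
  "cone_u \<mu> E Fs x = {v1 + v2 | v1 v2. v1 \<in> E x \<and> v2 \<in> Fs x \<and> norm v1 \<le> \<mu> * norm v2}"

definition vec_angle :: "real ^ 'n \<Rightarrow> real ^ 'n \<Rightarrow> real" where
  "vec_angle u w = arccos ((u \<bullet> w) / (norm u * norm w))"

text \<open>Common cone condition with (d-1)-dimensional stable cones, for the lifts
  F n of f_n and G n of f_n^{-1}.\<close>
definition common_cone_condition :: "real \<Rightarrow> real \<Rightarrow> (real ^ 'n \<Rightarrow> (real ^ 'n) set) \<Rightarrow> (real ^ 'n \<Rightarrow> (real ^ 'n) set) \<Rightarrow>
     (nat \<Rightarrow> real ^ 'n \<Rightarrow> real ^ 'n) \<Rightarrow> (nat \<Rightarrow> real ^ 'n \<Rightarrow> real ^ 'n) \<Rightarrow> bool" where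
  "common_cone_condition \<mu> \<eta> E Fs F G \<longleftrightarrow>
   (\<exists>\<theta>::real. 0 < \<mu> \<and> \<mu> < 1 \<and> 1 < \<eta> \<and> \<theta> > 0 \<and>
     continuous_subspace_field E \<and> continuous_subspace_field Fs \<and>
     (\<forall>x. dim (E x) = CARD('n) - 1 \<and> dim (Fs x) = 1 \<and> E x \<inter> Fs x = {0} \<and>
          (\<forall>v. \<exists>a\<in>E x. \<exists>b\<in>Fs x. v = a + b) \<and>
          (\<forall>k\<in>int_lattice. E (x + k) = E x \<and> Fs (x + k) = Fs x)) \<and>
     (\<forall>n x.
        (\<forall>v \<in> cone_u \<mu> E Fs x - {0}. Dm (F n) x v \<in> interior (cone_u \<mu> E Fs (F n x)) \<and>
            (\<forall>w \<in> frontier (cone_u \<mu> E Fs (F n x)) - {0}. vec_angle (Dm (F n) x v) w \<ge> \<theta>)) \<and>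
        (\<forall>v \<in> cone_s \<mu> E Fs x - {0}. Dm (G n) x v \<in> interior (cone_s \<mu> E Fs (G n x)) \<and>
            (\<forall>w \<in> frontier (cone_s \<mu> E Fs (G n x)) - {0}. vec_angle (Dm (G n) x v) w \<ge> \<theta>)) \<and>
        (\<forall>v \<in> cone_u \<mu> E Fs x. norm (Dm (F n) x v) \<ge> \<eta> * norm v) \<and>
        (\<forall>v \<in> cone_s \<mu> E Fs x. norm (Dm (G n) x v) \<ge> \<eta> * norm v)))"

text \<open>fwd F n = f_n o ... o f_1 and bwd G n = f_1^{-1} o ... o f_n^{-1}, where f_{k+1} is F k.\<close>
primrec fwd :: "(nat \<Rightarrow> 'a \<Rightarrow> 'a) \<Rightarrow> nat \<Rightarrow> 'a \<Rightarrow> 'a" where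
  "fwd F 0 = id"
| "fwd F (Suc n) = F n \<circ> fwd F n"

primrec bwd :: "(nat \<Rightarrow> 'a \<Rightarrow> 'a) \<Rightarrow> nat \<Rightarrow> 'a \<Rightarrow> 'a" where
  "bwd G 0 = id"
| "bwd G (Suc n) = bwd G n \<circ> G n"

definition stable_space :: "real \<Rightarrow> (real ^ 'n \<Rightarrow> (real ^ 'n) set) \<Rightarrow> (real ^ 'n \<Rightarrow> (real ^ 'n) set) \<Rightarrow>
    (nat \<Rightarrow> real ^ 'n \<Rightarrow> real ^ 'n) \<Rightarrow> (nat \<Rightarrow> real ^ 'n \<Rightarrow> real ^ 'n) \<Rightarrow> real ^ 'n \<Rightarrow> (real ^ 'n) set" where
  "stable_space \<mu> E Fs F G x =
     (\<Inter>n\<in>{1..}. Dm (bwd G n) (fwd F n x) ` cone_s \<mu> E Fs (fwd F n x))"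

end

theory Submission
  imports Defs
begin

text \<open>
  The stable space at \<open>x\<close> is the kernel of a covector, obtained as the limit of
  \<open>\<omega>\<^sub>n(x) v = \<langle>Q(x\<^sub>n) A\<^sub>n u, A\<^sub>n v\<rangle> / \<langle>Q(x\<^sub>n) A\<^sub>n u, A\<^sub>n u\<rangle>\<close>, where \<open>x\<^sub>n\<close> is the orbit
  of \<open>x\<close>, \<open>A\<^sub>n\<close> the derivative of the \<open>n\<close>-th composition at \<open>x\<close>, \<open>u\<close> a locally constant vector
  in the unstable cone, and \<open>Q\<close> a smooth periodic field of matrices close to a positive multiple of
  the orthogonal projection onto the complement of \<open>E\<close>.  The normalisation \<open>\<omega>\<^sub>n u = 1\<close> means that
  \<open>D\<omega>\<^sub>n(x) h\<close> only has to be evaluated on vectors \<open>v\<close> in the kernel of \<open>\<omega>\<^sub>n(x)\<close>.  There its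
  main part is a sum over \<open>k < n\<close> of terms containing \<open>D\<^sup>2f(A\<^sub>k h, A\<^sub>k v)\<close>, divided by
  \<open>|A\<^bsub>k+1\<^esub> u|\<close>.  Since the unstable direction is one-dimensional, \<open>|A\<^sub>k h|\<close> is at most a constant
  times \<open>|A\<^sub>k u|\<close>, so the expansion along \<open>h\<close> cancels and the contraction of \<open>A\<^sub>k v\<close> remains: the
  derivatives converge uniformly, at the rate \<open>\<eta>\<^sup>-\<^sup>n\<close>.  If third derivatives are bounded,
  \<open>D\<omega>\<^sub>n\<close> is Lipschitz with a constant growing at most exponentially in \<open>n\<close>, and interpolating
  between the two estimates gives a Hoelder bound for the limit.
\<close>

section \<open>Bounded Lipschitz functions and projections onto lines\<close>

text \<open>The field \<open>E\<close> is only continuous, so the projection onto its complement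
  cannot be differentiated along orbits; this forces the smoothing \<open>Q\<close>. What
  \<open>Q\<close> must still do is vanish, as a functional of its second slot, only inside the
  stable cone, and be positive on the unstable cone; both survive a small perturbation and an
  unknown positive factor, since the covector is a quotient. A vector \<open>u\<close> that is
  constant in x contributes no derivative terms, but it stays in the unstable cone only near one
  point. Hence the analysis is done on balls of one common radius, and the pieces are glued through
  the orthogonal projection onto the stable space, which does not depend on \<open>u\<close>. All
  convergence estimates rest on one identity: two covectors that are 1 at \<open>u\<close> differ at
  v by the value of the first on the kernel projection of v for the second, and that projection is
  contracted. The Hoelder exponent is governed by two rates only, the contraction 1 / \<eta> and the
  exponential growth of the Lipschitz constants.\<close>

text \<open>
  The gauge \<open>d\<close> is not assumed to be the distance: \<open>line_proj_derivative\<close> takes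
  \<open>d x y = dist x y + norm (DW x - DW y)\<close>, which covers mere continuity of \<open>DW\<close> as well as a
  Hoelder bound.
\<close>

definition bdd_lip :: "('a \<Rightarrow> 'a \<Rightarrow> real) \<Rightarrow> 'a set \<Rightarrow> real \<Rightarrow> ('a \<Rightarrow> 'b::real_normed_vector) \<Rightarrow> bool" where
  "bdd_lip d S B f \<longleftrightarrow> (\<forall>x\<in>S. norm (f x) \<le> B) \<and> (\<forall>x\<in>S. \<forall>y\<in>S. norm (f x - f y) \<le> B * d x y)"

lemma bdd_lipI:
  assumes "\<And>x. x \<in> S \<Longrightarrow> norm (f x) \<le> B" "\<And>x y. x \<in> S \<Longrightarrow> y \<in> S \<Longrightarrow> norm (f x - f y) \<le> B * d x y"
  shows "bdd_lip d S B f"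
  using assms by (simp add: bdd_lip_def)

lemma bdd_lipD:
  assumes "bdd_lip d S B f"
  shows "x \<in> S \<Longrightarrow> norm (f x) \<le> B" "x \<in> S \<Longrightarrow> y \<in> S \<Longrightarrow> norm (f x - f y) \<le> B * d x y"
  using assms by (simp_all add: bdd_lip_def)

locale dist_on =
  fixes d :: "'a \<Rightarrow> 'a \<Rightarrow> real" and S :: "'a set"
  assumes d_nonneg: "\<And>x y. 0 \<le> d x y"
begin

abbreviation "bl \<equiv> bdd_lip d S"

lemma bl_nonneg: assumes "bl B f" "x \<in> S" shows "0 \<le> B"
  using bdd_lipD(1)[OF assms] norm_ge_zero[of "f x"] by linarith

lemma bl_mono: assumes "bl B f" "B \<le> B'" shows "bl B' f"
proof (rule bdd_lipI)
  fix x y assume "x \<in> S" "y \<in> S"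
  then have "norm (f x - f y) \<le> B * d x y" by (rule bdd_lipD(2)[OF assms(1)])
  also have "\<dots> \<le> B' * d x y" by (rule mult_right_mono[OF assms(2) d_nonneg])
  finally show "norm (f x - f y) \<le> B' * d x y" .
qed (use bdd_lipD(1)[OF assms(1)] assms(2) in force)

lemma bl_add: assumes "bl B f" "bl B' g" shows "bl (B + B') (\<lambda>x. f x + g x)"
proof (rule bdd_lipI)
  fix x y assume xy: "x \<in> S" "y \<in> S"
  have "norm (f x + g x - (f y + g y)) \<le> norm (f x - f y) + norm (g x - g y)"
    using norm_triangle_ineq[of "f x - f y" "g x - g y"] by (simp add: algebra_simps)
  then show "norm (f x + g x - (f y + g y)) \<le> (B + B') * d x y"
    using bdd_lipD(2)[OF assms(1) xy] bdd_lipD(2)[OF assms(2) xy] by (simp add: distrib_right)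
  show "norm (f x + g x) \<le> B + B'"
    using bdd_lipD(1)[OF assms(1) xy(1)] bdd_lipD(1)[OF assms(2) xy(1)] norm_triangle_ineq[of "f x" "g x"] by linarith
qed

lemma bl_minus: assumes "bl B f" shows "bl B (\<lambda>x. - f x)"
proof (rule bdd_lipI)
  fix x y assume xy: "x \<in> S" "y \<in> S"
  show "norm (- f x - - f y) \<le> B * d x y"
    using bdd_lipD(2)[OF assms(1) xy] by (simp add: norm_minus_commute)
qed (use bdd_lipD(1)[OF assms(1)] in simp)

lemma bl_diff: assumes "bl B f" "bl B' g" shows "bl (B + B') (\<lambda>x. f x - g x)"
  using bl_add[OF assms(1) bl_minus[OF assms(2)]] by simp

text \<open>One constant bounds both the values and the variation, so a product picks up a factor 2
  from the two halves of the product rule. Keeping this shape lets bounds for nested products be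
  assembled by rule application alone.\<close>

lemma bl_bilinear:
  assumes bil: "bounded_bilinear pr" and pr: "\<And>a b. norm (pr a b) \<le> norm a * norm b"
    and f: "bl B f" and g: "bl B' g"
  shows "bl (2 * B * B') (\<lambda>x. pr (f x) (g x))"
proof (rule bdd_lipI)
  interpret bounded_bilinear pr by (rule bil)
  fix x y assume xy: "x \<in> S" "y \<in> S"
  note nn = bl_nonneg[OF f xy(1)] bl_nonneg[OF g xy(1)] 
  have eq: "pr (f x) (g x) - pr (f y) (g y) = pr (f x - f y) (g x) + pr (f y) (g x - g y)"
    by (simp add: diff_left diff_right)
  have "norm (pr (f x) (g x) - pr (f y) (g y)) \<le> norm (f x - f y) * norm (g x) + norm (f y) * norm (g x - g y)"
    using norm_triangle_ineq[of "pr (f x - f y) (g x)" "pr (f y) (g x - g y)"] pr[of "f x - f y" "g x"] pr[of "f y" "g x - g y"]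
    unfolding eq by linarith
  also have "\<dots> \<le> (B * d x y) * B' + B * (B' * d x y)"
    by (intro add_mono mult_mono bdd_lipD[OF f] bdd_lipD[OF g] xy) (use nn d_nonneg in auto)
  finally show "norm (pr (f x) (g x) - pr (f y) (g y)) \<le> 2 * B * B' * d x y" by (simp add: mult_ac)
  have "norm (pr (f x) (g x)) \<le> norm (f x) * norm (g x)" by (rule pr)
  also have "\<dots> \<le> B * B'" 
    by (intro mult_mono bdd_lipD[OF f] bdd_lipD[OF g] xy) (use nn d_nonneg in auto)
  also have "\<dots> \<le> 2 * B * B'" using nn by simp
  finally show "norm (pr (f x) (g x)) \<le> 2 * B * B'" .
qed

lemmas bl_mult = bl_bilinear[OF bounded_bilinear_mult norm_mult_ineq]
lemmas bl_inner = bl_bilinear[OF bounded_bilinear_inner Cauchy_Schwarz_ineq2[folded real_norm_def]]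
lemmas bl_scaleR = bl_bilinear[OF bounded_bilinear_scaleR eq_refl[OF norm_scaleR[folded real_norm_def]]]
lemmas bl_blinfun_apply = bl_bilinear[OF bounded_bilinear_blinfun_apply norm_blinfun]

text \<open>Since 1/a - 1/b = -(a - b)/(a b), the reciprocal varies at most c^2 times as fast;
  \<open>1 \<le> c\<close> and \<open>1 \<le> B\<close> let the same constant dominate the bound c
  of the values.\<close>

lemma bl_inverse:
  fixes f :: "'a \<Rightarrow> real"
  assumes f: "bl B f" and c: "1 \<le> c" and ge: "\<And>x. x \<in> S \<Longrightarrow> 1 \<le> c * f x" and B: "1 \<le> B"
  shows "bl (c\<^sup>2 * B) (\<lambda>x. 1 / f x)"
proof (rule bdd_lipI)
  fix x y assume xy: "x \<in> S" "y \<in> S"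
  have pos: "f z > 0" "1 / f z \<le> c" if "z \<in> S" for z
  proof -
    have "0 < c * f z" using ge[OF that] by linarith
    then show "f z > 0" using c by (simp add: zero_less_mult_iff)
    then show "1 / f z \<le> c" using ge[OF that] by (simp add: field_simps)
  qed
  have "1 / f x - 1 / f y = - ((f x - f y) * ((1 / f x) * (1 / f y)))"
    using pos[OF xy(1)] pos[OF xy(2)] by (simp add: field_simps)
  then have "norm (1 / f x - 1 / f y) = norm (f x - f y) * ((1 / f x) * (1 / f y))"
    using pos[OF xy(1)] pos[OF xy(2)] by (simp add: abs_mult)
  also have "\<dots> \<le> (B * d x y) * (c * c)"
    by (intro mult_mono bdd_lipD[OF f] xy pos) (use pos(1)[OF xy(1)] pos(1)[OF xy(2)] B d_nonneg c in auto)
  finally show "norm (1 / f x - 1 / f y) \<le> c\<^sup>2 * B * d x y" by (simp add: power2_eq_square mult_ac)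
  have "norm (1 / f x) \<le> c" using pos[OF xy(1)] by simp
  also have "c * 1 \<le> c\<^sup>2 * B" unfolding power2_eq_square using c B by (intro mult_mono) auto
  finally show "norm (1 / f x) \<le> c\<^sup>2 * B" by simp
qed

end

section \<open>Derivative of the projection off a varying line\<close>

lemma norm_blinfun_le_unit:
  fixes X :: "'a::real_normed_vector \<Rightarrow>\<^sub>L 'b::real_normed_vector"
  assumes "0 \<le> b" and le: "\<And>h. norm h \<le> 1 \<Longrightarrow> norm (X h) \<le> b"
  shows "norm X \<le> b"
proof (rule norm_blinfun_bound[OF assms(1)])
  fix h
  show "norm (X h) \<le> b * norm h"
  proof (cases "h = 0")
    case False
    then have "norm (X h) = norm (X (h /\<^sub>R norm h)) * norm h"
      by (simp add: blinfun.scaleR_right)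
    also have "\<dots> \<le> b * norm h" by (intro mult_right_mono le) (use False in auto)
    finally show ?thesis .
  qed simp
qed

definition line_proj :: "'a::euclidean_space \<Rightarrow> 'a \<Rightarrow>\<^sub>L 'a" where
  "line_proj w = (1 / (w \<bullet> w)) *\<^sub>R (blinfun_scaleR_left w o\<^sub>L blinfun_inner_right w)"

lemma line_proj_apply: "line_proj w v = ((w \<bullet> v) / (w \<bullet> w)) *\<^sub>R w"
  by (simp add: line_proj_def blinfun.scaleR_left)

text \<open>Away from W = 0 the derivative is a polynomial in \<open>W\<close>, \<open>DW\<close>
  and the reciprocal of W . W, so the calculus of \<open>bdd_lip\<close> applies after evaluation at
  two vectors of norm at most 1. As \<open>K\<close> is at least 1, lower powers are absorbed by the
  ninth.\<close>

lemma line_proj_derivative: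
  fixes W :: "'a::euclidean_space \<Rightarrow> 'a" and DW :: "'a \<Rightarrow> 'a \<Rightarrow>\<^sub>L 'a"
  assumes S: "open S" and dW: "\<And>x. x \<in> S \<Longrightarrow> (W has_derivative DW x) (at x)"
    and K: "1 \<le> K"
    and W1: "\<And>x. x \<in> S \<Longrightarrow> 1 \<le> norm (W x)" and WK: "\<And>x. x \<in> S \<Longrightarrow> norm (W x) \<le> K"
    and DWK: "\<And>x. x \<in> S \<Longrightarrow> norm (DW x) \<le> K"
    and WL: "\<And>x y. x \<in> S \<Longrightarrow> y \<in> S \<Longrightarrow> norm (W x - W y) \<le> K * dist x y"
  obtains DP where "\<And>x. x \<in> S \<Longrightarrow> ((\<lambda>x. id_blinfun - line_proj (W x)) has_derivative blinfun_apply (DP x)) (at x)"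
    and "\<And>x. x \<in> S \<Longrightarrow> norm (DP x) \<le> 2000 * K ^ 9"
    and "\<And>x y. x \<in> S \<Longrightarrow> y \<in> S \<Longrightarrow> norm (DP x - DP y) \<le> 2000 * K ^ 9 * (dist x y + norm (DW x - DW y))"
proof -
  define P where "P = (\<lambda>x. id_blinfun - line_proj (W x))"
  define G where "G x h = - ((- (2 * (W x \<bullet> DW x h)) * (1 / (W x \<bullet> W x)) * (1 / (W x \<bullet> W x))) *\<^sub>R (blinfun_scaleR_left (W x) o\<^sub>L blinfun_inner_right (W x))
     + (1 / (W x \<bullet> W x)) *\<^sub>R ((blinfun_scaleR_left (DW x h) o\<^sub>L blinfun_inner_right (W x)) + (blinfun_scaleR_left (W x) o\<^sub>L blinfun_inner_right (DW x h))))" for x h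
  have G: "(P has_derivative G x) (at x)" if x: "x \<in> S" for x
  proof -
    note [derivative_intros] = dW[OF x] bounded_linear.has_derivative[OF bounded_linear_blinfun_scaleR_left]
      bounded_linear.has_derivative[OF bounded_linear_blinfun_inner_right]
      bounded_bilinear.FDERIV[OF bounded_bilinear_blinfun_compose]
    have nz: "W x \<bullet> W x \<noteq> 0" using W1[OF x] by auto
    show ?thesis unfolding P_def line_proj_def G_def
      apply (rule derivative_eq_intros refl nz)+
      apply (rule ext)
      apply (simp add: inner_commute divide_inverse algebra_simps)
      done
  qed
  define DP where "DP x = Blinfun (G x)" for x
  have DP: "blinfun_apply (DP x) = G x" if "x \<in> S" for x
    unfolding DP_def by (rule bounded_linear_Blinfun_apply[OF has_derivative_bounded_linear[OF G[OF that]]])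
  define d where "d x y = dist x y + norm (DW x - DW y)" for x y
  interpret dist_on d S by unfold_locales (simp add: d_def)
  have key: "bl (2000 * K ^ 9) (\<lambda>x. G x h v)" if h: "norm h \<le> 1" and v: "norm v \<le> 1" for h v
  proof -
    have bW: "bl K W"
    proof (rule bdd_lipI)
      fix x y assume xy: "x \<in> S" "y \<in> S"
      have "K * dist x y \<le> K * d x y" by (intro mult_left_mono) (use K in \<open>auto simp: d_def\<close>)
      then show "norm (W x - W y) \<le> K * d x y" using WL[OF xy] by linarith
    qed (rule WK)
    have bD: "bl K (\<lambda>x. DW x h)"
    proof (rule bdd_lipI)
      fix x y assume xy: "x \<in> S" "y \<in> S"
      have "norm (DW x h - DW y h) \<le> norm (DW x - DW y) * norm h"
        by (metis blinfun.diff_left norm_blinfun)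
      also have "\<dots> \<le> norm (DW x - DW y) * 1" by (intro mult_left_mono h) auto
      also have "\<dots> \<le> 1 * d x y" by (simp add: d_def)
      also have "\<dots> \<le> K * d x y" by (intro mult_right_mono K d_nonneg)
      finally show "norm (DW x h - DW y h) \<le> K * d x y" .
    next
      fix x assume "x \<in> S"
      then have "norm (DW x h) \<le> K * 1"
        by (intro order_trans[OF norm_blinfun] mult_mono DWK h) (use K in auto)
      then show "norm (DW x h) \<le> K" by simp
    qed
    have bv: "bl K (\<lambda>x. v)"
      by (rule bdd_lipI) (use v K d_nonneg in auto)
    have K2: "1 \<le> 2 * K * K"
    proof -
      have "1 * 1 \<le> K * K" using K by (intro mult_mono) auto
      then show ?thesis by simp
    qed
    have br: "bl (1\<^sup>2 * (2 * K * K)) (\<lambda>x. 1 / (W x \<bullet> W x))"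
    proof (rule bl_inverse[OF bl_inner[OF bW bW]])
      show "1 \<le> 1 * (W x \<bullet> W x)" if "x \<in> S" for x
        using W1[OF that] power_mono[of 1 "norm (W x)" 2] by (simp add: power2_norm_eq_inner)
    qed (use K2 in simp_all)
    have br: "bl (2 * K\<^sup>2) (\<lambda>x. 1 / (W x \<bullet> W x))" using br by (simp add: power2_eq_square mult_ac)
    have b2: "bl 2 (\<lambda>x. 2::real)" by (rule bdd_lipI) (use d_nonneg in auto)
    have eq: "G x h v = (2 * (W x \<bullet> DW x h) * (1 / (W x \<bullet> W x)) * (1 / (W x \<bullet> W x))) *\<^sub>R ((W x \<bullet> v) *\<^sub>R W x)
       - (1 / (W x \<bullet> W x)) *\<^sub>R ((W x \<bullet> v) *\<^sub>R DW x h + (DW x h \<bullet> v) *\<^sub>R W x)" for x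
      by (simp add: G_def blinfun.diff_left blinfun.add_left blinfun.minus_left blinfun.scaleR_left algebra_simps)
    \<comment> \<open>The bound produced by the product rules, in which the reciprocal contributes
      K^2 and the constant \<open>v\<close> is given the bound \<open>K\<close> as well. It equals
      1024 K^9 + 32 K^5, which is rounded up to 2000 K^9.\<close>
    let ?B = "2 * (2 * (2 * (2 * 2 * (2 * K * K)) * (2 * K\<^sup>2)) * (2 * K\<^sup>2)) * (2 * (2 * K * K) * K)
       + 2 * (2 * K\<^sup>2) * (2 * (2 * K * K) * K + 2 * (2 * K * K) * K)"
    have "bl ?B (\<lambda>x. G x h v)"
      unfolding eq
      by (intro bl_diff bl_add bl_scaleR bl_mult bl_inner bW bD bv br b2)
    moreover have "?B \<le> 2000 * K ^ 9"
    proof -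
      have "?B = 1024 * K ^ 9 + 32 * K ^ 5" by (simp add: eval_nat_numeral algebra_simps)
      moreover have "K ^ 5 \<le> K ^ 9" "0 \<le> K ^ 9" using K by (auto intro: power_increasing)
      ultimately have "?B \<le> 2000 * K ^ 9" by linarith
      then show ?thesis .
    qed
    ultimately show ?thesis by (rule bl_mono)
  qed
  have nrm: "norm X \<le> b"
    if "0 \<le> b" "\<And>h v. norm h \<le> 1 \<Longrightarrow> norm v \<le> 1 \<Longrightarrow> norm (X h v) \<le> b" for X :: "'a \<Rightarrow>\<^sub>L 'a \<Rightarrow>\<^sub>L 'a" and b
    by (intro norm_blinfun_le_unit that)
  show ?thesis
  proof (rule that[of DP])
    show "((\<lambda>x. id_blinfun - line_proj (W x)) has_derivative blinfun_apply (DP x)) (at x)" if "x \<in> S" for x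
      using G[OF that] unfolding DP[OF that] P_def .
    show "norm (DP x) \<le> 2000 * K ^ 9" if "x \<in> S" for x
      using bdd_lipD(1)[OF key that] K by (intro nrm) (auto simp: DP[OF that])
    show "norm (DP x - DP y) \<le> 2000 * K ^ 9 * (dist x y + norm (DW x - DW y))" if xy: "x \<in> S" "y \<in> S" for x y
      using bdd_lipD(2)[OF key xy] K
      by (intro nrm) (auto simp: DP[OF xy(1)] DP[OF xy(2)] blinfun.diff_left d_def)
  qed
qed

text \<open>Take n to be the integer part of ln (1/r) / (2 ln \<Lambda>). Then \<Lambda>^n is at
  most r^(-1/2), so the growing summand is at most H r^(1/2), while q^n is at most r^a / q with a =
  ln (1/q) / (2 ln \<Lambda>); the division by q pays for the rounding. The exponent, the smaller of
  1/2 and a, depends on \<open>q\<close> and \<Lambda> alone.\<close>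

lemma holder_interpolation:
  fixes q \<Lambda> :: real
  assumes q: "0 < q" "q < 1" and \<Lambda>: "1 < \<Lambda>"
  obtains \<beta> where "0 < \<beta>" "\<beta> < 1"
    "\<And>t r K H. 0 \<le> r \<Longrightarrow> r \<le> 1 \<Longrightarrow> 0 \<le> K \<Longrightarrow> 0 \<le> H \<Longrightarrow> (\<And>n. t \<le> K * q ^ n + H * \<Lambda> ^ n * r) \<Longrightarrow> t \<le> (K / q + H) * r powr \<beta>"
proof -
  define a where "a = ln (1 / q) / (2 * ln \<Lambda>)"
  define \<beta> where "\<beta> = min (1/2) a"
  have a: "a > 0" using q \<Lambda> by (simp add: a_def)
  have \<beta>: "0 < \<beta>" "\<beta> < 1" "\<beta> \<le> 1/2" "\<beta> \<le> a" using a by (auto simp: \<beta>_def)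
  have "t \<le> (K / q + H) * r powr \<beta>"
    if r: "0 \<le> r" "r \<le> 1" and KH: "0 \<le> K" "0 \<le> H" and t: "\<And>n. t \<le> K * q ^ n + H * \<Lambda> ^ n * r" for t r K H :: real
  proof (cases "r = 0")
    case True
    have "(\<lambda>n. K * q ^ n) \<longlonglongrightarrow> K * 0" by (intro tendsto_intros LIMSEQ_realpow_zero) (use q in auto)
    then have "t \<le> 0" using t True by (intro LIMSEQ_le_const[of _ 0]) auto
    then show ?thesis using True by simp
  next
    case False
    then have r0: "r > 0" using r by simp
    define s where "s = ln (1 / r) / (2 * ln \<Lambda>)"
    define n where "n = nat \<lfloor>s\<rfloor>"
    have s0: "s \<ge> 0" using r r0 \<Lambda> by (simp add: s_def)
    have n: "real n \<le> s" "s - 1 \<le> real n" unfolding n_def using s0 by linarith+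
    have "\<Lambda> ^ n = \<Lambda> powr real n" using \<Lambda> by (simp add: powr_realpow)
    also have "\<dots> \<le> \<Lambda> powr s" by (rule powr_mono) (use n \<Lambda> in auto)
    also have "\<dots> = r powr (-1/2)" using \<Lambda> r0 by (simp add: powr_def s_def ln_div)
    finally have "H * \<Lambda> ^ n * r \<le> H * r powr (-1/2) * r" by (intro mult_right_mono mult_left_mono KH r)
    also have "\<dots> = H * r powr (1/2)"
    proof -
      have "r powr (-1/2) * r powr 1 = r powr (-1/2 + 1)" by (rule powr_add[symmetric])
      then show ?thesis using r0 by simp
    qed
    also have "\<dots> \<le> H * r powr \<beta>" by (intro mult_left_mono KH powr_mono') (use \<beta> r in auto)
    finally have 1: "H * \<Lambda> ^ n * r \<le> H * r powr \<beta>" .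
    have "q ^ n = q powr real n" using q by (simp add: powr_realpow)
    also have "\<dots> \<le> q powr (s - 1)" by (rule powr_mono') (use n q in auto)
    also have "\<dots> = q powr s / q" using q by (simp add: powr_diff)
    also have "q powr s = r powr a" using q r0 \<Lambda> by (simp add: powr_def s_def a_def ln_div)
    also have "r powr a / q \<le> r powr \<beta> / q" by (intro divide_right_mono powr_mono') (use \<beta> r q in auto)
    finally have "K * q ^ n \<le> K * (r powr \<beta> / q)" by (intro mult_left_mono KH)
    then show ?thesis using 1 t[of n] by (simp add: algebra_simps)
  qed
  then show ?thesis using that \<beta>(1,2) by blast
qed

section \<open>Dominated sequences of linear maps\<close>

primrec blprod :: "(nat \<Rightarrow> 'a::real_normed_vector \<Rightarrow>\<^sub>L 'a) \<Rightarrow> nat \<Rightarrow> 'a \<Rightarrow>\<^sub>L 'a" where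
  "blprod L 0 = id_blinfun"
| "blprod L (Suc n) = L n o\<^sub>L blprod L n"

lemma blprod_add: "blprod L (m + k) = blprod (\<lambda>i. L (i + k)) m o\<^sub>L blprod L k"
  by (induction m) (auto intro!: blinfun_eqI)

lemma blprod_add_apply:
  "blprod (\<lambda>i. L (i + k)) m (blprod L k v) = blprod L (m + k) v"
  by (simp add: blprod_add)

definition pairing :: "(nat \<Rightarrow> 'a::real_inner \<Rightarrow>\<^sub>L 'a) \<Rightarrow> (nat \<Rightarrow> 'a \<Rightarrow>\<^sub>L 'a) \<Rightarrow> nat \<Rightarrow> 'a \<Rightarrow> 'a \<Rightarrow> real" where
  "pairing L Q n u v = Q n (blprod L n u) \<bullet> blprod L n v"

definition covec :: "(nat \<Rightarrow> 'a::real_inner \<Rightarrow>\<^sub>L 'a) \<Rightarrow> (nat \<Rightarrow> 'a \<Rightarrow>\<^sub>L 'a) \<Rightarrow> nat \<Rightarrow> 'a \<Rightarrow> 'a \<Rightarrow> real" where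
  "covec L Q n u v = pairing L Q n u v / pairing L Q n u u"

text \<open>The projection along \<open>u\<close> onto the kernel of the covector, provided that the
  covector is 1 at \<open>u\<close>; \<open>covec_u\<close> supplies this for nonzero
  \<open>u\<close> in the unstable cone.\<close>

definition kproj :: "(nat \<Rightarrow> 'a::real_inner \<Rightarrow>\<^sub>L 'a) \<Rightarrow> (nat \<Rightarrow> 'a \<Rightarrow>\<^sub>L 'a) \<Rightarrow> nat \<Rightarrow> 'a \<Rightarrow> 'a \<Rightarrow> 'a" where
  "kproj L Q n u v = v - covec L Q n u v *\<^sub>R u"

text \<open>
  Along an orbit \<open>x\<^sub>n\<close>, with \<open>L n\<close> and \<open>S n\<close> the first and second derivatives of the \<open>n\<close>-th map at
  \<open>x\<^sub>n\<close> and \<open>T n\<close> the derivative of the matrix field \<open>Q\<close> there, the following are the derivatives of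
  \<open>blprod\<close>, \<open>pairing\<close> and \<open>covec\<close> with respect to \<open>x\<close> in direction \<open>h\<close>.
\<close>

primrec dblprod :: "(nat \<Rightarrow> 'a::real_normed_vector \<Rightarrow>\<^sub>L 'a) \<Rightarrow> (nat \<Rightarrow> 'a \<Rightarrow>\<^sub>L 'a \<Rightarrow>\<^sub>L 'a) \<Rightarrow> nat \<Rightarrow> 'a \<Rightarrow> 'a \<Rightarrow> 'a" where
  "dblprod L S 0 h v = 0"
| "dblprod L S (Suc n) h v = S n (blprod L n h) (blprod L n v) + L n (dblprod L S n h v)"

definition dpairing :: "(nat \<Rightarrow> 'a::real_inner \<Rightarrow>\<^sub>L 'a) \<Rightarrow> (nat \<Rightarrow> 'a \<Rightarrow>\<^sub>L 'a) \<Rightarrow> (nat \<Rightarrow> 'a \<Rightarrow>\<^sub>L 'a \<Rightarrow>\<^sub>L 'a) \<Rightarrow>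
    (nat \<Rightarrow> 'a \<Rightarrow>\<^sub>L 'a \<Rightarrow>\<^sub>L 'a) \<Rightarrow> nat \<Rightarrow> 'a \<Rightarrow> 'a \<Rightarrow> 'a \<Rightarrow> real" where
  "dpairing L Q S T n u h v =
     T n (blprod L n h) (blprod L n u) \<bullet> blprod L n v
     + Q n (dblprod L S n h u) \<bullet> blprod L n v
     + Q n (blprod L n u) \<bullet> dblprod L S n h v"

definition dcovec :: "(nat \<Rightarrow> 'a::real_inner \<Rightarrow>\<^sub>L 'a) \<Rightarrow> (nat \<Rightarrow> 'a \<Rightarrow>\<^sub>L 'a) \<Rightarrow> (nat \<Rightarrow> 'a \<Rightarrow>\<^sub>L 'a \<Rightarrow>\<^sub>L 'a) \<Rightarrow>
    (nat \<Rightarrow> 'a \<Rightarrow>\<^sub>L 'a \<Rightarrow>\<^sub>L 'a) \<Rightarrow> nat \<Rightarrow> 'a \<Rightarrow> 'a \<Rightarrow> 'a \<Rightarrow> real" where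
  "dcovec L Q S T n u h v = dpairing L Q S T n u h (kproj L Q n u v) / pairing L Q n u u"

lemma pairing_diff: "pairing L Q n u (v - w) = pairing L Q n u v - pairing L Q n u w"
  and pairing_scaleR: "pairing L Q n u (r *\<^sub>R v) = r * pairing L Q n u v"
  and pairing_add: "pairing L Q n u (v + w) = pairing L Q n u v + pairing L Q n u w"
  by (simp_all add: pairing_def blinfun.diff_right blinfun.add_right blinfun.scaleR_right inner_diff_right inner_add_right)

lemma covec_diff: "covec L Q n u (v - w) = covec L Q n u v - covec L Q n u w"
  and covec_scaleR: "covec L Q n u (r *\<^sub>R v) = r * covec L Q n u v"
  and covec_add: "covec L Q n u (v + w) = covec L Q n u v + covec L Q n u w"
  by (simp_all add: covec_def pairing_diff pairing_scaleR pairing_add diff_divide_distrib add_divide_distrib)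

lemma dblprod_linear:
  "dblprod L S n h (v + w) = dblprod L S n h v + dblprod L S n h w"
  "dblprod L S n h (r *\<^sub>R v) = r *\<^sub>R dblprod L S n h v"
  "dblprod L S n (h + k) v = dblprod L S n h v + dblprod L S n k v"
  "dblprod L S n (r *\<^sub>R h) v = r *\<^sub>R dblprod L S n h v"
  by (induction n) (simp_all add: blinfun.add_right blinfun.add_left blinfun.scaleR_left blinfun.scaleR_right scaleR_add_right)

lemma dblprod_diff: "dblprod L S n h (v - w) = dblprod L S n h v - dblprod L S n h w"
  using dblprod_linear(1)[of L S n h "v - w" w] by simp

lemma dpairing_linear:
  "dpairing L Q S T n u h (v - w) = dpairing L Q S T n u h v - dpairing L Q S T n u h w"
  "dpairing L Q S T n u h (r *\<^sub>R v) = r * dpairing L Q S T n u h v"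
  "dpairing L Q S T n u (h + k) v = dpairing L Q S T n u h v + dpairing L Q S T n u k v"
  "dpairing L Q S T n u (r *\<^sub>R h) v = r * dpairing L Q S T n u h v"
  unfolding dpairing_def dblprod_linear dblprod_diff blinfun.diff_right blinfun.add_right
      blinfun.add_left blinfun.scaleR_left blinfun.scaleR_right distrib_left
      inner_diff_right inner_add_right inner_add_left inner_scaleR_left inner_scaleR_right
  by linarith+

lemma dcovec_linear:
  "dcovec L Q S T n u (h + k) v = dcovec L Q S T n u h v + dcovec L Q S T n u k v"
  "dcovec L Q S T n u (r *\<^sub>R h) v = r * dcovec L Q S T n u h v"
  by (simp_all add: dcovec_def dpairing_linear add_divide_distrib)

text \<open>Duhamel's formula: the second derivative acts once, at time k, and the remaining n - Suc
  k maps transport the result linearly to time n.\<close>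

lemma dblprod_sum:
  "dblprod L S n h v = (\<Sum>k<n. blprod (\<lambda>i. L (i + Suc k)) (n - Suc k) (S k (blprod L k h) (blprod L k v)))"
proof (induction n)
  case (Suc n)
  have "L n (dblprod L S n h v)
      = (\<Sum>k<n. L n (blprod (\<lambda>i. L (i + Suc k)) (n - Suc k) (S k (blprod L k h) (blprod L k v))))"
    unfolding Suc by (rule blinfun.sum_right)
  also have "\<dots> = (\<Sum>k<n. blprod (\<lambda>i. L (i + Suc k)) (Suc n - Suc k) (S k (blprod L k h) (blprod L k v)))"
  proof (rule sum.cong)
    fix k assume "k \<in> {..<n}"
    then obtain j where "n = Suc (j + k)" using less_imp_Suc_add[of k n] by (auto simp: add.commute)
    then show "L n (blprod (\<lambda>i. L (i + Suc k)) (n - Suc k) (S k (blprod L k h) (blprod L k v)))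
      = blprod (\<lambda>i. L (i + Suc k)) (Suc n - Suc k) (S k (blprod L k h) (blprod L k v))"
      by (simp add: Suc_diff_le)
  qed simp
  finally show ?case by simp
qed simp

lemma geometric_sum_le:
  fixes q :: real assumes "0 \<le> q" "q < 1"
  shows "(\<Sum>k<n. q ^ k) \<le> 1 / (1 - q)"
  using assms sum_le_suminf[of "\<lambda>k. q^k" "{..<n}"] by (simp add: summable_geometric suminf_geometric)

lemma geometric_sum_rev_le:
  fixes q :: real assumes "0 \<le> q" "q < 1"
  shows "(\<Sum>k<n. q ^ (n - Suc k)) \<le> 1 / (1 - q)"
  using geometric_sum_le[OF assms, of n] by (simp add: sum.nat_diff_reindex)

lemma geometric_sum_tail_le:
  fixes q :: real assumes "0 \<le> q" "q < 1"
  shows "(\<Sum>k=n..<m. q ^ k) \<le> q ^ n / (1 - q)"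
proof (cases "n \<le> m")
  case True
  then have "(\<Sum>k=n..<m. q ^ k) = (\<Sum>k<m-n. q ^ (k + n))"
    using sum.shift_bounds_nat_ivl[of "\<lambda>k. q ^ k" 0 n "m - n"] by (simp add: lessThan_atLeast0)
  also have "\<dots> = q ^ n * (\<Sum>k<m-n. q ^ k)" by (simp add: power_add sum_distrib_left mult.commute)
  also have "\<dots> \<le> q ^ n * (1 / (1 - q))"
    by (intro mult_left_mono geometric_sum_le assms) (use assms in auto)
  finally show ?thesis by simp
qed (use assms in auto)

text \<open>The cone condition along a single orbit, with one constant \<open>C\<close> for all
  comparisons of angles and norms. Codimension one enters through \<open>Q_kernel\<close>: the
  hyperplane orthogonal to \<open>Q n w\<close> lies entirely in the stable cone. The axioms pass to
  tails of the sequence, which is how the Duhamel summands are estimated.\<close>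

locale dominated_seq =
  fixes L Q :: "nat \<Rightarrow> 'a::euclidean_space \<Rightarrow>\<^sub>L 'a" and Ks Ku :: "nat \<Rightarrow> 'a set" and \<eta> C :: real
  assumes eta: "1 < \<eta>" and C: "1 \<le> C"
    and Ku_image: "w \<in> Ku n \<Longrightarrow> L n w \<in> Ku (Suc n)"
    and Ku_expand: "w \<in> Ku n \<Longrightarrow> \<eta> * norm w \<le> norm (L n w)"
    and Ks_preimage: "L n v \<in> Ks (Suc n) \<Longrightarrow> v \<in> Ks n"
    and Ks_contract: "L n v \<in> Ks (Suc n) \<Longrightarrow> \<eta> * norm (L n v) \<le> norm v"
    and Ku_scaleR: "w \<in> Ku n \<Longrightarrow> r *\<^sub>R w \<in> Ku n"
    and separation: "v \<in> Ks n \<Longrightarrow> w \<in> Ku n \<Longrightarrow> norm w \<le> C * norm (v + w)"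
    and Q_pos: "w \<in> Ku n \<Longrightarrow> (norm w)\<^sup>2 \<le> C * (Q n w \<bullet> w)"
    and Q_bound: "norm (Q n) \<le> C"
    and Q_kernel: "w \<in> Ku n \<Longrightarrow> w \<noteq> 0 \<Longrightarrow> Q n w \<bullet> v = 0 \<Longrightarrow> v \<in> Ks n"
begin

abbreviation "A \<equiv> blprod L"
abbreviation "q \<equiv> 1 / \<eta>"

lemma q: "0 < q" "q < 1" using eta by auto

lemma shift: "dominated_seq (\<lambda>i. L (i + k)) (\<lambda>i. Q (i + k)) (\<lambda>i. Ks (i + k)) (\<lambda>i. Ku (i + k)) \<eta> C"
  using eta C Ku_image Ku_expand Ks_preimage Ks_contract Ku_scaleR separation Q_pos Q_bound Q_kernel
  by unfold_locales auto

lemma Ku_A: "w \<in> Ku 0 \<Longrightarrow> A n w \<in> Ku n"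
  by (induction n) (auto intro: Ku_image)

text \<open>Expansion is read backwards from the later time, the form that yields geometric series
  in n - k.\<close>

lemma A_Ku_expand:
  assumes "w \<in> Ku 0" "k \<le> n"
  shows "norm (A k w) \<le> q ^ (n - k) * norm (A n w)"
  using assms(2)
proof (induction n rule: dec_induct)
  case (step n)
  have "\<eta> * norm (A n w) \<le> norm (A (Suc n) w)"
    using Ku_expand[OF Ku_A[OF assms(1)]] by simp
  then have "norm (A n w) \<le> q * norm (A (Suc n) w)" using eta by (simp add: field_simps)
  then have "q ^ (n - k) * norm (A n w) \<le> q ^ (n - k) * (q * norm (A (Suc n) w))"
    by (intro mult_left_mono) (use q in auto)
  also have "\<dots> = q ^ (Suc n - k) * norm (A (Suc n) w)"
    using step by (simp add: Suc_diff_le)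
  finally show ?case using step.IH by linarith
qed simp

lemma A_Ku_mono:
  assumes "w \<in> Ku 0" "k \<le> n"
  shows "norm (A k w) \<le> norm (A n w)"
proof -
  have "q ^ (n - k) \<le> 1" using q by (intro power_le_one) auto
  then have "q ^ (n - k) * norm (A n w) \<le> 1 * norm (A n w)" by (intro mult_right_mono) auto
  then show ?thesis using A_Ku_expand[OF assms] by linarith
qed

lemma A_Ku_ge: "w \<in> Ku 0 \<Longrightarrow> norm w \<le> norm (A n w)"
  using A_Ku_mono[of w 0 n] by simp

lemma Ks_A_preimage:
  assumes "A n v \<in> Ks n" "k \<le> n"
  shows "A k v \<in> Ks k"
  using assms(2,1)
  by (induction rule: dec_induct) (use Ks_preimage in auto)

lemma A_Ks_contract:
  assumes "A n v \<in> Ks n"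
  shows "norm (A n v) \<le> q ^ n * norm v"
  using assms
proof (induction n)
  case (Suc n)
  have L: "L n (A n v) \<in> Ks (Suc n)" using Suc.prems by simp
  have "\<eta> * norm (A (Suc n) v) \<le> norm (A n v)" using Ks_contract[OF L] by simp
  also have "\<dots> \<le> q ^ n * norm v" by (rule Suc.IH[OF Ks_preimage[OF L]])
  finally show ?case using eta by (simp add: field_simps)
qed simp

context
  fixes u assumes u: "u \<in> Ku 0" "u \<noteq> 0"
begin

lemma A_u_pos: "norm (A n u) > 0"
proof -
  have "norm u > 0" using u by simp
  then show ?thesis using A_Ku_ge[OF u(1), of n] by linarith
qed

lemma pairing_ge: "(norm (A n u))\<^sup>2 \<le> C * pairing L Q n u u"
  unfolding pairing_def by (rule Q_pos[OF Ku_A[OF u(1)]])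

lemma pairing_pos: "pairing L Q n u u > 0"
proof -
  have "0 < (norm (A n u))\<^sup>2" using A_u_pos by simp
  then have "0 < C * pairing L Q n u u" using pairing_ge[of n] by linarith
  then show ?thesis using C by (simp add: zero_less_mult_iff)
qed

lemma inverse_pairing_le: "1 / pairing L Q n u u \<le> C / (norm (A n u))\<^sup>2"
  using pairing_ge[of n] pairing_pos[of n] A_u_pos[of n] by (simp add: field_simps)

lemma covec_u: "covec L Q n u u = 1"
  using pairing_pos[of n] by (simp add: covec_def)

lemma covec_kproj: "covec L Q n u (kproj L Q n u v) = 0"
  by (simp add: kproj_def covec_diff covec_scaleR covec_u)

text \<open>A kernel vector of the n-th covector lies in the stable cone at time n by
  \<open>Q_kernel\<close>, and stable cones are invariant backwards. Nothing is claimed about times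
  after n.\<close>

lemma A_kproj: 
  assumes "k \<le> n" shows "A k (kproj L Q n u v) \<in> Ks k"
proof -
  have "pairing L Q n u (kproj L Q n u v) = 0"
    using covec_kproj[of n v] pairing_pos[of n] by (simp add: covec_def)
  then have "A n (kproj L Q n u v) \<in> Ks n"
    unfolding pairing_def using Q_kernel[OF Ku_A[OF u(1)]] A_u_pos by force
  then show ?thesis using Ks_A_preimage assms by blast
qed

text \<open>\<open>separation\<close> at time 0, applied to the splitting of \<open>v\<close> into
  its kernel projection and a multiple of \<open>u\<close>, which lie in the two cones.\<close>

lemma covec_bound: "\<bar>covec L Q n u v\<bar> * norm u \<le> C * norm v"
proof -
  have "norm (covec L Q n u v *\<^sub>R u) \<le> C * norm (kproj L Q n u v + covec L Q n u v *\<^sub>R u)"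
    using A_kproj[of 0 n v] u(1) by (intro separation[of _ 0] Ku_scaleR) auto
  then show ?thesis by (simp add: kproj_def)
qed

lemma kproj_bound: "norm (kproj L Q n u v) \<le> 2 * C * norm v"
proof -
  have "norm (kproj L Q n u v) \<le> norm v + \<bar>covec L Q n u v\<bar> * norm u"
    unfolding kproj_def by (metis norm_triangle_ineq4 norm_scaleR)
  also have "\<dots> \<le> norm v + C * norm v" using covec_bound by simp
  also have "\<dots> \<le> 2 * C * norm v" using mult_right_mono[OF C, of "norm v"] by simp
  finally show ?thesis .
qed

lemma A_kproj_bound:
  assumes "k \<le> n" shows "norm (A k (kproj L Q n u v)) \<le> 2 * C * q ^ k * norm v"
proof -
  have "norm (A k (kproj L Q n u v)) \<le> q ^ k * norm (kproj L Q n u v)"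
    by (rule A_Ks_contract[OF A_kproj[OF assms]])
  also have "\<dots> \<le> q ^ k * (2 * C * norm v)"
    by (intro mult_left_mono kproj_bound) (use q in auto)
  finally show ?thesis by (simp add: mult_ac)
qed

text \<open>Split \<open>h\<close> by the covector of the same time k: the kernel part has been
  contracted up to time k, and the rest is a controlled multiple of \<open>u\<close>. So
  \<open>u\<close> realises, up to a constant, the largest expansion of \<open>A k\<close>.\<close>

lemma A_bound: "norm (A k h) * norm u \<le> 3 * C * norm (A k u) * norm h"
proof -
  have "norm (A k h) = norm (A k (kproj L Q k u h) + covec L Q k u h *\<^sub>R A k u)"
    by (simp add: kproj_def blinfun.diff_right blinfun.scaleR_right)
  also have "\<dots> \<le> norm (A k (kproj L Q k u h)) + \<bar>covec L Q k u h\<bar> * norm (A k u)"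
    by (metis norm_triangle_ineq norm_scaleR)
  finally have "norm (A k h) * norm u \<le>
      (norm (A k (kproj L Q k u h)) + \<bar>covec L Q k u h\<bar> * norm (A k u)) * norm u"
    by (rule mult_right_mono) simp
  also have "\<dots> = norm (A k (kproj L Q k u h)) * norm u + (\<bar>covec L Q k u h\<bar> * norm u) * norm (A k u)"
    by (simp add: algebra_simps)
  also have "\<dots> \<le> (2 * C * norm h) * norm (A k u) + (C * norm h) * norm (A k u)"
  proof (intro add_mono mult_mono[of "norm (A k (kproj L Q k u h))"] mult_right_mono covec_bound A_Ku_ge[OF u(1)])
    have "2 * C * q ^ k * norm h \<le> 2 * C * 1 * norm h"
      by (intro mult_mono power_le_one) (use q C in auto)
    then show "norm (A k (kproj L Q k u h)) \<le> 2 * C * norm h"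
      using A_kproj_bound[of k k h] by linarith
  qed (use C in auto)
  finally show ?thesis by (simp add: algebra_simps)
qed

text \<open>Cauchy-Schwarz at time n against the lower bound for the pairing. Unlike
  \<open>covec_bound\<close> it sees the image \<open>A n v\<close>, and therefore gains when that
  image is small.\<close>

lemma covec_A_bound: "\<bar>covec L Q n u v\<bar> * norm (A n u) \<le> C\<^sup>2 * norm (A n v)"
proof -
  have "\<bar>pairing L Q n u v\<bar> \<le> norm (Q n (A n u)) * norm (A n v)"
    unfolding pairing_def by (rule Cauchy_Schwarz_ineq2)
  also have "\<dots> \<le> (C * norm (A n u)) * norm (A n v)"
    by (intro mult_right_mono norm_blinfun[THEN order_trans] Q_bound) auto
  finally have 1: "\<bar>pairing L Q n u v\<bar> \<le> (C * norm (A n u)) * norm (A n v)" .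
  have "\<bar>covec L Q n u v\<bar> = \<bar>pairing L Q n u v\<bar> * (1 / pairing L Q n u u)"
    using pairing_pos[of n] by (simp add: covec_def)
  also have "\<dots> \<le> ((C * norm (A n u)) * norm (A n v)) * (C / (norm (A n u))\<^sup>2)"
    by (intro mult_mono 1 inverse_pairing_le) (use pairing_pos[of n] C in auto)
  finally show ?thesis using A_u_pos[of n] by (simp add: field_simps power2_eq_square)
qed

text \<open>Both covectors are 1 at \<open>u\<close>, so their difference at \<open>v\<close> is the
  n-th one evaluated on the kernel projection of the m-th, a vector contracted up to time n. The
  factor \<open>norm (A n u)\<close> is retained on the left because \<open>mainterm_Cauchy\<close>
  offsets the growth of \<open>A k u\<close> with it.\<close>

lemma covec_Cauchy:
  assumes "n \<le> m"
  shows "\<bar>covec L Q n u v - covec L Q m u v\<bar> * norm (A n u) \<le> 2 * C ^ 3 * q ^ n * norm v"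
proof -
  have "covec L Q n u v - covec L Q m u v = covec L Q n u (kproj L Q m u v)"
    by (simp add: kproj_def covec_diff covec_scaleR covec_u)
  then have "\<bar>covec L Q n u v - covec L Q m u v\<bar> * norm (A n u) \<le> C\<^sup>2 * norm (A n (kproj L Q m u v))"
    using covec_A_bound by simp
  also have "\<dots> \<le> C\<^sup>2 * (2 * C * q ^ n * norm v)"
    by (intro mult_left_mono A_kproj_bound assms) auto
  finally show ?thesis by (simp add: eval_nat_numeral mult_ac)
qed

end

lemma pairing_shift:
  "pairing (\<lambda>i. L (i + k)) (\<lambda>i. Q (i + k)) m (A k u) z
     = Q (m + k) (A (m + k) u) \<bullet> blprod (\<lambda>i. L (i + k)) m z"
  by (simp add: pairing_def blprod_add_apply)

text \<open>Started at time k from \<open>A k u\<close>, the sequence has the same denominator as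
  the original at time m + k. A Duhamel summand paired with the image of \<open>u\<close> and
  divided by the original pairing is thus again a covector, namely of a tail.\<close>

lemma covec_shift:
  "covec (\<lambda>i. L (i + k)) (\<lambda>i. Q (i + k)) m (A k u) z
     = Q (m + k) (A (m + k) u) \<bullet> blprod (\<lambda>i. L (i + k)) m z / pairing L Q (m + k) u u"
  by (simp add: pairing_shift covec_def pairing_def blprod_add_apply)

end

section \<open>Uniform convergence of the differentiated covectors\<close>

context dominated_seq
begin

context
  fixes u and S T :: "nat \<Rightarrow> 'a \<Rightarrow>\<^sub>L 'a \<Rightarrow>\<^sub>L 'a" and M :: real
  assumes u: "u \<in> Ku 0" "norm u = 1"
    and S: "\<And>n. norm (S n) \<le> M" and T: "\<And>n. norm (T n) \<le> M"
begin

lemma u_nz: "u \<noteq> 0" using u by auto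

lemma M_nonneg: "0 \<le> M" using S[of 0] norm_ge_zero[of "S 0"] by linarith

text \<open>
  Normalising the covector of the shifted sequence by \<open>A (Suc k) u\<close> is what absorbs the growth of
  \<open>A k h\<close> in \<open>tail_covec_S_bound\<close>.
\<close>

definition tail_covec :: "nat \<Rightarrow> nat \<Rightarrow> 'a \<Rightarrow> real" where
  "tail_covec k n = covec (\<lambda>i. L (i + Suc k)) (\<lambda>i. Q (i + Suc k)) (n - Suc k) (A (Suc k) u)"

lemma tail_covec_eq:
  "k < n \<Longrightarrow> tail_covec k n z = Q n (A n u) \<bullet> blprod (\<lambda>i. L (i + Suc k)) (n - Suc k) z / pairing L Q n u u"
  unfolding tail_covec_def covec_shift by simp

lemma Ku_Suc: "A (Suc k) u \<in> Ku (0 + Suc k)" "A (Suc k) u \<noteq> 0"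
  using Ku_A[OF u(1), of "Suc k"] A_u_pos[OF u(1) u_nz, of "Suc k"] by auto

lemma tail_covec_bound: "\<bar>tail_covec k n z\<bar> * norm (A (Suc k) u) \<le> C * norm z"
  unfolding tail_covec_def by (rule dominated_seq.covec_bound[OF shift Ku_Suc])

lemma tail_covec_Cauchy:
  assumes "k < n" "n \<le> m"
  shows "\<bar>tail_covec k n z - tail_covec k m z\<bar> * norm (A n u) \<le> 2 * C ^ 3 * q ^ (n - Suc k) * norm z"
proof -
  have "blprod (\<lambda>i. L (i + Suc k)) (n - Suc k) (A (Suc k) u) = A n u"
    using assms by (subst blprod_add_apply) simp
  then show ?thesis
    unfolding tail_covec_def 
    using dominated_seq.covec_Cauchy[OF shift Ku_Suc, of "n - Suc k" "m - Suc k" k z] assms by simp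
qed

lemma tail_A_bound:
  assumes "k < n"
  shows "norm (blprod (\<lambda>i. L (i + Suc k)) (n - Suc k) z) * norm (A (Suc k) u) \<le> 3 * C * norm (A n u) * norm z"
proof -
  have "blprod (\<lambda>i. L (i + Suc k)) (n - Suc k) (A (Suc k) u) = A n u"
    using assms by (subst blprod_add_apply) simp
  then show ?thesis
    using dominated_seq.A_bound[OF shift Ku_Suc, of k "n - Suc k" z] by simp
qed

lemma A_bound1: "norm (A k h) \<le> 3 * C * norm (A k u) * norm h"
  using A_bound[OF u(1) u_nz, of k h] u(2) by simp

lemma S_bound: "norm (S k (A k h) z) \<le> 3 * C * M * norm (A k u) * norm h * norm z"
proof -
  have "norm (S k (A k h) z) \<le> norm (S k (A k h)) * norm z" by (rule norm_blinfun)
  also have "\<dots> \<le> (norm (S k) * norm (A k h)) * norm z"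
    by (intro mult_right_mono norm_blinfun) auto
  also have "\<dots> \<le> (M * (3 * C * norm (A k u) * norm h)) * norm z"
    by (intro mult_right_mono mult_mono S A_bound1 M_nonneg) auto
  finally show ?thesis by (simp add: mult_ac)
qed

lemma tail_covec_S_bound:
  "\<bar>tail_covec k n (S k (A k h) z)\<bar> \<le> 3 * C\<^sup>2 * M * norm h * norm z"
proof -
  have pos: "norm (A (Suc k) u) > 0" by (rule A_u_pos[OF u(1) u_nz])
  have "\<bar>tail_covec k n (S k (A k h) z)\<bar> * norm (A (Suc k) u) \<le> C * (3 * C * M * norm (A k u) * norm h * norm z)"
    by (rule order_trans[OF tail_covec_bound]) (intro mult_left_mono S_bound, use C in auto)
  also have "\<dots> \<le> C * (3 * C * M * norm (A (Suc k) u) * norm h * norm z)"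
    by (intro mult_left_mono mult_right_mono A_Ku_mono[OF u(1)]) (use C M_nonneg in auto)
  also have "\<dots> = (3 * C\<^sup>2 * M * norm h * norm z) * norm (A (Suc k) u)"
    by (simp add: power2_eq_square mult_ac)
  finally show ?thesis using pos by (simp only: mult_le_cancel_right_pos)
qed

text \<open>The share of time k, by Duhamel's formula, in the summand of \<open>dpairing\<close>
  that differentiates the second slot, after division by the pairing.\<close>

definition mainterm where "mainterm k n h v = tail_covec k n (S k (A k h) (A k (kproj L Q n u v)))"

lemma mainterm_bound:
  assumes "k < n"
  shows "\<bar>mainterm k n h v\<bar> \<le> 6 * C ^ 3 * M * norm h * norm v * q ^ k"
proof -
  have "\<bar>mainterm k n h v\<bar> \<le> 3 * C\<^sup>2 * M * norm h * norm (A k (kproj L Q n u v))"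
    unfolding mainterm_def by (rule tail_covec_S_bound)
  also have "\<dots> \<le> 3 * C\<^sup>2 * M * norm h * (2 * C * q ^ k * norm v)"
    by (intro mult_left_mono A_kproj_bound[OF u(1) u_nz]) (use assms M_nonneg in auto)
  finally show ?thesis by (simp add: eval_nat_numeral mult_ac)
qed

text \<open>Passing from n to m changes the kernel projection, by a multiple \<delta> of
  \<open>u\<close>, and also the tail covector; the two changes contribute 6 and 12 to the constant.
  Each is of order q^n, with a further factor q^(n - Suc k) that makes the sum over k
  bounded.\<close>

lemma mainterm_Cauchy:
  assumes "k < n" "n \<le> m"
  shows "\<bar>mainterm k n h v - mainterm k m h v\<bar> \<le> 18 * C ^ 5 * M * norm h * norm v * q ^ n * q ^ (n - Suc k)"
proof -
  define \<delta> where "\<delta> = covec L Q m u v - covec L Q n u v"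
  define s where "s = S k (A k h) (A k (kproj L Q m u v))"
  have an: "norm (A n u) > 0" by (rule A_u_pos[OF u(1) u_nz])
  have ak: "norm (A k u) \<le> q ^ (n - k) * norm (A n u)" by (rule A_Ku_expand[OF u(1)]) (use assms in simp)
  have nk: "q ^ (n - k) \<le> q ^ (n - Suc k)"
    by (rule power_decreasing) (use q in auto)
  have ak': "norm (A k u) \<le> q ^ (n - Suc k) * norm (A n u)"
    by (rule order_trans[OF ak]) (intro mult_right_mono nk, auto)
  have "kproj L Q n u v - kproj L Q m u v = \<delta> *\<^sub>R u" by (simp add: kproj_def \<delta>_def algebra_simps)
  then have eq: "S k (A k h) (A k (kproj L Q n u v)) = s + S k (A k h) (\<delta> *\<^sub>R A k u)"
    unfolding s_def by (metis blinfun.add_right blinfun.scaleR_right diff_add_cancel add.commute)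
  have tc: "tail_covec k n (a + b) = tail_covec k n a + tail_covec k n b" for a b
    by (simp add: tail_covec_def covec_add)
  have split: "mainterm k n h v - mainterm k m h v =
    tail_covec k n (S k (A k h) (\<delta> *\<^sub>R A k u)) + (tail_covec k n s - tail_covec k m s)"
    unfolding mainterm_def eq tc by (simp add: s_def)
  have \<delta>: "\<bar>\<delta>\<bar> * norm (A n u) \<le> 2 * C ^ 3 * q ^ n * norm v"
    unfolding \<delta>_def by (subst abs_minus_commute) (rule covec_Cauchy[OF u(1) u_nz assms(2)])
  have "\<bar>tail_covec k n (S k (A k h) (\<delta> *\<^sub>R A k u))\<bar> \<le> 3 * C\<^sup>2 * M * norm h * norm (\<delta> *\<^sub>R A k u)"
    by (rule tail_covec_S_bound)
  also have "\<dots> \<le> 3 * C\<^sup>2 * M * norm h * (\<bar>\<delta>\<bar> * (q ^ (n - Suc k) * norm (A n u)))"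
    unfolding norm_scaleR by (intro mult_left_mono ak') (use M_nonneg in auto)
  also have "\<dots> = 3 * C\<^sup>2 * M * norm h * q ^ (n - Suc k) * (\<bar>\<delta>\<bar> * norm (A n u))" by (simp add: mult_ac)
  also have "\<dots> \<le> 3 * C\<^sup>2 * M * norm h * q ^ (n - Suc k) * (2 * C ^ 3 * q ^ n * norm v)"
    by (intro mult_left_mono \<delta>) (use M_nonneg q in auto)
  finally have 1: "\<bar>tail_covec k n (S k (A k h) (\<delta> *\<^sub>R A k u))\<bar>
      \<le> 6 * C ^ 5 * M * norm h * norm v * q ^ n * q ^ (n - Suc k)"
    by (simp add: eval_nat_numeral mult_ac)
  \<comment> \<open>The growth of \<open>A k h\<close> is at most that of \<open>A k u\<close>,
    measured backwards from time n as q^(n - k); with the contraction q^k of the kernel vector it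
    makes q^n, whatever k is.\<close>
  have "norm s \<le> 3 * C * M * norm (A k u) * norm h * norm (A k (kproj L Q m u v))"
    unfolding s_def by (rule S_bound)
  also have "\<dots> \<le> 3 * C * M * (q ^ (n - k) * norm (A n u)) * norm h * (2 * C * q ^ k * norm v)"
    by (intro mult_mono A_kproj_bound[OF u(1) u_nz] ak) (use assms q M_nonneg C in auto)
  also have "\<dots> = 6 * C\<^sup>2 * M * norm h * norm v * (q ^ (n - k) * q ^ k) * norm (A n u)"
    by (simp add: eval_nat_numeral mult_ac)
  also have "q ^ (n - k) * q ^ k = q ^ n" using assms by (simp flip: power_add)
  finally have s: "norm s \<le> 6 * C\<^sup>2 * M * norm h * norm v * q ^ n * norm (A n u)" .
  have "\<bar>tail_covec k n s - tail_covec k m s\<bar> * norm (A n u) \<le> 2 * C ^ 3 * q ^ (n - Suc k) * norm s"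
    by (rule tail_covec_Cauchy[OF assms])
  also have "\<dots> \<le> 2 * C ^ 3 * q ^ (n - Suc k) * (6 * C\<^sup>2 * M * norm h * norm v * q ^ n * norm (A n u))"
    by (intro mult_left_mono s) (use q C in auto)
  also have "\<dots> = (12 * C ^ 5 * M * norm h * norm v * q ^ n * q ^ (n - Suc k)) * norm (A n u)"
    by (simp add: eval_nat_numeral mult_ac)
  finally have 2: "\<bar>tail_covec k n s - tail_covec k m s\<bar> \<le> 12 * C ^ 5 * M * norm h * norm v * q ^ n * q ^ (n - Suc k)"
    using an by (simp only: mult_le_cancel_right_pos)
  show ?thesis unfolding split using 1 2 by linarith
qed

definition restterm where
  "restterm n h v = (T n (A n h) (A n u) \<bullet> A n (kproj L Q n u v)
     + Q n (dblprod L S n h u) \<bullet> A n (kproj L Q n u v)) / pairing L Q n u u"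

lemma dcovec_split: "dcovec L Q S T n u h v = restterm n h v + (\<Sum>k<n. mainterm k n h v)"
proof -
  have "Q n (A n u) \<bullet> dblprod L S n h (kproj L Q n u v) / pairing L Q n u u
     = (\<Sum>k<n. mainterm k n h v)"
    unfolding dblprod_sum inner_sum_right sum_divide_distrib
    by (intro sum.cong refl) (simp add: mainterm_def tail_covec_eq)
  then show ?thesis
    by (simp add: dcovec_def dpairing_def restterm_def add_divide_distrib)
qed

text \<open>In a Duhamel summand the transport costs the ratio of \<open>norm (A n u)\<close> to
  \<open>norm (A (Suc k) u)\<close>. The denominator cancels one of the two factors
  \<open>norm (A k u)\<close> coming from the second derivative, and the other is at most q^(n - Suc
  k) \<open>norm (A n u)\<close>. The resulting square is what the pairing in
  \<open>restterm\<close> can cancel.\<close>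

lemma dblprod_u_bound: "norm (dblprod L S n h u) \<le> 9 * C\<^sup>2 * M / (1 - q) * (norm (A n u))\<^sup>2 * norm h"
proof -
  have "norm (blprod (\<lambda>i. L (i + Suc k)) (n - Suc k) (S k (A k h) (A k u)))
      \<le> 9 * C\<^sup>2 * M * (norm (A n u))\<^sup>2 * norm h * q ^ (n - Suc k)" if "k < n" for k
  proof -
    let ?b = "blprod (\<lambda>i. L (i + Suc k)) (n - Suc k) (S k (A k h) (A k u))"
    have pos: "norm (A (Suc k) u) > 0" by (rule A_u_pos[OF u(1) u_nz])
    have "norm ?b * norm (A (Suc k) u) \<le> 3 * C * norm (A n u) * norm (S k (A k h) (A k u))"
      by (rule tail_A_bound[OF that])
    also have "\<dots> \<le> 3 * C * norm (A n u) * (3 * C * M * norm (A k u) * norm h * norm (A k u))"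
      by (intro mult_left_mono S_bound) (use C in auto)
    also have "\<dots> \<le> 3 * C * norm (A n u) * (3 * C * M * norm (A (Suc k) u) * norm h * (q ^ (n - Suc k) * norm (A n u)))"
    proof (intro mult_mono mult_right_mono mult_left_mono)
      show "norm (A k u) \<le> q ^ (n - Suc k) * norm (A n u)"
        using A_Ku_mono[OF u(1), of k "Suc k"] A_Ku_expand[OF u(1), of "Suc k" n] that by simp
      show "norm (A k u) \<le> norm (A (Suc k) u)" by (rule A_Ku_mono[OF u(1)]) simp
    qed (use C M_nonneg q in auto)
    also have "\<dots> = (9 * C\<^sup>2 * M * (norm (A n u))\<^sup>2 * norm h * q ^ (n - Suc k)) * norm (A (Suc k) u)"
      by (simp add: power2_eq_square mult_ac)
    finally show ?thesis using pos by (simp only: mult_le_cancel_right_pos)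
  qed
  then have "norm (dblprod L S n h u) \<le> (\<Sum>k<n. 9 * C\<^sup>2 * M * (norm (A n u))\<^sup>2 * norm h * q ^ (n - Suc k))"
    unfolding dblprod_sum by (intro sum_norm_le) simp
  also have "\<dots> = 9 * C\<^sup>2 * M * (norm (A n u))\<^sup>2 * norm h * (\<Sum>k<n. q ^ (n - Suc k))"
    by (simp add: sum_distrib_left)
  also have "\<dots> \<le> 9 * C\<^sup>2 * M * (norm (A n u))\<^sup>2 * norm h * (1 / (1 - q))"
    by (intro mult_left_mono geometric_sum_rev_le) (use q M_nonneg in auto)
  finally show ?thesis by (simp add: mult_ac)
qed

text \<open>Differentiating \<open>Q\<close> or the first slot costs two factors
  \<open>norm (A n u)\<close>, which the pairing in the denominator cancels. What is left is the
  contraction q^n of the kernel vector in the second slot.\<close>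

lemma restterm_bound: "\<bar>restterm n h v\<bar> \<le> 24 * C ^ 5 * M / (1 - q) * norm h * norm v * q ^ n"
proof -
  define a where "a = norm (A n u)"
  define z where "z = A n (kproj L Q n u v)"
  have a: "a > 0" unfolding a_def by (rule A_u_pos[OF u(1) u_nz])
  have z: "norm z \<le> 2 * C * q ^ n * norm v"
    unfolding z_def by (rule A_kproj_bound[OF u(1) u_nz]) simp
  have q1: "1 \<le> 1 / (1 - q)" using q by simp
  have C5: "C ^ 3 \<le> C ^ 5" by (intro power_increasing C) simp
  have "norm (T n (A n h) (A n u)) \<le> (norm (T n) * norm (A n h)) * norm (A n u)"
    by (intro order_trans[OF norm_blinfun] mult_right_mono norm_blinfun) auto
  also have "\<dots> \<le> (M * (3 * C * a * norm h)) * a"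
    unfolding a_def by (intro mult_right_mono mult_mono[of "norm (T n)"] T A_bound1 M_nonneg) auto
  finally have 1: "norm (T n (A n h) (A n u)) \<le> 3 * C * M * 1 * a\<^sup>2 * norm h" by (simp add: power2_eq_square mult_ac)
  also have "\<dots> \<le> 3 * C ^ 3 * M * (1 / (1 - q)) * a\<^sup>2 * norm h"
  proof (intro mult_right_mono mult_mono q1)
    show "C \<le> C ^ 3" using power_increasing[of 1 3 C] C by simp
  qed (use C M_nonneg in auto)
  finally have 1: "norm (T n (A n h) (A n u)) \<le> 3 * C ^ 3 * M / (1 - q) * a\<^sup>2 * norm h" by simp
  have "norm (Q n (dblprod L S n h u)) \<le> C * norm (dblprod L S n h u)"
    by (rule order_trans[OF norm_blinfun]) (intro mult_right_mono Q_bound, auto)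
  also have "\<dots> \<le> C * (9 * C\<^sup>2 * M / (1 - q) * a\<^sup>2 * norm h)"
    unfolding a_def by (intro mult_left_mono dblprod_u_bound) (use C in auto)
  finally have 2: "norm (Q n (dblprod L S n h u)) \<le> 9 * C ^ 3 * M / (1 - q) * a\<^sup>2 * norm h"
    by (simp add: eval_nat_numeral mult_ac)
  let ?y = "T n (A n h) (A n u) + Q n (dblprod L S n h u)"
  have 3: "norm ?y \<le> 12 * C ^ 3 * M / (1 - q) * a\<^sup>2 * norm h"
  proof -
    define e where "e = C ^ 3 * M / (1 - q) * a\<^sup>2 * norm h"
    have "norm (T n (A n h) (A n u)) \<le> 3 * e" "norm (Q n (dblprod L S n h u)) \<le> 9 * e"
      using 1 2 by (simp_all add: e_def)
    then have "norm ?y \<le> 12 * e"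
      using norm_triangle_ineq[of "T n (A n h) (A n u)" "Q n (dblprod L S n h u)"] by linarith
    then show ?thesis by (simp add: e_def)
  qed
  have "\<bar>restterm n h v\<bar> = \<bar>?y \<bullet> z\<bar> * (1 / pairing L Q n u u)"
    using pairing_pos[OF u(1) u_nz, of n] by (simp add: restterm_def z_def inner_add_left)
  also have "\<dots> \<le> (norm ?y * norm z) * (C / a\<^sup>2)"
    using pairing_pos[OF u(1) u_nz, of n] unfolding a_def
    by (intro mult_mono Cauchy_Schwarz_ineq2 inverse_pairing_le[OF u(1) u_nz]) auto
  also have "\<dots> \<le> ((12 * C ^ 3 * M / (1 - q) * a\<^sup>2 * norm h) * (2 * C * q ^ n * norm v)) * (C / a\<^sup>2)"
    by (intro mult_right_mono mult_mono 3 z) (use C M_nonneg q in auto)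
  also have "\<dots> = 24 * C ^ 5 * M / (1 - q) * norm h * norm v * q ^ n"
    using a by (simp add: eval_nat_numeral field_simps)
  finally show ?thesis .
qed

text \<open>72 = 24 + 24 + 18 + 6: the rest terms at n and m, the changes of the main terms with k <
  n, and the new main terms with k from n on. The sums are geometric in q^(n - Suc k) and q^k
  respectively.\<close>

lemma dcovec_Cauchy:
  assumes "n \<le> m"
  shows "\<bar>dcovec L Q S T n u h v - dcovec L Q S T m u h v\<bar> \<le> 72 * C ^ 5 * M / (1 - q) * norm h * norm v * q ^ n"
proof -
  let ?c = "C ^ 5 * M / (1 - q) * norm h * norm v"
  have c0: "?c \<ge> 0" using C M_nonneg q by auto
  have qmn: "q ^ m \<le> q ^ n" by (rule power_decreasing) (use assms q in auto)
  have r: "\<bar>restterm n h v\<bar> \<le> 24 * (?c * q ^ n)" "\<bar>restterm m h v\<bar> \<le> 24 * (?c * q ^ m)"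
    using restterm_bound[of n h v] restterm_bound[of m h v] by simp_all
  have r2: "?c * q ^ m \<le> ?c * q ^ n" by (intro mult_left_mono qmn c0)
  have "(\<Sum>k<m. mainterm k m h v) = (\<Sum>k<n. mainterm k m h v) + (\<Sum>k=n..<m. mainterm k m h v)"
    using sum.atLeastLessThan_concat[of 0 n m "\<lambda>k. mainterm k m h v"] assms by (simp add: lessThan_atLeast0)
  then have eq: "dcovec L Q S T n u h v - dcovec L Q S T m u h v
     = restterm n h v - restterm m h v + (\<Sum>k<n. mainterm k n h v - mainterm k m h v) - (\<Sum>k=n..<m. mainterm k m h v)"
    by (simp add: dcovec_split sum_subtractf)
  have "\<bar>\<Sum>k<n. mainterm k n h v - mainterm k m h v\<bar> \<le> (\<Sum>k<n. 18 * C ^ 5 * M * norm h * norm v * q ^ n * q ^ (n - Suc k))"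
    by (intro order_trans[OF sum_abs] sum_mono mainterm_Cauchy assms) auto
  also have "\<dots> = 18 * C ^ 5 * M * norm h * norm v * q ^ n * (\<Sum>k<n. q ^ (n - Suc k))"
    by (simp add: sum_distrib_left)
  also have "\<dots> \<le> 18 * C ^ 5 * M * norm h * norm v * q ^ n * (1 / (1 - q))"
    by (intro mult_left_mono geometric_sum_rev_le) (use q C M_nonneg in auto)
  finally have m1: "\<bar>\<Sum>k<n. mainterm k n h v - mainterm k m h v\<bar> \<le> 18 * (?c * q ^ n)" by (simp add: mult_ac)
  have "\<bar>\<Sum>k=n..<m. mainterm k m h v\<bar> \<le> (\<Sum>k=n..<m. 6 * C ^ 3 * M * norm h * norm v * q ^ k)"
    by (intro order_trans[OF sum_abs] sum_mono mainterm_bound) auto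
  also have "\<dots> = 6 * C ^ 3 * M * norm h * norm v * (\<Sum>k=n..<m. q ^ k)"
    by (simp add: sum_distrib_left)
  also have "\<dots> \<le> 6 * C ^ 5 * M * norm h * norm v * (q ^ n / (1 - q))"
    by (intro mult_mono mult_right_mono mult_left_mono geometric_sum_tail_le power_increasing C sum_nonneg)
       (use q C M_nonneg in auto)
  finally have m2: "\<bar>\<Sum>k=n..<m. mainterm k m h v\<bar> \<le> 6 * (?c * q ^ n)" by (simp add: mult_ac)
  have "\<bar>dcovec L Q S T n u h v - dcovec L Q S T m u h v\<bar> \<le> 72 * (?c * q ^ n)"
  proof -
    have aux: "\<bar>a - b + c - d\<bar> \<le> 72 * x"
      if "\<bar>a\<bar> \<le> 24 * x" "\<bar>b\<bar> \<le> 24 * y" "y \<le> x" "\<bar>c\<bar> \<le> 18 * x" "\<bar>d\<bar> \<le> 6 * x" for a b c d x y :: real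
      using that by linarith
    show ?thesis unfolding eq by (rule aux[OF r r2 m1 m2])
  qed
  then show ?thesis by simp
qed

end

end

section \<open>Smooth sequences of maps\<close>

lemma has_derivative_fwd:
  assumes "\<And>n x. (F n has_derivative blinfun_apply (D1 n x)) (at x)"
  shows "(fwd F n has_derivative blinfun_apply (blprod (\<lambda>k. D1 k (fwd F k x)) n)) (at x)"
proof (induction n)
  case 0
  show ?case by (simp add: id_def)
next
  case (Suc n)
  show ?case
    using diff_chain_at[OF Suc assms] by (simp add: comp_def)
qed

text \<open>Uniform bounds on the whole space stand in for compactness of the torus, and the cone
  condition becomes the requirement that every orbit is dominated with the same \<eta> and
  \<open>C\<close>.\<close>

locale smooth_seq =
  fixes F :: "nat \<Rightarrow> 'a::euclidean_space \<Rightarrow> 'a" and D1 :: "nat \<Rightarrow> 'a \<Rightarrow> 'a \<Rightarrow>\<^sub>L 'a"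
    and D2 :: "nat \<Rightarrow> 'a \<Rightarrow> 'a \<Rightarrow>\<^sub>L 'a \<Rightarrow>\<^sub>L 'a" and Qf :: "'a \<Rightarrow> 'a \<Rightarrow>\<^sub>L 'a"
    and DQ :: "'a \<Rightarrow> 'a \<Rightarrow>\<^sub>L 'a \<Rightarrow>\<^sub>L 'a" and Ks Ku :: "'a \<Rightarrow> 'a set" and \<eta> C M :: real
  assumes F_deriv: "(F n has_derivative D1 n x) (at x)"
    and D1_deriv: "(D1 n has_derivative D2 n x) (at x)"
    and D2_cont: "continuous_on UNIV (D2 n)"
    and Q_deriv: "(Qf has_derivative DQ x) (at x)"
    and DQ_cont: "continuous_on UNIV DQ"
    and D1_bound: "norm (D1 n x) \<le> M" and D2_bound: "norm (D2 n x) \<le> M" and DQ_bound: "norm (DQ x) \<le> M"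
    and M1: "1 \<le> M"
    and Ks_closed: "closed (Ks x)"
    and dominated: "dominated_seq (\<lambda>k. D1 k (fwd F k x)) (\<lambda>k. Qf (fwd F k x))
        (\<lambda>k. Ks (fwd F k x)) (\<lambda>k. Ku (fwd F k x)) \<eta> C"
begin

abbreviation "LL x \<equiv> \<lambda>k. D1 k (fwd F k x)"
abbreviation "QQ x \<equiv> \<lambda>k. Qf (fwd F k x)"
abbreviation "SS x \<equiv> \<lambda>k. D2 k (fwd F k x)"
abbreviation "TT x \<equiv> \<lambda>k. DQ (fwd F k x)"
abbreviation "q \<equiv> 1 / \<eta>"

lemma q: "0 < q" "q < 1" using dominated_seq.q[OF dominated] by auto
lemma C1: "1 \<le> C" by (rule dominated_seq.C[OF dominated])

lemmas fwd_deriv = has_derivative_fwd[of F D1, OF F_deriv]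

lemma fwd_cont: "continuous_on S (fwd F n)"
  by (intro continuous_at_imp_continuous_on ballI has_derivative_continuous[OF fwd_deriv])

lemma blprod_deriv: "((\<lambda>x. blprod (LL x) n v) has_derivative (\<lambda>h. dblprod (LL x) (SS x) n h v)) (at x)"
proof (induction n)
  case (Suc n)
  have "((\<lambda>x. D1 n (fwd F n x)) has_derivative (\<lambda>h. D2 n (fwd F n x) (blprod (LL x) n h))) (at x)"
    using diff_chain_at[OF fwd_deriv D1_deriv] by (simp add: comp_def)
  from bounded_bilinear.FDERIV[OF bounded_bilinear_blinfun_apply this Suc]
  show ?case by (simp add: add.commute)
qed simp

lemma pairing_deriv:
  "((\<lambda>x. pairing (LL x) (QQ x) n u v) has_derivative (\<lambda>h. dpairing (LL x) (QQ x) (SS x) (TT x) n u h v)) (at x)"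
proof -
  have 1: "((\<lambda>x. Qf (fwd F n x)) has_derivative (\<lambda>h. DQ (fwd F n x) (blprod (LL x) n h))) (at x)"
    using diff_chain_at[OF fwd_deriv Q_deriv] by (simp add: comp_def)
  from bounded_bilinear.FDERIV[OF bounded_bilinear_blinfun_apply 1 blprod_deriv]
  have 2: "((\<lambda>x. Qf (fwd F n x) (blprod (LL x) n u)) has_derivative
      (\<lambda>h. Qf (fwd F n x) (dblprod (LL x) (SS x) n h u) + DQ (fwd F n x) (blprod (LL x) n h) (blprod (LL x) n u))) (at x)" .
  from bounded_bilinear.FDERIV[OF bounded_bilinear_inner 2 blprod_deriv]
  show ?thesis
    unfolding pairing_def dpairing_def by (simp add: inner_add_left algebra_simps)
qed

text \<open>The quotient rule gives dp(v)/p - (p(v)/p) dp(u)/p. As dp is linear in its last slot,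
  this is dp/p at v - (p(v)/p) u, which is how \<open>kproj\<close> gets into
  \<open>dcovec\<close>.\<close>

lemma covec_deriv:
  assumes "u \<in> Ku x" "u \<noteq> 0"
  shows "((\<lambda>x. covec (LL x) (QQ x) n u v) has_derivative (\<lambda>h. dcovec (LL x) (QQ x) (SS x) (TT x) n u h v)) (at x)"
proof -
  have pos: "pairing (LL x) (QQ x) n u u > 0"
    by (rule dominated_seq.pairing_pos[OF dominated]) (use assms in auto)
  have "((\<lambda>x. pairing (LL x) (QQ x) n u v / pairing (LL x) (QQ x) n u u) has_derivative
     (\<lambda>h. dcovec (LL x) (QQ x) (SS x) (TT x) n u h v)) (at x)"
  proof (rule has_derivative_eq_rhs[OF has_derivative_divide'[OF pairing_deriv pairing_deriv]])
    have aux: "(a * p - b * c) / (p * p) = (a - (b / p) * c) / p" if "p > 0" for a b c p :: real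
      using that by (simp add: diff_divide_distrib)
    show "(\<lambda>h. (dpairing (LL x) (QQ x) (SS x) (TT x) n u h v * pairing (LL x) (QQ x) n u u -
          pairing (LL x) (QQ x) n u v * dpairing (LL x) (QQ x) (SS x) (TT x) n u h u) /
         (pairing (LL x) (QQ x) n u u * pairing (LL x) (QQ x) n u u)) =
      (\<lambda>h. dcovec (LL x) (QQ x) (SS x) (TT x) n u h v)"
      unfolding aux[OF pos] dcovec_def kproj_def dpairing_linear covec_def ..
  qed (use pos in simp)
  then show ?thesis unfolding covec_def .
qed

lemma fwd_cont_comp: 
  assumes "continuous_on UNIV f" shows "continuous_on S (\<lambda>x. f (fwd F n x))"
  by (rule continuous_on_compose2[OF assms fwd_cont]) simp

lemma D1_cont: "continuous_on UNIV (D1 n)" and Q_cont: "continuous_on UNIV Qf"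
  by (intro continuous_at_imp_continuous_on ballI has_derivative_continuous[OF D1_deriv]
      has_derivative_continuous[OF Q_deriv])+

lemmas orbit_cont = fwd_cont_comp[OF D1_cont] fwd_cont_comp[OF D2_cont] fwd_cont_comp[OF Q_cont] fwd_cont_comp[OF DQ_cont]

lemma blprod_cont: "continuous_on S (\<lambda>x. blprod (LL x) n v)"
  by (intro continuous_at_imp_continuous_on ballI has_derivative_continuous[OF blprod_deriv])

lemma dblprod_cont: "continuous_on S (\<lambda>x. dblprod (LL x) (SS x) n h v)"
  by (induction n) (auto intro!: continuous_intros orbit_cont blprod_cont)

lemma dpairing_cont: "continuous_on S (\<lambda>x. dpairing (LL x) (QQ x) (SS x) (TT x) n u h v)"
  unfolding dpairing_def
  by (intro continuous_intros orbit_cont blprod_cont dblprod_cont)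

lemma pairing_cont: "continuous_on S (\<lambda>x. pairing (LL x) (QQ x) n u v)"
  by (intro continuous_at_imp_continuous_on ballI has_derivative_continuous[OF pairing_deriv])

text \<open>\<open>kproj\<close> hides a dependence on x in the last slot of
  \<open>dpairing\<close>. Here every slot holds a fixed vector, so continuity and Lipschitz bounds
  can be proved factor by factor.\<close>

lemma dcovec_alt: "dcovec (LL x) (QQ x) (SS x) (TT x) n u h v =
   dpairing (LL x) (QQ x) (SS x) (TT x) n u h v * (1 / pairing (LL x) (QQ x) n u u)
   - pairing (LL x) (QQ x) n u v * (1 / pairing (LL x) (QQ x) n u u)
     * dpairing (LL x) (QQ x) (SS x) (TT x) n u h u * (1 / pairing (LL x) (QQ x) n u u)"
  by (simp add: dcovec_def kproj_def dpairing_linear covec_def diff_divide_distrib)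

lemma dcovec_cont:
  assumes "\<And>x. x \<in> S \<Longrightarrow> u \<in> Ku x" "u \<noteq> 0"
  shows "continuous_on S (\<lambda>x. dcovec (LL x) (QQ x) (SS x) (TT x) n u h v)"
proof -
  have "pairing (LL x) (QQ x) n u u \<noteq> 0" if "x \<in> S" for x
    using dominated_seq.pairing_pos[OF dominated, of u x n] assms(1)[OF that] assms(2) by simp
  then show ?thesis
    unfolding dcovec_alt by (intro continuous_intros dpairing_cont pairing_cont) auto
qed

section \<open>Limit covectors and their kernels\<close>

abbreviation "stab x \<equiv> {v. \<forall>n. blprod (LL x) n v \<in> Ks (fwd F n x)}"

definition "covec_vec u n x = (\<Sum>i\<in>Basis. covec (LL x) (QQ x) n u i *\<^sub>R i)"
definition "dcovec_vec u n x h = (\<Sum>i\<in>Basis. dcovec (LL x) (QQ x) (SS x) (TT x) n u h i *\<^sub>R i)"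

text \<open>The constant of \<open>dcovec_Cauchy\<close> summed over an orthonormal basis; it is
  large enough to bound the covectors themselves as well.\<close>

definition "K0 = real DIM('a) * (72 * C ^ 5 * M / (1 - q))"

lemma K0: "1 \<le> K0" "real DIM('a) * C \<le> K0"
proof -
  have "C * 1 \<le> C ^ 5 * M" using C1 M1 power_increasing[of 1 5 C] by (intro mult_mono) auto
  also have "\<dots> \<le> C ^ 5 * M * (1 / (1 - q))" using mult_left_mono[of 1 "1 / (1 - q)" "C ^ 5 * M"] q C1 M1 by simp
  finally have "C \<le> C ^ 5 * M / (1 - q)" by simp
  then have 1: "C \<le> 72 * C ^ 5 * M / (1 - q)" using C1 by simp
  then show "real DIM('a) * C \<le> K0" unfolding K0_def by (intro mult_left_mono) auto
  moreover have "1 * 1 \<le> real DIM('a) * C" using C1 DIM_positive by (intro mult_mono) auto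
  ultimately show "1 \<le> K0" by linarith
qed

lemma covec_vec_inner: "covec_vec u n x \<bullet> v = covec (LL x) (QQ x) n u v"
proof -
  have lin: "linear (covec (LL x) (QQ x) n u)"
    by (rule linearI) (simp_all add: covec_add covec_scaleR)
  have "covec (LL x) (QQ x) n u v = covec (LL x) (QQ x) n u (\<Sum>i\<in>Basis. (v \<bullet> i) *\<^sub>R i)"
    by (simp add: euclidean_representation)
  also have "\<dots> = (\<Sum>i\<in>Basis. (v \<bullet> i) * covec (LL x) (QQ x) n u i)"
    by (simp add: linear_sum[OF lin] linear_cmul[OF lin])
  finally show ?thesis by (simp add: covec_vec_def inner_sum_left mult.commute[of _ "_ \<bullet> v"] inner_commute[of v])
qed

lemma covec_vec_deriv:
  assumes "u \<in> Ku x" "u \<noteq> 0"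
  shows "(covec_vec u n has_derivative dcovec_vec u n x) (at x)"
  unfolding covec_vec_def[abs_def] dcovec_vec_def[abs_def]
  by (intro has_derivative_sum has_derivative_scaleR_left covec_deriv assms)

lemma norm_Basis_sum_le:
  assumes "\<And>i::'a. i \<in> Basis \<Longrightarrow> \<bar>f i\<bar> \<le> b"
  shows "norm (\<Sum>i\<in>Basis. f i *\<^sub>R (i::'a)) \<le> real DIM('a) * b"
  by (rule sum_norm_bound) (use assms in simp)

context
  fixes u :: 'a and S :: "'a set"
  assumes u: "norm u = 1" and uKu: "\<And>x. x \<in> S \<Longrightarrow> u \<in> Ku x"
begin

lemma u_nz: "u \<noteq> 0" using u by auto

lemma dcovec_vec_Cauchy:
  assumes "x \<in> S" "n \<le> m"
  shows "norm (dcovec_vec u n x h - dcovec_vec u m x h) \<le> K0 * q ^ n * norm h"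
proof -
  have "dcovec_vec u n x h - dcovec_vec u m x h = (\<Sum>i\<in>Basis. (dcovec (LL x) (QQ x) (SS x) (TT x) n u h i - dcovec (LL x) (QQ x) (SS x) (TT x) m u h i) *\<^sub>R i)"
    by (simp add: dcovec_vec_def sum_subtractf scaleR_left_diff_distrib)
  also have "norm \<dots> \<le> real DIM('a) * (72 * C ^ 5 * M / (1 - q) * norm h * q ^ n)"
  proof (rule norm_Basis_sum_le)
    fix i :: 'a assume "i \<in> Basis"
    then show "\<bar>dcovec (LL x) (QQ x) (SS x) (TT x) n u h i - dcovec (LL x) (QQ x) (SS x) (TT x) m u h i\<bar>
       \<le> 72 * C ^ 5 * M / (1 - q) * norm h * q ^ n"
      using dominated_seq.dcovec_Cauchy[OF dominated, of u x "SS x" M "TT x" n m h i]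
        uKu[OF assms(1)] u D2_bound DQ_bound assms(2) by simp
  qed
  finally show ?thesis by (simp add: K0_def mult_ac)
qed

text \<open>At n = 0 the Duhamel sum is empty and only the rest term remains. Together with the
  convergence estimate from n = 0 on, this bounds the derivative of the limit by
  \<open>2 * K0\<close>.\<close>

lemma dcovec_vec_0_bound:
  assumes "x \<in> S" shows "norm (dcovec_vec u 0 x h) \<le> K0 * norm h"
proof -
  have "norm (dcovec_vec u 0 x h) \<le> real DIM('a) * (72 * C ^ 5 * M / (1 - q) * norm h)"
    unfolding dcovec_vec_def
  proof (rule norm_Basis_sum_le)
    fix i :: 'a assume i: "i \<in> Basis"
    have "\<bar>dcovec (LL x) (QQ x) (SS x) (TT x) 0 u h i\<bar> \<le> 24 * C ^ 5 * M / (1 - q) * norm h * norm i * q ^ 0"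
      using dominated_seq.restterm_bound[OF dominated, of u x "SS x" M "TT x" 0 h i]
        dominated_seq.dcovec_split[OF dominated, of u x "SS x" M "TT x" 0 h i]
        uKu[OF assms(1)] u D2_bound DQ_bound by simp
    also have "\<dots> = 24 * (C ^ 5 * M / (1 - q) * norm h)" using i by simp
    also have "\<dots> \<le> 72 * (C ^ 5 * M / (1 - q) * norm h)"
      by (intro mult_right_mono mult_nonneg_nonneg divide_nonneg_pos) (use C1 M1 q in auto)
    finally show "\<bar>dcovec (LL x) (QQ x) (SS x) (TT x) 0 u h i\<bar> \<le> 72 * C ^ 5 * M / (1 - q) * norm h" by simp
  qed
  then show ?thesis by (simp add: K0_def mult_ac)
qed

lemma covec_vec_Cauchy:
  assumes "x \<in> S" "n \<le> m"
  shows "norm (covec_vec u n x - covec_vec u m x) \<le> real DIM('a) * (2 * C ^ 3) * q ^ n"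
proof -
  have "covec_vec u n x - covec_vec u m x = (\<Sum>i\<in>Basis. (covec (LL x) (QQ x) n u i - covec (LL x) (QQ x) m u i) *\<^sub>R i)"
    by (simp add: covec_vec_def sum_subtractf scaleR_left_diff_distrib)
  also have "norm \<dots> \<le> real DIM('a) * (2 * C ^ 3 * q ^ n)"
  proof (rule norm_Basis_sum_le)
    fix i :: 'a assume i: "i \<in> Basis"
    have ge: "1 \<le> norm (blprod (LL x) n u)"
      using dominated_seq.A_Ku_ge[OF dominated, of u x n] uKu[OF assms(1)] u by simp
    have "\<bar>covec (LL x) (QQ x) n u i - covec (LL x) (QQ x) m u i\<bar> * 1
       \<le> \<bar>covec (LL x) (QQ x) n u i - covec (LL x) (QQ x) m u i\<bar> * norm (blprod (LL x) n u)"
      by (intro mult_left_mono ge) auto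
    also have "\<dots> \<le> 2 * C ^ 3 * q ^ n * norm i"
      using dominated_seq.covec_Cauchy[OF dominated, of u x n m i] uKu[OF assms(1)] u_nz assms(2) by simp
    finally show "\<bar>covec (LL x) (QQ x) n u i - covec (LL x) (QQ x) m u i\<bar> \<le> 2 * C ^ 3 * q ^ n"
      using i by simp
  qed
  finally show ?thesis by (simp add: mult_ac)
qed

lemma covec_vec_bound:
  assumes "x \<in> S" shows "norm (covec_vec u n x) \<le> K0"
proof -
  have "norm (covec_vec u n x) \<le> real DIM('a) * C"
    unfolding covec_vec_def
  proof (rule norm_Basis_sum_le)
    fix i :: 'a assume i: "i \<in> Basis"
    show "\<bar>covec (LL x) (QQ x) n u i\<bar> \<le> C"
      using dominated_seq.covec_bound[OF dominated, of u x n i] uKu[OF assms(1)] u u_nz i by simp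
  qed
  then show ?thesis using K0(2) by linarith
qed

lemma geometric_tendsto: "(\<lambda>n. c * q ^ n) \<longlonglongrightarrow> 0"
proof -
  have "(\<lambda>n. c * q ^ n) \<longlonglongrightarrow> c * 0" by (intro tendsto_intros LIMSEQ_realpow_zero) (use q in auto)
  then show ?thesis by simp
qed

lemma geometric_Cauchy_convergent:
  fixes X :: "nat \<Rightarrow> 'a"
  assumes "\<And>n m. n \<le> m \<Longrightarrow> norm (X n - X m) \<le> c * q ^ n"
  obtains l where "X \<longlonglongrightarrow> l" "\<And>n. norm (X n - l) \<le> c * q ^ n"
proof -
  have "Cauchy X"
  proof (rule CauchyI')
    fix e :: real assume "e > 0"
    then have "\<forall>\<^sub>F n in sequentially. c * q ^ n < e"
      using order_tendstoD(2)[OF geometric_tendsto] by blast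
    then obtain N where N: "\<And>n. n \<ge> N \<Longrightarrow> c * q ^ n < e" by (auto simp: eventually_sequentially)
    have "dist (X m) (X n) < e" if "m \<ge> N" "n > m" for m n
      using assms[of m n] N[of m] that by (simp add: dist_norm)
    then show "\<exists>M. \<forall>m\<ge>M. \<forall>n>m. dist (X m) (X n) < e" by blast
  qed
  then obtain l where l: "X \<longlonglongrightarrow> l" using Cauchy_convergent convergent_def by blast
  have "norm (X n - l) \<le> c * q ^ n" for n
  proof (rule Lim_bounded)
    show "(\<lambda>m. norm (X n - X m)) \<longlonglongrightarrow> norm (X n - l)" by (intro tendsto_intros l)
    show "\<forall>m\<ge>n. norm (X n - X m) \<le> c * q ^ n" using assms by blast
  qed
  then show ?thesis using that l by blast
qed

text \<open>If w . v = 0, the kernel projections of \<open>v\<close> converge to \<open>v\<close>,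
  and for fixed n their images at time n eventually lie in the closed stable cone. Conversely, a
  vector that stays in the stable cones is contracted like q^n, so \<open>covec_A_bound\<close>
  sends its covectors to 0.\<close>

lemma limit_kernel:
  assumes x: "x \<in> S" and lim: "(\<lambda>n. covec_vec u n x) \<longlonglongrightarrow> w"
  shows "w \<bullet> v = 0 \<longleftrightarrow> v \<in> stab x"
proof -
  note ux = uKu[OF x]
  have lim': "(\<lambda>n. covec (LL x) (QQ x) n u v) \<longlonglongrightarrow> w \<bullet> v"
    unfolding covec_vec_inner[symmetric] by (intro tendsto_intros lim)
  show ?thesis
  proof
    assume 0: "w \<bullet> v = 0"
    have "blprod (LL x) n v \<in> Ks (fwd F n x)" for n
    proof (rule Lim_in_closed_set[OF Ks_closed])
      have "(\<lambda>m. kproj (LL x) (QQ x) m u v) \<longlonglongrightarrow> v - (w \<bullet> v) *\<^sub>R u"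
        unfolding kproj_def by (intro tendsto_intros lim')
      then show "(\<lambda>m. blprod (LL x) n (kproj (LL x) (QQ x) m u v)) \<longlonglongrightarrow> blprod (LL x) n v"
        using 0 by (intro tendsto_intros) simp
      show "\<forall>\<^sub>F m in sequentially. blprod (LL x) n (kproj (LL x) (QQ x) m u v) \<in> Ks (fwd F n x)"
        using dominated_seq.A_kproj[OF dominated, of u x n _ v] ux u_nz
        by (auto intro: eventually_sequentiallyI[of n])
    qed simp
    then show "v \<in> stab x" by simp
  next
    assume v: "v \<in> stab x"
    have "norm (covec (LL x) (QQ x) n u v) \<le> (C\<^sup>2 * norm v) * q ^ n" for n
    proof -
      have ge: "1 \<le> norm (blprod (LL x) n u)"
        using dominated_seq.A_Ku_ge[OF dominated, of u x n] ux u by simp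
      have "\<bar>covec (LL x) (QQ x) n u v\<bar> * 1 \<le> \<bar>covec (LL x) (QQ x) n u v\<bar> * norm (blprod (LL x) n u)"
        by (intro mult_left_mono ge) auto
      also have "\<dots> \<le> C\<^sup>2 * norm (blprod (LL x) n v)"
        using dominated_seq.covec_A_bound[OF dominated, of u x n v] ux u_nz by simp
      also have "\<dots> \<le> C\<^sup>2 * (q ^ n * norm v)"
        using dominated_seq.A_Ks_contract[OF dominated, of x n v] v by (intro mult_left_mono) auto
      finally show ?thesis by (simp add: mult_ac)
    qed
    then have "(\<lambda>n. covec (LL x) (QQ x) n u v) \<longlonglongrightarrow> 0"
      by (intro Lim_null_comparison[OF _ geometric_tendsto[of "C\<^sup>2 * norm v"]] always_eventually) blast
    then show "w \<bullet> v = 0" using lim' LIMSEQ_unique by blast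
  qed
qed

text \<open>Uniform convergence of the derivatives on a convex set makes the limit differentiable.
  The explicit distance between \<open>DW\<close> and the n-th derivative is exported because the
  Hoelder estimate interpolates with it.\<close>

lemma local_limit:
  assumes S: "open S" "convex S"
  obtains W DW where
    "\<And>x. x \<in> S \<Longrightarrow> (W has_derivative blinfun_apply (DW x)) (at x)"
    "\<And>x n h. x \<in> S \<Longrightarrow> norm (dcovec_vec u n x h - DW x h) \<le> K0 * q ^ n * norm h"
    "continuous_on S DW"
    "\<And>x. x \<in> S \<Longrightarrow> 1 \<le> norm (W x)" "\<And>x. x \<in> S \<Longrightarrow> norm (W x) \<le> K0"
    "\<And>x. x \<in> S \<Longrightarrow> norm (DW x) \<le> 2 * K0"
    "\<And>x v. x \<in> S \<Longrightarrow> W x \<bullet> v = 0 \<longleftrightarrow> v \<in> stab x"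
proof -
  have "\<exists>l. (\<lambda>n. dcovec_vec u n x h) \<longlonglongrightarrow> l \<and> (\<forall>n. norm (dcovec_vec u n x h - l) \<le> K0 * norm h * q ^ n)" if "x \<in> S" for x h
    by (rule geometric_Cauchy_convergent[of "\<lambda>n. dcovec_vec u n x h" "K0 * norm h"])
       (use dcovec_vec_Cauchy[OF that] in \<open>auto simp: mult_ac\<close>)
  then obtain g' where g': "\<And>x h. x \<in> S \<Longrightarrow> (\<lambda>n. dcovec_vec u n x h) \<longlonglongrightarrow> g' x h"
    "\<And>x h n. x \<in> S \<Longrightarrow> norm (dcovec_vec u n x h - g' x h) \<le> K0 * norm h * q ^ n" by metis
  have "\<exists>l. (\<lambda>n. covec_vec u n x) \<longlonglongrightarrow> l" if "x \<in> S" for x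
    by (rule geometric_Cauchy_convergent[of "\<lambda>n. covec_vec u n x"]) (use covec_vec_Cauchy[OF that] in auto)
  then obtain l where l: "\<And>x. x \<in> S \<Longrightarrow> (\<lambda>n. covec_vec u n x) \<longlonglongrightarrow> l x" by metis
  have ex: "\<exists>g. \<forall>x\<in>S. (\<lambda>n. covec_vec u n x) \<longlonglongrightarrow> g x \<and> (g has_derivative g' x) (at x within S)"
  proof (cases "S = {}")
    case False
    then obtain x0 where x0: "x0 \<in> S" by blast
    show ?thesis
    proof (rule has_derivative_sequence[where f = "covec_vec u" and f' = "dcovec_vec u", OF S(2) _ _ x0 l[OF x0]])
      show "(covec_vec u n has_derivative dcovec_vec u n x) (at x within S)" if "x \<in> S" for n x
        using covec_vec_deriv[OF uKu[OF that] u_nz] has_derivative_at_withinI by blast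
      show "\<forall>\<^sub>F n in sequentially. \<forall>x\<in>S. \<forall>h. norm (dcovec_vec u n x h - g' x h) \<le> e * norm h" if "e > 0" for e
      proof -
        have "\<forall>\<^sub>F n in sequentially. K0 * q ^ n < e"
          using order_tendstoD(2)[OF geometric_tendsto that] by blast
        then show ?thesis
        proof eventually_elim
          case (elim n)
          show ?case
          proof (intro ballI allI)
            fix x h assume x: "x \<in> S"
            have "norm (dcovec_vec u n x h - g' x h) \<le> K0 * q ^ n * norm h" using g'(2)[OF x, of n h] by (simp add: mult_ac)
            also have "\<dots> \<le> e * norm h" by (intro mult_right_mono) (use elim in auto)
            finally show "norm (dcovec_vec u n x h - g' x h) \<le> e * norm h" .
          qed
        qed
      qed
    qed
  qed simp
  then obtain W where W: "\<And>x. x \<in> S \<Longrightarrow> (\<lambda>n. covec_vec u n x) \<longlonglongrightarrow> W x"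
    "\<And>x. x \<in> S \<Longrightarrow> (W has_derivative g' x) (at x within S)" by blast
  define DW where "DW x = Blinfun (g' x)" for x
  have DW: "blinfun_apply (DW x) = g' x" if "x \<in> S" for x
    unfolding DW_def by (rule bounded_linear_Blinfun_apply[OF has_derivative_bounded_linear[OF W(2)[OF that]]])
  show ?thesis
  proof
    show "(W has_derivative blinfun_apply (DW x)) (at x)" if "x \<in> S" for x
      using W(2)[OF that] DW[OF that] at_within_open[OF that S(1)] by simp
    show near: "norm (dcovec_vec u n x h - DW x h) \<le> K0 * q ^ n * norm h" if "x \<in> S" for x n h
      using g'(2)[OF that, of n h] DW[OF that] by (simp add: mult_ac)
    show "continuous_on S DW"
    proof (rule continuous_on_blinfun_componentwise)
      fix i :: 'a assume i: "i \<in> Basis"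
      show "continuous_on S (\<lambda>x. DW x i)"
      proof (rule uniform_limit_theorem)
        show "\<forall>\<^sub>F n in sequentially. continuous_on S (\<lambda>x. dcovec_vec u n x i)"
          unfolding dcovec_vec_def by (intro always_eventually allI continuous_intros dcovec_cont uKu u_nz)
        show "uniform_limit S (\<lambda>n x. dcovec_vec u n x i) (\<lambda>x. DW x i) sequentially"
        proof (rule uniform_limitI)
          fix e :: real assume "e > 0"
          then have "\<forall>\<^sub>F n in sequentially. K0 * q ^ n < e"
            using order_tendstoD(2)[OF geometric_tendsto] by blast
          then show "\<forall>\<^sub>F n in sequentially. \<forall>x\<in>S. dist (dcovec_vec u n x i) (DW x i) < e"
          proof eventually_elim
            case (elim n)
            then show ?case using near[of _ n i] i by (force simp: dist_norm)
          qed
        qed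
      qed simp
    qed
    \<comment> \<open>The normalisation at \<open>u\<close> passes to the limit: W . u = 1 with
      \<open>u\<close> a unit vector.\<close>
    show "1 \<le> norm (W x)" if x: "x \<in> S" for x
    proof -
      have "(\<lambda>n. covec_vec u n x \<bullet> u) \<longlonglongrightarrow> W x \<bullet> u" by (intro tendsto_intros W(1)[OF x])
      moreover have "covec_vec u n x \<bullet> u = 1" for n
        unfolding covec_vec_inner using dominated_seq.covec_u[OF dominated, of u x n] uKu[OF x] u_nz by simp
      ultimately have "W x \<bullet> u = 1" by (simp add: LIMSEQ_const_iff)
      then show ?thesis using norm_cauchy_schwarz[of "W x" u] u by simp
    qed
    show "norm (W x) \<le> K0" if x: "x \<in> S" for x
      by (rule Lim_bounded[of "\<lambda>n. norm (covec_vec u n x)" _ 0]) (use W(1)[OF x] covec_vec_bound[OF x] in \<open>auto intro: tendsto_norm\<close>)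
    show "norm (DW x) \<le> 2 * K0" if x: "x \<in> S" for x
    proof (rule norm_blinfun_bound)
      show "norm (DW x h) \<le> 2 * K0 * norm h" for h
        using near[OF x, of 0 h] dcovec_vec_0_bound[OF x, of h]
          norm_triangle_ineq4[of "dcovec_vec u 0 x h" "dcovec_vec u 0 x h - DW x h"] by simp
    qed (use K0 in simp)
    show "W x \<bullet> v = 0 \<longleftrightarrow> v \<in> stab x" if x: "x \<in> S" for x v
      by (rule limit_kernel[OF x W(1)[OF x]])
  qed
qed

end

end

section \<open>Lipschitz bounds\<close>

lemma norm_blinfun_apply_diff_le:
  "norm (blinfun_apply f a - blinfun_apply g b) \<le> norm (f - g) * norm a + norm g * norm (a - b)"
proof -
  have eq: "f a - g b = (f - g) a + g (a - b)"
    by (simp add: blinfun.diff_left blinfun.diff_right)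
  show ?thesis unfolding eq
    by (rule norm_triangle_le[OF add_mono[OF norm_blinfun norm_blinfun]])
qed

text \<open>The form in which bounded third derivatives are used.\<close>

locale smooth_seq_lip = smooth_seq +
  assumes D2_lip: "norm (D2 n x - D2 n y) \<le> M * dist x y"
    and DQ_lip: "norm (DQ x - DQ y) \<le> M * dist x y"
begin

lemma lipschitz_of_deriv:
  assumes "\<And>x. (f has_derivative blinfun_apply (Df x)) (at x)" "\<And>x. norm (Df x) \<le> B"
  shows "norm (f x - f y) \<le> B * norm (x - y)"
  by (rule differentiable_bound[of UNIV f "\<lambda>x. blinfun_apply (Df x)"])
     (use assms in \<open>auto simp: norm_blinfun.rep_eq[symmetric]\<close>)

lemma D1_lip: "norm (D1 n x - D1 n y) \<le> M * norm (x - y)"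
  by (rule lipschitz_of_deriv[OF D1_deriv D2_bound])

lemma Q_lip: "norm (Qf x - Qf y) \<le> M * norm (x - y)"
  by (rule lipschitz_of_deriv[OF Q_deriv DQ_bound])

text \<open>Bounds are powers of 2 M rather than M: the extra factor per step absorbs the several
  summands of the product rules.\<close>

lemma M_powers: "0 \<le> M ^ n" "M ^ n \<le> (2 * M) ^ n" "1 \<le> (2 * M) ^ n" "k \<le> n \<Longrightarrow> (2 * M) ^ k \<le> (2 * M) ^ n"
proof -
  have 1: "1 \<le> 2 * M" using M1 by simp
  show "0 \<le> M ^ n" "M ^ n \<le> (2 * M) ^ n" using M1 by (auto intro: power_mono)
  show "1 \<le> (2 * M) ^ n" by (rule one_le_power[OF 1])
  show "(2 * M) ^ k \<le> (2 * M) ^ n" if "k \<le> n" by (rule power_increasing[OF that 1])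
qed

lemma M_power_double: "M ^ (2 * n) = M ^ n * M ^ n"
  by (simp add: mult_2 power_add)

lemma blprod_bound: "norm (blprod (LL x) n) \<le> M ^ n"
proof (induction n)
  case 0
  show ?case by (simp add: norm_blinfun_id_le)
next
  case (Suc n)
  show ?case
    by (simp, rule order_trans[OF norm_blinfun_compose])
       (intro mult_mono D1_bound Suc, use M1 in auto)
qed

lemma blprod_apply_bound: "norm (blprod (LL x) n v) \<le> M ^ n * norm v"
  by (rule order_trans[OF norm_blinfun mult_right_mono[OF blprod_bound]]) simp

lemma fwd_lip: "norm (fwd F n x - fwd F n y) \<le> M ^ n * norm (x - y)"
  by (rule lipschitz_of_deriv[OF fwd_deriv blprod_bound])

lemma orbit_lip:
  "norm (D1 n (fwd F n x) - D1 n (fwd F n y)) \<le> M * M ^ n * norm (x - y)"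
  "norm (D2 n (fwd F n x) - D2 n (fwd F n y)) \<le> M * M ^ n * norm (x - y)"
  "norm (Qf (fwd F n x) - Qf (fwd F n y)) \<le> M * M ^ n * norm (x - y)"
  "norm (DQ (fwd F n x) - DQ (fwd F n y)) \<le> M * M ^ n * norm (x - y)"
proof -
  have *: "M * norm (fwd F n x - fwd F n y) \<le> M * M ^ n * norm (x - y)"
    using mult_left_mono[OF fwd_lip[of n x y], of M] M1 by (simp add: mult_ac)
  show "norm (D1 n (fwd F n x) - D1 n (fwd F n y)) \<le> M * M ^ n * norm (x - y)"
    "norm (D2 n (fwd F n x) - D2 n (fwd F n y)) \<le> M * M ^ n * norm (x - y)"
    "norm (Qf (fwd F n x) - Qf (fwd F n y)) \<le> M * M ^ n * norm (x - y)"
    "norm (DQ (fwd F n x) - DQ (fwd F n y)) \<le> M * M ^ n * norm (x - y)"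
    by (rule order_trans[OF _ *], simp add: D1_lip D2_lip[unfolded dist_norm] Q_lip DQ_lip[unfolded dist_norm])+
qed

text \<open>In the induction step the orbits may have separated by M^n and the product may have
  grown by M^n, hence the exponent 2 n.\<close>

lemma blprod_lip: "norm (blprod (LL x) n v - blprod (LL y) n v) \<le> (2 * M) ^ (2 * n) * norm (x - y) * norm v"
proof (induction n)
  case (Suc n)
  have "norm (blprod (LL x) (Suc n) v - blprod (LL y) (Suc n) v)
    \<le> norm (D1 n (fwd F n x) - D1 n (fwd F n y)) * norm (blprod (LL x) n v)
      + norm (D1 n (fwd F n y)) * norm (blprod (LL x) n v - blprod (LL y) n v)"
    unfolding blprod.simps blinfun_compose.rep_eq comp_apply by (rule norm_blinfun_apply_diff_le)
  also have "\<dots> \<le> (M * M ^ n * norm (x - y)) * (M ^ n * norm v) + M * ((2 * M) ^ (2 * n) * norm (x - y) * norm v)"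
    by (intro add_mono mult_mono orbit_lip blprod_apply_bound D1_bound Suc) (use M1 in auto)
  also have "\<dots> = (M * M ^ (2 * n) + M * (2 * M) ^ (2 * n)) * norm (x - y) * norm v"
    unfolding M_power_double by (simp add: algebra_simps)
  also have "\<dots> \<le> (2 * M) ^ (2 * Suc n) * norm (x - y) * norm v"
  proof (intro mult_right_mono)
    have "M * M ^ (2 * n) + M * (2 * M) ^ (2 * n) \<le> M * (2 * M) ^ (2 * n) + M * (2 * M) ^ (2 * n)"
      by (intro add_mono mult_left_mono M_powers) (use M1 in auto)
    also have "\<dots> = (2 * M) ^ (2 * n + 1)" by simp
    also have "\<dots> \<le> (2 * M) ^ (2 * Suc n)" by (rule M_powers) simp
    finally show "M * M ^ (2 * n) + M * (2 * M) ^ (2 * n) \<le> (2 * M) ^ (2 * Suc n)" .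
  qed auto
  finally show ?case .
qed simp

lemma dblprod_bound: "norm (dblprod (LL x) (SS x) n h v) \<le> (2 * M) ^ (2 * n) * norm h * norm v"
proof (induction n)
  case (Suc n)
  have "norm (D2 n (fwd F n x) (blprod (LL x) n h) (blprod (LL x) n v)) \<le> (norm (D2 n (fwd F n x)) * norm (blprod (LL x) n h)) * norm (blprod (LL x) n v)"
    by (intro order_trans[OF norm_blinfun] mult_right_mono norm_blinfun) auto
  also have "\<dots> \<le> (M * (M ^ n * norm h)) * (M ^ n * norm v)"
    by (intro mult_mono D2_bound blprod_apply_bound) (use M1 in auto)
  finally have 1: "norm (D2 n (fwd F n x) (blprod (LL x) n h) (blprod (LL x) n v)) \<le> M * M ^ (2 * n) * norm h * norm v"
    unfolding M_power_double by (simp add: mult_ac)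
  have "norm (D1 n (fwd F n x) (dblprod (LL x) (SS x) n h v)) \<le> M * ((2 * M) ^ (2 * n) * norm h * norm v)"
    by (rule order_trans[OF norm_blinfun]) (intro mult_mono D1_bound Suc, use M1 in auto)
  with 1 have "norm (dblprod (LL x) (SS x) (Suc n) h v) \<le> M * M ^ (2 * n) * norm h * norm v + M * ((2 * M) ^ (2 * n) * norm h * norm v)"
    unfolding dblprod.simps by (rule norm_triangle_le[OF add_mono])
  also have "\<dots> = (M * M ^ (2 * n) + M * (2 * M) ^ (2 * n)) * norm h * norm v"
    by (simp add: algebra_simps)
  also have "\<dots> \<le> (2 * M) ^ (2 * Suc n) * norm h * norm v"
  proof (intro mult_right_mono)
    have "M * M ^ (2 * n) + M * (2 * M) ^ (2 * n) \<le> M * (2 * M) ^ (2 * n) + M * (2 * M) ^ (2 * n)"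
      by (intro add_mono mult_left_mono M_powers) (use M1 in auto)
    also have "\<dots> = (2 * M) ^ (2 * n + 1)" by simp
    also have "\<dots> \<le> (2 * M) ^ (2 * Suc n)" by (rule M_powers) simp
    finally show "M * M ^ (2 * n) + M * (2 * M) ^ (2 * n) \<le> (2 * M) ^ (2 * Suc n)" .
  qed auto
  finally show ?case .
qed simp

text \<open>The step produces five summands, three from varying the second derivative and its two
  slots and two from the recursive term. Each is at most M (2 M)^(4 n) times the norms, and 5 M is
  at most (2 M)^4.\<close>

lemma dblprod_lip:
  "norm (dblprod (LL x) (SS x) n h v - dblprod (LL y) (SS y) n h v) \<le> (2 * M) ^ (4 * n) * norm (x - y) * norm h * norm v"
proof (induction n)
  case (Suc n)
  let ?d = "norm (x - y)" and ?N = "(2 * M) ^ (4 * n)"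
  have N: "M ^ n * M ^ n * M ^ n \<le> ?N" "M ^ n * M ^ n \<le> ?N" "(2 * M) ^ (2 * n) * M ^ n \<le> ?N"
  proof -
    have a: "M ^ k \<le> ?N" if "k \<le> 4 * n" for k
      using M_powers(2)[of k] M_powers(4)[OF that] by linarith
    show "M ^ n * M ^ n * M ^ n \<le> ?N" "M ^ n * M ^ n \<le> ?N"
      unfolding power_add[symmetric] by (intro a, simp)+
    have "(2 * M) ^ (2 * n) * M ^ n \<le> (2 * M) ^ (2 * n) * (2 * M) ^ n"
      by (intro mult_left_mono M_powers) (use M1 in auto)
    also have "\<dots> \<le> ?N" unfolding power_add[symmetric] by (rule M_powers) simp
    finally show "(2 * M) ^ (2 * n) * M ^ n \<le> ?N" .
  qed
  let ?a = "blprod (LL x) n h" and ?b = "blprod (LL x) n v"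
  let ?a' = "blprod (LL y) n h" and ?b' = "blprod (LL y) n v"
  let ?S = "D2 n (fwd F n x)" and ?S' = "D2 n (fwd F n y)"
  let ?z = "dblprod (LL x) (SS x) n h v" and ?z' = "dblprod (LL y) (SS y) n h v"
  have A: "norm (?S ?a - ?S' ?a') * norm ?b \<le> 2 * (M * ?N * ?d * norm h * norm v)"
  proof -
    have "norm (?S ?a - ?S' ?a') \<le> norm (?S - ?S') * norm ?a + norm ?S' * norm (?a - ?a')"
      by (rule norm_blinfun_apply_diff_le)
    also have "\<dots> \<le> (M * M ^ n * ?d) * (M ^ n * norm h) + M * ((2 * M) ^ (2 * n) * ?d * norm h)"
      by (intro add_mono mult_mono orbit_lip blprod_apply_bound D2_bound blprod_lip) (use M1 in auto)
    finally have "norm (?S ?a - ?S' ?a') * norm ?b \<le>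
      ((M * M ^ n * ?d) * (M ^ n * norm h) + M * ((2 * M) ^ (2 * n) * ?d * norm h)) * (M ^ n * norm v)"
      by (intro mult_mono blprod_apply_bound) (use M1 in auto)
    also have "\<dots> = (M ^ n * M ^ n * M ^ n) * (M * ?d * norm h * norm v) + ((2 * M) ^ (2 * n) * M ^ n) * (M * ?d * norm h * norm v)"
      by (simp add: algebra_simps)
    also have "\<dots> \<le> ?N * (M * ?d * norm h * norm v) + ?N * (M * ?d * norm h * norm v)"
      by (intro add_mono mult_right_mono N) (use M1 in auto)
    finally show ?thesis by (simp add: mult_ac)
  qed
  have B: "norm (?S' ?a') * norm (?b - ?b') \<le> M * ?N * ?d * norm h * norm v"
  proof -
    have "norm (?S' ?a') * norm (?b - ?b') \<le> (M * (M ^ n * norm h)) * ((2 * M) ^ (2 * n) * ?d * norm v)"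
      by (intro mult_mono order_trans[OF norm_blinfun] D2_bound blprod_apply_bound blprod_lip) (use M1 in auto)
    also have "\<dots> = ((2 * M) ^ (2 * n) * M ^ n) * (M * ?d * norm h * norm v)" by (simp add: mult_ac)
    also have "\<dots> \<le> ?N * (M * ?d * norm h * norm v)" by (intro mult_right_mono N) (use M1 in auto)
    finally show ?thesis by (simp add: mult_ac)
  qed
  have AB: "norm (?S ?a ?b - ?S' ?a' ?b') \<le> 3 * (M * ?N * ?d * norm h * norm v)"
    using norm_blinfun_apply_diff_le[of "?S ?a" ?b "?S' ?a'" ?b'] A B by linarith
  have D: "norm (D1 n (fwd F n x) ?z - D1 n (fwd F n y) ?z') \<le> 2 * (M * ?N * ?d * norm h * norm v)"
  proof -
    have "norm (D1 n (fwd F n x) ?z - D1 n (fwd F n y) ?z') \<le>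
       norm (D1 n (fwd F n x) - D1 n (fwd F n y)) * norm ?z + norm (D1 n (fwd F n y)) * norm (?z - ?z')"
      by (rule norm_blinfun_apply_diff_le)
    also have "\<dots> \<le> (M * M ^ n * ?d) * ((2 * M) ^ (2 * n) * norm h * norm v) + M * (?N * ?d * norm h * norm v)"
      by (intro add_mono mult_mono orbit_lip dblprod_bound D1_bound Suc) (use M1 in auto)
    also have "\<dots> = ((2 * M) ^ (2 * n) * M ^ n) * (M * ?d * norm h * norm v) + M * (?N * ?d * norm h * norm v)"
      by (simp add: mult_ac)
    also have "\<dots> \<le> ?N * (M * ?d * norm h * norm v) + M * (?N * ?d * norm h * norm v)"
      by (intro add_mono mult_right_mono N order_refl) (use M1 in auto)
    finally show ?thesis by (simp add: mult_ac)
  qed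
  have "norm (dblprod (LL x) (SS x) (Suc n) h v - dblprod (LL y) (SS y) (Suc n) h v)
     \<le> norm (?S ?a ?b - ?S' ?a' ?b') + norm (D1 n (fwd F n x) ?z - D1 n (fwd F n y) ?z')"
    unfolding dblprod.simps by (rule order_trans[OF eq_refl norm_triangle_ineq]) (simp add: algebra_simps)
  also have "\<dots> \<le> 5 * (M * ?N * ?d * norm h * norm v)" using AB D by linarith
  also have "\<dots> = (5 * M) * (?N * ?d * norm h * norm v)" by simp
  also have "\<dots> \<le> (2 * M) ^ 4 * (?N * ?d * norm h * norm v)"
  proof (intro mult_right_mono)
    have "5 * M \<le> 16 * M ^ 4" using power_increasing[of 1 4 M] M1 by simp
    then show "5 * M \<le> (2 * M) ^ 4" by (simp add: power_mult_distrib)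
  qed (use M1 in auto)
  also have "\<dots> = (2 * M) ^ (4 * Suc n) * ?d * norm h * norm v" by (simp add: power_add mult_ac)
  finally show ?case .
qed simp

text \<open>One exponential rate for all factors of \<open>dcovec\<close>. A generous choice costs
  only in the size of the Hoelder exponent.\<close>

definition "\<Lambda> = (2 * M) ^ 4"

lemma \<Lambda>: "1 < \<Lambda>" "(2 * M) ^ (4 * n) = \<Lambda> ^ n" "k \<le> 4 * n \<Longrightarrow> (2 * M) ^ k \<le> \<Lambda> ^ n"
proof -
  show 1: "1 < \<Lambda>" unfolding \<Lambda>_def using M1 by (intro one_less_power) auto
  show "(2 * M) ^ (4 * n) = \<Lambda> ^ n" by (simp add: \<Lambda>_def power_mult)
  then show "k \<le> 4 * n \<Longrightarrow> (2 * M) ^ k \<le> \<Lambda> ^ n" using M_powers(4)[of k "4 * n"] by simp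
qed

lemma M_power_le_\<Lambda>: "M ^ n \<le> \<Lambda> ^ n"
  using M_powers(2)[of n] \<Lambda>(3)[of n n] by linarith

sublocale dist_on dist S for S :: "'a set"
  by unfold_locales auto

text \<open>A common bound for the values of \<open>Qf\<close>, controlled by \<open>C\<close>, and
  for its derivative and Lipschitz constants, controlled by \<open>M\<close>.\<close>

definition "G = C + M"

lemma G: "1 \<le> G" "M \<le> G" "C \<le> G" using C1 M1 by (auto simp: G_def)

text \<open>The prefactors of the bounds for one pairing, one \<open>dpairing\<close> and two
  reciprocals of pairings; the 32 covers the factors 2 of the product rules.\<close>

definition "H0 = 32 * (4 * G) * (16 * G) * (4 * C\<^sup>2 * G) * (4 * C\<^sup>2 * G)"

lemma H0: "0 \<le> H0" unfolding H0_def using G C1 by simp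

section \<open>Exponential Lipschitz bounds for the differentiated covectors\<close>

context
  fixes u :: 'a and S :: "'a set"
  assumes u: "norm u = 1" and uKu: "\<And>x. x \<in> S \<Longrightarrow> u \<in> Ku x"
begin

abbreviation "blS \<equiv> bdd_lip dist S"

lemma bl_blprod: assumes "norm v \<le> 1" shows "blS (\<Lambda> ^ n) (\<lambda>x. blprod (LL x) n v)"
proof (rule bdd_lipI)
  show "norm (blprod (LL x) n v) \<le> \<Lambda> ^ n" for x
  proof -
    have "norm (blprod (LL x) n v) \<le> M ^ n * norm v" by (rule blprod_apply_bound)
    also have "\<dots> \<le> \<Lambda> ^ n * 1" by (intro mult_mono M_power_le_\<Lambda> assms) (use \<Lambda>(1) in auto)
    finally show ?thesis by simp
  qed
  show "norm (blprod (LL x) n v - blprod (LL y) n v) \<le> \<Lambda> ^ n * dist x y" for x y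
  proof -
    have "norm (blprod (LL x) n v - blprod (LL y) n v) \<le> (2 * M) ^ (2 * n) * norm (x - y) * norm v" by (rule blprod_lip)
    also have "\<dots> \<le> \<Lambda> ^ n * norm (x - y) * 1"
      by (intro mult_mono assms \<Lambda>(3)) (use \<Lambda>(1) in auto)
    finally show ?thesis by (simp add: dist_norm)
  qed
qed

lemma bl_dblprod: assumes "norm h \<le> 1" "norm v \<le> 1" shows "blS (\<Lambda> ^ n) (\<lambda>x. dblprod (LL x) (SS x) n h v)"
proof (rule bdd_lipI)
  show "norm (dblprod (LL x) (SS x) n h v) \<le> \<Lambda> ^ n" for x
  proof -
    have "norm (dblprod (LL x) (SS x) n h v) \<le> (2 * M) ^ (2 * n) * norm h * norm v" by (rule dblprod_bound)
    also have "\<dots> \<le> \<Lambda> ^ n * 1 * 1" by (intro mult_mono \<Lambda>(3) assms) (use \<Lambda>(1) in auto)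
    finally show ?thesis by simp
  qed
  show "norm (dblprod (LL x) (SS x) n h v - dblprod (LL y) (SS y) n h v) \<le> \<Lambda> ^ n * dist x y" for x y
  proof -
    have "norm (dblprod (LL x) (SS x) n h v - dblprod (LL y) (SS y) n h v)
      \<le> (2 * M) ^ (4 * n) * norm (x - y) * norm h * norm v" by (rule dblprod_lip)
    also have "\<dots> \<le> \<Lambda> ^ n * norm (x - y) * 1 * 1"
      by (intro mult_mono assms \<Lambda>(3)) (use \<Lambda>(1) in auto)
    finally show ?thesis by (simp add: dist_norm)
  qed
qed

lemma bl_Q: "blS (G * \<Lambda> ^ n) (\<lambda>x. Qf (fwd F n x))" and bl_DQ: "blS (G * \<Lambda> ^ n) (\<lambda>x. DQ (fwd F n x))"
proof -
  have L1: "1 \<le> \<Lambda> ^ n" using \<Lambda>(1) by (intro one_le_power) auto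
  have L2: "M * M ^ n * norm (x - y) \<le> G * \<Lambda> ^ n * dist x y" for x y :: 'a
    unfolding dist_norm by (intro mult_mono G M_power_le_\<Lambda>) (use G M1 \<Lambda>(1) in auto)
  have L3: "G * 1 \<le> G * \<Lambda> ^ n" by (intro mult_left_mono L1) (use G in auto)
  have Qb: "norm (Qf (fwd F n x)) \<le> C" for x by (rule dominated_seq.Q_bound[OF dominated])
  have b: "C \<le> G * \<Lambda> ^ n" "M \<le> G * \<Lambda> ^ n" using L3 G by linarith+
  show "blS (G * \<Lambda> ^ n) (\<lambda>x. Qf (fwd F n x))"
    by (intro bdd_lipI order_trans[OF orbit_lip(3) L2] order_trans[OF Qb b(1)])
  show "blS (G * \<Lambda> ^ n) (\<lambda>x. DQ (fwd F n x))"
    by (intro bdd_lipI order_trans[OF orbit_lip(4) L2] order_trans[OF DQ_bound b(2)])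
qed

lemma bl_pairing:
  assumes "norm v \<le> 1" shows "blS (4 * G * \<Lambda> ^ (3 * n)) (\<lambda>x. pairing (LL x) (QQ x) n u v)"
proof -
  have "blS (2 * (2 * (G * \<Lambda> ^ n) * \<Lambda> ^ n) * \<Lambda> ^ n) (\<lambda>x. pairing (LL x) (QQ x) n u v)"
    unfolding pairing_def by (intro bl_inner bl_blinfun_apply bl_Q bl_blprod assms) (use u in auto)
  also have "2 * (2 * (G * \<Lambda> ^ n) * \<Lambda> ^ n) * \<Lambda> ^ n = 4 * G * \<Lambda> ^ (3 * n)"
    by (simp add: power_add eval_nat_numeral mult_ac)
  finally show ?thesis .
qed

lemma bl_dpairing:
  assumes "norm h \<le> 1" "norm v \<le> 1" shows "blS (16 * G * \<Lambda> ^ (4 * n)) (\<lambda>x. dpairing (LL x) (QQ x) (SS x) (TT x) n u h v)"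
proof -
  let ?L = "\<Lambda> ^ n"
  have "blS (2 * (2 * (2 * (G * ?L) * ?L) * ?L) * ?L + 2 * (2 * (G * ?L) * ?L) * ?L + 2 * (2 * (G * ?L) * ?L) * ?L)
     (\<lambda>x. dpairing (LL x) (QQ x) (SS x) (TT x) n u h v)"
    unfolding dpairing_def
    by (intro bl_add bl_inner bl_blinfun_apply bl_Q bl_DQ bl_blprod bl_dblprod assms) (use u in auto)
  moreover have "2 * (2 * (2 * (G * ?L) * ?L) * ?L) * ?L + 2 * (2 * (G * ?L) * ?L) * ?L + 2 * (2 * (G * ?L) * ?L) * ?L
      \<le> 16 * G * \<Lambda> ^ (4 * n)"
  proof -
    have 1: "2 * (2 * (2 * (G * ?L) * ?L) * ?L) * ?L = 8 * (G * \<Lambda> ^ (4 * n))"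
      "2 * (2 * (G * ?L) * ?L) * ?L = 4 * (G * \<Lambda> ^ (3 * n))"
      by (simp_all add: power_add eval_nat_numeral mult_ac)
    have "G * \<Lambda> ^ (3 * n) \<le> G * \<Lambda> ^ (4 * n)" by (intro mult_left_mono power_increasing) (use G \<Lambda>(1) in auto)
    then show ?thesis using 1 by linarith
  qed
  ultimately show ?thesis by (rule bl_mono)
qed

lemma bl_inverse_pairing: "blS (4 * C\<^sup>2 * G * \<Lambda> ^ (3 * n)) (\<lambda>x. 1 / pairing (LL x) (QQ x) n u u)"
proof -
  have "blS (C\<^sup>2 * (4 * G * \<Lambda> ^ (3 * n))) (\<lambda>x. 1 / pairing (LL x) (QQ x) n u u)"
  proof (rule bl_inverse[OF bl_pairing C1])
    have unz: "u \<noteq> 0" using u by auto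
    show "1 \<le> C * pairing (LL x) (QQ x) n u u" if "x \<in> S" for x
    proof -
      have "1 \<le> norm (blprod (LL x) n u)"
        using dominated_seq.A_Ku_ge[OF dominated, of u x n] uKu[OF that] u by simp
      then have "1 \<le> (norm (blprod (LL x) n u))\<^sup>2" by simp
      then show ?thesis using dominated_seq.pairing_ge[OF dominated, of u x n] uKu[OF that] unz by simp
    qed
    have "1 * 1 \<le> G * \<Lambda> ^ (3 * n)" by (intro mult_mono G one_le_power) (use \<Lambda>(1) G in auto)
    then show "1 \<le> 4 * G * \<Lambda> ^ (3 * n)" by simp
  qed (use u in simp)
  then show ?thesis by (simp add: mult_ac)
qed

text \<open>13 = 3 + 4 + 3 + 3, from a pairing, a \<open>dpairing\<close> and two reciprocals in the
  second summand of \<open>dcovec_alt\<close>. The first summand lacks one pairing and one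
  reciprocal, whose bounds are at least 1, so it is absorbed.\<close>

lemma bl_dcovec:
  assumes "norm h \<le> 1" "norm v \<le> 1"
  shows "blS (H0 * \<Lambda> ^ (13 * n)) (\<lambda>x. dcovec (LL x) (QQ x) (SS x) (TT x) n u h v)"
proof -
  let ?p = "4 * G * \<Lambda> ^ (3 * n)" and ?d = "16 * G * \<Lambda> ^ (4 * n)" and ?i = "4 * C\<^sup>2 * G * \<Lambda> ^ (3 * n)"
  have "blS (2 * ?d * ?i + 2 * (2 * (2 * ?p * ?i) * ?d) * ?i) (\<lambda>x. dcovec (LL x) (QQ x) (SS x) (TT x) n u h v)"
    unfolding dcovec_alt by (intro bl_diff bl_mult bl_dpairing bl_pairing bl_inverse_pairing assms) (use u in auto)
  moreover have "2 * ?d * ?i + 2 * (2 * (2 * ?p * ?i) * ?d) * ?i \<le> H0 * \<Lambda> ^ (13 * n)"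
  proof -
    let ?L = "\<Lambda> ^ n"
    have L: "1 \<le> \<Lambda> ^ k" for k using \<Lambda>(1) by (intro one_le_power) auto
    have C2: "1 \<le> C\<^sup>2" using C1 by (intro one_le_power)
    have p1: "1 \<le> ?p" using mult_mono[OF G(1) L[of "3 * n"]] G by simp
    have "1 * 1 * 1 \<le> C\<^sup>2 * G * \<Lambda> ^ (3 * n)" by (intro mult_mono C2 G L) (use G in auto)
    then have i1: "1 \<le> ?i" by simp
    have d0: "0 \<le> ?d * ?i" using G \<Lambda>(1) by simp
    have "(?d * ?i) * (1 * 1) \<le> (?d * ?i) * (?p * ?i)" by (intro mult_left_mono mult_mono p1 i1 d0) (use p1 in auto)
    then have "2 * ?d * ?i + 2 * (2 * (2 * ?p * ?i) * ?d) * ?i \<le> 32 * (?p * ?d * ?i * ?i)"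
      using d0 by (simp add: algebra_simps)
    also have "\<dots> = H0 * (\<Lambda> ^ (3 * n) * \<Lambda> ^ (4 * n) * \<Lambda> ^ (3 * n) * \<Lambda> ^ (3 * n))"
      by (simp add: H0_def mult_ac)
    also have "\<Lambda> ^ (3 * n) * \<Lambda> ^ (4 * n) * \<Lambda> ^ (3 * n) * \<Lambda> ^ (3 * n) = \<Lambda> ^ (13 * n)"
      by (simp flip: power_add)
    finally show ?thesis .
  qed
  ultimately show ?thesis by (rule bl_mono)
qed

lemma dcovec_vec_lip:
  assumes "x \<in> S" "y \<in> S"
  shows "norm (dcovec_vec u n x h - dcovec_vec u n y h) \<le> real DIM('a) * H0 * (\<Lambda> ^ 13) ^ n * norm (x - y) * norm h"
proof -
  have unit: "norm (dcovec_vec u n x h - dcovec_vec u n y h) \<le> real DIM('a) * (H0 * \<Lambda> ^ (13 * n) * dist x y)" if h: "norm h \<le> 1" for h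
  proof -
    have "dcovec_vec u n x h - dcovec_vec u n y h = (\<Sum>i\<in>Basis. (dcovec (LL x) (QQ x) (SS x) (TT x) n u h i - dcovec (LL y) (QQ y) (SS y) (TT y) n u h i) *\<^sub>R i)"
      by (simp add: dcovec_vec_def sum_subtractf scaleR_left_diff_distrib)
    also have "norm \<dots> \<le> real DIM('a) * (H0 * \<Lambda> ^ (13 * n) * dist x y)"
      by (rule norm_Basis_sum_le) (use bdd_lipD(2)[OF bl_dcovec[OF h] assms] in auto)
    finally show ?thesis .
  qed
  show ?thesis
  proof (cases "h = 0")
    case True
    \<comment> \<open>Homogeneity in the direction with the scalar 0: \<open>dcovec\<close> vanishes
      at h = 0.\<close>
    then show ?thesis by (simp add: dcovec_vec_def dcovec_linear(2)[of _ _ _ _ _ _ 0 0, simplified])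
  next
    case False
    define e where "e = h /\<^sub>R norm h"
    have e: "h = norm h *\<^sub>R e" "norm e \<le> 1" using False by (simp_all add: e_def)
    have sc: "dcovec_vec u n z (r *\<^sub>R e) = r *\<^sub>R dcovec_vec u n z e" for z r
      by (simp add: dcovec_vec_def dcovec_linear scaleR_sum_right)
    have "norm (dcovec_vec u n x h - dcovec_vec u n y h) = norm h * norm (dcovec_vec u n x e - dcovec_vec u n y e)"
      by (subst (1 2) e(1)) (simp only: sc scaleR_diff_right[symmetric] norm_scaleR abs_norm_cancel)
    also have "\<dots> \<le> norm h * (real DIM('a) * (H0 * \<Lambda> ^ (13 * n) * dist x y))"
      by (intro mult_left_mono unit e) auto
    also have "\<Lambda> ^ (13 * n) = (\<Lambda> ^ 13) ^ n" by (rule power_mult)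
    finally show ?thesis by (simp only: dist_norm mult_ac)
  qed
qed

end

end

section \<open>Projection fields\<close>

lemma is_orth_proj_line_proj:
  fixes w :: "real ^ 'n"
  assumes "w \<noteq> 0" "\<And>v. w \<bullet> v = 0 \<longleftrightarrow> v \<in> E"
  shows "is_orth_proj E (blinfun_apply (id_blinfun - line_proj w))"
  unfolding is_orth_proj_def
proof (intro conjI allI ballI)
  fix v
  have "w \<bullet> (v - (w \<bullet> v / (w \<bullet> w)) *\<^sub>R w) = 0" using assms(1) by (simp add: inner_diff_right)
  then show "(id_blinfun - line_proj w) v \<in> E"
    using assms(2) by (simp add: blinfun.diff_left line_proj_apply)
next
  fix v z assume "z \<in> E"
  then have "w \<bullet> z = 0" using assms(2) by blast
  then show "(v - (id_blinfun - line_proj w) v) \<bullet> z = 0"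
    by (simp add: blinfun.diff_left line_proj_apply)
qed

text \<open>The difference of the two values lies in \<open>E\<close> and is orthogonal to
  \<open>E\<close>. This uniqueness makes local constructions agree on overlaps and makes the
  projections of periodic fields periodic.\<close>

lemma is_orth_proj_unique:
  fixes P P' :: "real ^ 'n \<Rightarrow> real ^ 'n"
  assumes "is_orth_proj E P" "is_orth_proj E P'"
  shows "P = P'"
proof
  fix v
  let ?d = "P v - P' v"
  have d: "?d \<bullet> w = 0" if "w \<in> E" for w
  proof -
    have "(v - P v) \<bullet> w = 0" "(v - P' v) \<bullet> w = 0" using assms that by (auto simp: is_orth_proj_def)
    then show ?thesis by (simp add: inner_diff_left)
  qed
  have "P v \<in> E" "P' v \<in> E" using assms by (auto simp: is_orth_proj_def)
  then have "?d \<bullet> ?d = 0" using d by (simp add: inner_diff_right)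
  then show "P v = P' v" by simp
qed

text \<open>By uniqueness the local projections agree on overlaps, so the value at x may be taken
  from the ball around x itself. The predicate \<open>R\<close> carries along whatever local control
  of the derivative is at hand.\<close>

lemma glue_projections:
  fixes E :: "real ^ 'n \<Rightarrow> (real ^ 'n) set"
  assumes \<rho>: "0 < \<rho>"
    and loc: "\<And>x0. \<exists>P DP. (\<forall>y\<in>ball x0 \<rho>. is_orth_proj (E y) (blinfun_apply (P y)) \<and> (P has_derivative blinfun_apply (DP y)) (at y)) \<and> R x0 DP"
  obtains P DP where "\<And>x. is_orth_proj (E x) (blinfun_apply (P x))"
    "\<And>x. (P has_derivative blinfun_apply (DP x)) (at x)"
    "\<And>x0. \<exists>D. R x0 D \<and> (\<forall>y\<in>ball x0 \<rho>. DP y = D y)"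
proof -
  obtain P' DP' where P': "\<And>x0 y. y \<in> ball x0 \<rho> \<Longrightarrow> is_orth_proj (E y) (blinfun_apply (P' x0 y))"
    "\<And>x0 y. y \<in> ball x0 \<rho> \<Longrightarrow> (P' x0 has_derivative blinfun_apply (DP' x0 y)) (at y)" "\<And>x0. R x0 (DP' x0)"
    using loc by metis
  define P where "P x = P' x x" for x
  define DP where "DP x = DP' x x" for x
  have self: "x \<in> ball x \<rho>" for x using \<rho> by simp
  have P_eq: "P y = P' x0 y" if "y \<in> ball x0 \<rho>" for x0 y
    using is_orth_proj_unique[OF P'(1)[OF self[of y]] P'(1)[OF that]]
    by (simp add: P_def blinfun_apply_inject)
  have dP: "(P has_derivative blinfun_apply (DP' x0 y)) (at y)" if "y \<in> ball x0 \<rho>" for x0 y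
    by (rule has_derivative_transform_within_open[OF P'(2)[OF that] open_ball that]) (simp add: P_eq)
  show ?thesis
  proof
    show "is_orth_proj (E x) (blinfun_apply (P x))" for x unfolding P_def by (rule P'(1)[OF self])
    show "(P has_derivative blinfun_apply (DP x)) (at x)" for x unfolding DP_def by (rule dP[OF self])
    show "\<exists>D. R x0 D \<and> (\<forall>y\<in>ball x0 \<rho>. DP y = D y)" for x0
    proof (intro exI conjI ballI)
      show "R x0 (DP' x0)" by (rule P'(3))
      fix y assume y: "y \<in> ball x0 \<rho>"
      have "blinfun_apply (DP y) = blinfun_apply (DP' x0 y)"
        unfolding DP_def by (rule has_derivative_unique[OF dP[OF self] dP[OF y]])
      then show "DP y = DP' x0 y" by (simp add: blinfun_apply_inject)
    qed
  qed
qed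

section \<open>Local projections and the Hoelder bound for their derivatives\<close>

context smooth_seq
begin

text \<open>The constant of \<open>line_proj_derivative\<close> for \<open>2 * K0\<close>, which
  bounds \<open>W\<close>, its derivative and its Lipschitz constant.\<close>

definition "Kp = 2000 * (2 * K0) ^ 9"

lemma Kp: "1 \<le> Kp" 
proof -
  have "1 \<le> (2 * K0) ^ 9" using K0 by (intro one_le_power) simp
  then show ?thesis by (simp add: Kp_def)
qed

text \<open>Controlling the variation of \<open>DP\<close> by that of \<open>DW\<close> serves
  twice: here it transfers continuity, in \<open>C1_holder_projection_field\<close> a Hoelder
  bound.\<close>

lemma local_projection:
  fixes u :: 'a and x0 :: 'a
  assumes u: "norm u = 1" and uKu: "\<And>x. x \<in> ball x0 \<rho> \<Longrightarrow> u \<in> Ku x"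
  obtains W DP DW where 
    "\<And>x. x \<in> ball x0 \<rho> \<Longrightarrow> W x \<noteq> 0"
    "\<And>x v. x \<in> ball x0 \<rho> \<Longrightarrow> W x \<bullet> v = 0 \<longleftrightarrow> v \<in> stab x"
    "\<And>x. x \<in> ball x0 \<rho> \<Longrightarrow> ((\<lambda>x. id_blinfun - line_proj (W x)) has_derivative blinfun_apply (DP x)) (at x)"
    "\<And>x. x \<in> ball x0 \<rho> \<Longrightarrow> norm (DP x) \<le> Kp"
    "\<And>x y. x \<in> ball x0 \<rho> \<Longrightarrow> y \<in> ball x0 \<rho> \<Longrightarrow> norm (DP x - DP y) \<le> Kp * (dist x y + norm (DW x - DW y))"
    "\<And>x n h. x \<in> ball x0 \<rho> \<Longrightarrow> norm (dcovec_vec u n x h - blinfun_apply (DW x) h) \<le> K0 * q ^ n * norm h"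
    "continuous_on (ball x0 \<rho>) DP"
proof -
  obtain W DW where W:
    "\<And>x. x \<in> ball x0 \<rho> \<Longrightarrow> (W has_derivative blinfun_apply (DW x)) (at x)"
    "\<And>x n h. x \<in> ball x0 \<rho> \<Longrightarrow> norm (dcovec_vec u n x h - DW x h) \<le> K0 * q ^ n * norm h"
    "continuous_on (ball x0 \<rho>) DW"
    "\<And>x. x \<in> ball x0 \<rho> \<Longrightarrow> 1 \<le> norm (W x)" "\<And>x. x \<in> ball x0 \<rho> \<Longrightarrow> norm (W x) \<le> K0"
    "\<And>x. x \<in> ball x0 \<rho> \<Longrightarrow> norm (DW x) \<le> 2 * K0"
    "\<And>x v. x \<in> ball x0 \<rho> \<Longrightarrow> W x \<bullet> v = 0 \<longleftrightarrow> v \<in> stab x"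
    using local_limit[OF u uKu open_ball convex_ball] by blast
  have WL: "norm (W x - W y) \<le> 2 * K0 * dist x y" if "x \<in> ball x0 \<rho>" "y \<in> ball x0 \<rho>" for x y
    unfolding dist_norm
    by (rule differentiable_bound[of "ball x0 \<rho>" W "\<lambda>x. blinfun_apply (DW x)"])
       (use W(1,6) that in \<open>auto simp: norm_blinfun.rep_eq[symmetric] intro: has_derivative_at_withinI\<close>)
  obtain DP where DP:
    "\<And>x. x \<in> ball x0 \<rho> \<Longrightarrow> ((\<lambda>x. id_blinfun - line_proj (W x)) has_derivative blinfun_apply (DP x)) (at x)"
    "\<And>x. x \<in> ball x0 \<rho> \<Longrightarrow> norm (DP x) \<le> 2000 * (2 * K0) ^ 9"
    "\<And>x y. x \<in> ball x0 \<rho> \<Longrightarrow> y \<in> ball x0 \<rho> \<Longrightarrow> norm (DP x - DP y) \<le> 2000 * (2 * K0) ^ 9 * (dist x y + norm (DW x - DW y))"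
  proof (rule line_proj_derivative[of "ball x0 \<rho>" W DW "2 * K0"])
    show "norm (W x) \<le> 2 * K0" if "x \<in> ball x0 \<rho>" for x using W(5)[OF that] K0 by simp
  qed (use W K0 WL in \<open>auto simp del: mem_ball\<close>)
  have cont: "continuous_on (ball x0 \<rho>) DP"
    unfolding continuous_on_def
  proof
    fix x assume x: "x \<in> ball x0 \<rho>"
    have "((\<lambda>y. Kp * (dist y x + norm (DW y - DW x))) \<longlongrightarrow> Kp * (dist x x + norm (DW x - DW x))) (at x within ball x0 \<rho>)"
      by (intro tendsto_intros) (use W(3) x in \<open>auto simp: continuous_on_def\<close>)
    then have lim: "((\<lambda>y. Kp * (dist y x + norm (DW y - DW x))) \<longlongrightarrow> 0) (at x within ball x0 \<rho>)" by simp
    have "\<forall>\<^sub>F y in at x within ball x0 \<rho>. norm (DP y - DP x) \<le> Kp * (dist y x + norm (DW y - DW x))"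
      unfolding eventually_at_filter Kp_def using DP(3)[OF _ x] by (simp add: always_eventually del: mem_ball)
    then have "((\<lambda>y. DP y - DP x) \<longlongrightarrow> 0) (at x within ball x0 \<rho>)"
      by (rule Lim_null_comparison[OF _ lim])
    then show "(DP \<longlongrightarrow> DP x) (at x within ball x0 \<rho>)" by (simp add: LIM_zero_iff)
  qed
  have "W x \<noteq> 0" if "x \<in> ball x0 \<rho>" for x using W(4)[OF that] by auto
  then show ?thesis using that W(7) DP W(2) cont unfolding Kp_def by blast
qed

end

text \<open>Compare \<open>DW\<close> at two points through the n-th derivative: the error at either
  point is K0 q^n, and the n-th derivative is Lipschitz with a constant of order (\<Lambda>^13)^n.
  Exponent and constant are chosen before \<open>u\<close>, \<open>S\<close> and \<open>DW\<close>,
  because all balls have to share them.\<close>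

lemma (in smooth_seq_lip) DW_holder:
  obtains \<beta> K where "0 < \<beta>" "\<beta> < 1" "0 \<le> K"
    "\<And>u S DW x y. norm u = 1 \<Longrightarrow> (\<And>x. x \<in> S \<Longrightarrow> u \<in> Ku x) \<Longrightarrow> 
       (\<And>x n h. x \<in> S \<Longrightarrow> norm (dcovec_vec u n x h - blinfun_apply (DW x) h) \<le> K0 * q ^ n * norm h) \<Longrightarrow>
       x \<in> S \<Longrightarrow> y \<in> S \<Longrightarrow> dist x y \<le> 1 \<Longrightarrow> norm (DW x - DW y) \<le> K * dist x y powr \<beta>"
proof -
  have L13: "1 < \<Lambda> ^ 13" by (intro one_less_power \<Lambda>(1)) simp
  obtain \<beta> where \<beta>: "0 < \<beta>" "\<beta> < 1"
    "\<And>t r K H. 0 \<le> r \<Longrightarrow> r \<le> 1 \<Longrightarrow> 0 \<le> K \<Longrightarrow> 0 \<le> H \<Longrightarrow> (\<And>n. t \<le> K * q ^ n + H * (\<Lambda> ^ 13) ^ n * r) \<Longrightarrow> t \<le> (K / q + H) * r powr \<beta>"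
    using holder_interpolation[OF q L13] by blast
  define K where "K = 2 * K0 / q + real DIM('a) * H0"
  have "norm (DW x - DW y) \<le> K * dist x y powr \<beta>"
    if u: "norm u = 1" and uKu: "\<And>x. x \<in> S \<Longrightarrow> u \<in> Ku x"
      and near: "\<And>x n h. x \<in> S \<Longrightarrow> norm (dcovec_vec u n x h - blinfun_apply (DW x) h) \<le> K0 * q ^ n * norm h"
      and x: "x \<in> S" and y: "y \<in> S" and d: "dist x y \<le> 1" for u S DW x y
    unfolding K_def
  proof (rule \<beta>(3))
    fix n
    show "norm (DW x - DW y) \<le> 2 * K0 * q ^ n + real DIM('a) * H0 * (\<Lambda> ^ 13) ^ n * dist x y"
    proof (rule norm_blinfun_bound)
      show "0 \<le> 2 * K0 * q ^ n + real DIM('a) * H0 * (\<Lambda> ^ 13) ^ n * dist x y"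
        using K0 q H0 \<Lambda>(1) by (intro add_nonneg_nonneg mult_nonneg_nonneg zero_le_power) auto
      fix h
      have tri: "norm (a - b) \<le> norm (c - a) + norm (c - e) + norm (e - b)" for a b c e :: 'a
        using norm_triangle_ineq4[of "c - b" "c - a"] norm_triangle_ineq[of "c - e" "e - b"] by simp
      have "norm ((DW x - DW y) h) \<le> norm (dcovec_vec u n x h - DW x h) + norm (dcovec_vec u n x h - dcovec_vec u n y h) + norm (dcovec_vec u n y h - DW y h)"
        unfolding blinfun.diff_left by (rule tri)
      also have "\<dots> \<le> K0 * q ^ n * norm h + real DIM('a) * H0 * (\<Lambda> ^ 13) ^ n * norm (x - y) * norm h + K0 * q ^ n * norm h"
        by (intro add_mono near[OF x] near[OF y] dcovec_vec_lip[OF u uKu x y])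
      finally show "norm ((DW x - DW y) h) \<le> (2 * K0 * q ^ n + real DIM('a) * H0 * (\<Lambda> ^ 13) ^ n * dist x y) * norm h"
        by (simp add: algebra_simps dist_norm)
    qed
  qed (use d K0 H0 in auto)
  moreover have "0 \<le> K" using K0 q H0 by (simp add: K_def)
  ultimately show ?thesis using that \<beta>(1,2) by blast
qed

text \<open>The set \<open>stab\<close> of \<open>smooth_seq\<close>, made available outside the
  locale.\<close>

abbreviation tangent_stable where
  "tangent_stable F D1 Ks x \<equiv> {v. \<forall>n. blprod (\<lambda>k. D1 k (fwd F k x)) n v \<in> Ks (fwd F n x)}"

lemma C1_projection_field:
  fixes F :: "nat \<Rightarrow> real ^ 'n \<Rightarrow> real ^ 'n"
  assumes "smooth_seq F D1 D2 Qf DQ Ks Ku \<eta> C M"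
    and \<rho>: "0 < \<rho>" and u: "\<And>x0. \<exists>u. norm u = 1 \<and> (\<forall>x\<in>ball x0 \<rho>. u \<in> Ku x)"
  shows "C1_subspace_field (tangent_stable F D1 Ks)"
proof -
  interpret smooth_seq F D1 D2 Qf DQ Ks Ku \<eta> C M by fact
  have loc: "\<exists>P DP. (\<forall>y\<in>ball x0 \<rho>. is_orth_proj (stab y) (blinfun_apply (P y)) \<and> (P has_derivative blinfun_apply (DP y)) (at y))
      \<and> (continuous_on (ball x0 \<rho>) DP \<and> (\<forall>y\<in>ball x0 \<rho>. subspace (stab y)))" for x0
  proof -
    obtain u where u1: "norm u = 1" "\<And>x. x \<in> ball x0 \<rho> \<Longrightarrow> u \<in> Ku x" using u by blast
    obtain W DP DW where W: "\<And>x. x \<in> ball x0 \<rho> \<Longrightarrow> W x \<noteq> 0"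
    "\<And>x v. x \<in> ball x0 \<rho> \<Longrightarrow> W x \<bullet> v = 0 \<longleftrightarrow> v \<in> stab x"
    "\<And>x. x \<in> ball x0 \<rho> \<Longrightarrow> ((\<lambda>x. id_blinfun - line_proj (W x)) has_derivative blinfun_apply (DP x)) (at x)"
    "\<And>x. x \<in> ball x0 \<rho> \<Longrightarrow> norm (DP x) \<le> Kp"
    "\<And>x y. x \<in> ball x0 \<rho> \<Longrightarrow> y \<in> ball x0 \<rho> \<Longrightarrow> norm (DP x - DP y) \<le> Kp * (dist x y + norm (DW x - DW y))"
    "\<And>x n h. x \<in> ball x0 \<rho> \<Longrightarrow> norm (dcovec_vec u n x h - blinfun_apply (DW x) h) \<le> K0 * q ^ n * norm h"
    "continuous_on (ball x0 \<rho>) DP"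
      using local_projection[OF u1] by blast
    have sub: "subspace (stab y)" if y: "y \<in> ball x0 \<rho>" for y
    proof -
      have "stab y = {v. W y \<bullet> v = 0}" using W(2)[OF y] by auto
      then show ?thesis by (simp only: subspace_hyperplane)
    qed
    have orth: "is_orth_proj (stab y) (blinfun_apply (id_blinfun - line_proj (W y)))" if y: "y \<in> ball x0 \<rho>" for y
      by (rule is_orth_proj_line_proj[OF W(1)[OF y] W(2)[OF y]])
    show ?thesis
      by (intro exI[of _ "\<lambda>x. id_blinfun - line_proj (W x)"] exI[of _ DP] conjI ballI W(3,7) sub orth)
  qed
  obtain P DP where P: "\<And>x. is_orth_proj (stab x) (blinfun_apply (P x))"
    "\<And>x. (P has_derivative blinfun_apply (DP x)) (at x)"
    "\<And>x0. \<exists>D. (continuous_on (ball x0 \<rho>) D \<and> (\<forall>y\<in>ball x0 \<rho>. subspace (stab y))) \<and> (\<forall>y\<in>ball x0 \<rho>. DP y = D y)"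
    using glue_projections[OF \<rho> loc] by blast
  have "isCont DP x" for x
  proof -
    obtain D where D: "continuous_on (ball x \<rho>) D" "\<forall>y\<in>ball x \<rho>. DP y = D y" using P(3) by blast
    then have "continuous_on (ball x \<rho>) DP" using continuous_on_cong by metis
    then show ?thesis using \<rho> by (simp add: continuous_on_eq_continuous_at)
  qed
  then have "C1_map P DP" unfolding C1_map_def using P(2) by (simp add: continuous_at_imp_continuous_on)
  moreover have "subspace (stab x)" for x using P(3)[of x] \<rho> centre_in_ball by blast
  ultimately show ?thesis unfolding C1_subspace_field_def using P(1) by blast
qed

text \<open>Locally \<open>DP\<close> inherits the Hoelder bound of \<open>DW\<close>, because r is
  at most r^\<beta> for r at most 1; a radius of at most 1/2 keeps two points of a ball within
  distance 1. Distant points are handled by the uniform bound on the derivative.\<close>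

lemma C1_holder_projection_field:
  fixes F :: "nat \<Rightarrow> real ^ 'n \<Rightarrow> real ^ 'n"
  assumes "smooth_seq_lip F D1 D2 Qf DQ Ks Ku \<eta> C M"
    and \<rho>: "0 < \<rho>" "\<rho> \<le> 1 / 2" and u: "\<And>x0. \<exists>u. norm u = 1 \<and> (\<forall>x\<in>ball x0 \<rho>. u \<in> Ku x)"
  shows "\<exists>\<beta>. 0 < \<beta> \<and> \<beta> < 1 \<and> C1_holder_subspace_field \<beta> (tangent_stable F D1 Ks)"
proof -
  interpret smooth_seq_lip F D1 D2 Qf DQ Ks Ku \<eta> C M by fact
  obtain \<beta> K where \<beta>: "0 < \<beta>" "\<beta> < 1" "0 \<le> K"
    "\<And>u S DW x y. norm u = 1 \<Longrightarrow> (\<And>x. x \<in> S \<Longrightarrow> u \<in> Ku x) \<Longrightarrow> 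
       (\<And>x n h. x \<in> S \<Longrightarrow> norm (dcovec_vec u n x h - blinfun_apply (DW x) h) \<le> K0 * q ^ n * norm h) \<Longrightarrow>
       x \<in> S \<Longrightarrow> y \<in> S \<Longrightarrow> dist x y \<le> 1 \<Longrightarrow> norm (DW x - DW y) \<le> K * dist x y powr \<beta>"
    using DW_holder by blast
  define K' where "K' = Kp * (1 + K)"
  have K': "0 \<le> K'" using Kp \<beta>(3) by (simp add: K'_def)
  define R where "R x0 D \<longleftrightarrow> continuous_on (ball x0 \<rho>) D \<and> (\<forall>y\<in>ball x0 \<rho>. subspace (stab y)) \<and>
     (\<forall>y\<in>ball x0 \<rho>. norm (D y) \<le> Kp) \<and> (\<forall>x\<in>ball x0 \<rho>. \<forall>y\<in>ball x0 \<rho>. norm (D x - D y) \<le> K' * dist x y powr \<beta>)"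
    for x0 and D :: "real ^ 'n \<Rightarrow> (real ^ 'n) \<Rightarrow>\<^sub>L ((real ^ 'n) \<Rightarrow>\<^sub>L (real ^ 'n))"
  have loc: "\<exists>P DP. (\<forall>y\<in>ball x0 \<rho>. is_orth_proj (stab y) (blinfun_apply (P y)) \<and> (P has_derivative blinfun_apply (DP y)) (at y))
      \<and> R x0 DP" for x0
  proof -
    obtain u where u1: "norm u = 1" "\<And>x. x \<in> ball x0 \<rho> \<Longrightarrow> u \<in> Ku x" using u by blast
    obtain W DP DW where W: "\<And>x. x \<in> ball x0 \<rho> \<Longrightarrow> W x \<noteq> 0"
    "\<And>x v. x \<in> ball x0 \<rho> \<Longrightarrow> W x \<bullet> v = 0 \<longleftrightarrow> v \<in> stab x"
    "\<And>x. x \<in> ball x0 \<rho> \<Longrightarrow> ((\<lambda>x. id_blinfun - line_proj (W x)) has_derivative blinfun_apply (DP x)) (at x)"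
    "\<And>x. x \<in> ball x0 \<rho> \<Longrightarrow> norm (DP x) \<le> Kp"
    "\<And>x y. x \<in> ball x0 \<rho> \<Longrightarrow> y \<in> ball x0 \<rho> \<Longrightarrow> norm (DP x - DP y) \<le> Kp * (dist x y + norm (DW x - DW y))"
    "\<And>x n h. x \<in> ball x0 \<rho> \<Longrightarrow> norm (dcovec_vec u n x h - blinfun_apply (DW x) h) \<le> K0 * q ^ n * norm h"
    "continuous_on (ball x0 \<rho>) DP"
      using local_projection[OF u1] by blast
    have sub: "subspace (stab y)" if y: "y \<in> ball x0 \<rho>" for y
    proof -
      have "stab y = {v. W y \<bullet> v = 0}" using W(2)[OF y] by auto
      then show ?thesis by (simp only: subspace_hyperplane)
    qed
    have orth: "is_orth_proj (stab y) (blinfun_apply (id_blinfun - line_proj (W y)))" if y: "y \<in> ball x0 \<rho>" for y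
      by (rule is_orth_proj_line_proj[OF W(1)[OF y] W(2)[OF y]])
    have hol: "norm (DP x - DP y) \<le> K' * dist x y powr \<beta>" if xy: "x \<in> ball x0 \<rho>" "y \<in> ball x0 \<rho>" for x y
    proof -
      have d1: "dist x y \<le> 1" using xy \<rho>(2) dist_triangle2[of x y x0] by (simp add: dist_commute)
      have "dist x y \<le> dist x y powr \<beta>"
      proof (cases "x = y")
        case False
        then show ?thesis using powr_mono'[of \<beta> 1 "dist x y"] \<beta> d1 by simp
      qed simp
      moreover have "norm (DW x - DW y) \<le> K * dist x y powr \<beta>"
        by (rule \<beta>(4)[OF u1 W(6) xy d1])
      ultimately have "dist x y + norm (DW x - DW y) \<le> (1 + K) * dist x y powr \<beta>" by (simp add: algebra_simps)
      then have "Kp * (dist x y + norm (DW x - DW y)) \<le> Kp * ((1 + K) * dist x y powr \<beta>)"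
        by (rule mult_left_mono) (use Kp in simp)
      then show ?thesis using W(5)[OF xy] unfolding K'_def by (simp add: mult.assoc)
    qed
    show ?thesis unfolding R_def
      by (intro exI[of _ "\<lambda>x. id_blinfun - line_proj (W x)"] exI[of _ DP] conjI ballI W(3,7) sub orth W(4) hol)
  qed
  obtain P DP where P: "\<And>x. is_orth_proj (stab x) (blinfun_apply (P x))"
    "\<And>x. (P has_derivative blinfun_apply (DP x)) (at x)"
    "\<And>x0. \<exists>D. R x0 D \<and> (\<forall>y\<in>ball x0 \<rho>. DP y = D y)"
    using glue_projections[OF \<rho>(1) loc] by blast
  have self: "x \<in> ball x \<rho>" for x using \<rho> by simp
  have cont: "isCont DP x" for x
  proof -
    obtain D where D: "continuous_on (ball x \<rho>) D" "\<forall>y\<in>ball x \<rho>. DP y = D y" using P(3) R_def by blast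
    then have "continuous_on (ball x \<rho>) DP" using continuous_on_cong by metis
    then show ?thesis using \<rho> by (simp add: continuous_on_eq_continuous_at)
  qed
  have bd: "norm (DP x) \<le> Kp" for x
    using P(3)[of x] self[of x] unfolding R_def by metis
  have near: "norm (DP x - DP y) \<le> K' * dist x y powr \<beta>" if "dist x y < \<rho>" for x y
  proof -
    have "y \<in> ball x \<rho>" using that by simp
    then show ?thesis using P(3)[of x] self[of x] unfolding R_def by metis
  qed
  \<comment> \<open>The second summand is for pairs at distance at least \<rho>: multiplied by
    \<open>dist x y powr \<beta>\<close> it is at least \<open>2 * Kp\<close>.\<close>
  define K2 where "K2 = K' + 2 * Kp / \<rho> powr \<beta>"
  have "norm (DP x - DP y) \<le> K2 * dist x y powr \<beta>" for x y
  proof (cases "dist x y < \<rho>")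
    case True
    have "K' * dist x y powr \<beta> \<le> K2 * dist x y powr \<beta>"
      by (intro mult_right_mono) (use Kp in \<open>auto simp: K2_def\<close>)
    then show ?thesis using near[OF True] by linarith
  next
    case False
    have "norm (DP x - DP y) \<le> 2 * Kp" using norm_triangle_ineq4[of "DP x" "DP y"] bd[of x] bd[of y] by linarith
    also have "2 * Kp = 2 * Kp / \<rho> powr \<beta> * \<rho> powr \<beta>" using \<rho> by simp
    also have "\<dots> \<le> K2 * dist x y powr \<beta>"
      by (intro mult_mono powr_mono2) (use False \<rho> \<beta> Kp K' in \<open>auto simp: K2_def\<close>)
    finally show ?thesis .
  qed
  moreover have "C1_map P DP" unfolding C1_map_def using P(2) cont by (simp add: continuous_at_imp_continuous_on)
  moreover have "subspace (stab x)" for x using P(3)[of x] self[of x] unfolding R_def by blast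
  ultimately have "C1_holder_subspace_field \<beta> (tangent_stable F D1 Ks)"
    unfolding C1_holder_subspace_field_def using P(1) by blast
  then show ?thesis using \<beta>(1,2) by blast
qed

section \<open>Smoothing periodic functions\<close>

lemma int_lattice_uminus: "k \<in> int_lattice \<Longrightarrow> - k \<in> int_lattice"
  by (simp add: int_lattice_def)

lemma int_lattice_shift_unit_cube:
  fixes x :: "real ^ 'n"
  obtains k where "k \<in> int_lattice" "x - k \<in> cbox 0 1"
proof
  let ?k = "(\<chi> i. of_int \<lfloor>x $ i\<rfloor>) :: real ^ 'n"
  show "?k \<in> int_lattice" by (simp add: int_lattice_def)
  show "x - ?k \<in> cbox 0 1" by (simp add: mem_box_cart) linarith
qed

lemma int_lattice_shift_centered_cube:
  fixes x :: "real ^ 'n"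
  obtains k where "k \<in> int_lattice" "x - k \<in> cbox (- (\<chi> i. 1 / 2)) (\<chi> i. 1 / 2)"
proof
  let ?k = "(\<chi> i. of_int (round (x $ i))) :: real ^ 'n"
  show "?k \<in> int_lattice" by (simp add: int_lattice_def)
  have "- (1 / 2) \<le> x $ i - of_int (round (x $ i)) \<and> x $ i - of_int (round (x $ i)) \<le> 1 / 2" for i
    using of_int_round_abs_le[of "x $ i"] by linarith
  then show "x - ?k \<in> cbox (- (\<chi> i. 1 / 2)) (\<chi> i. 1 / 2)" by (simp add: mem_box_cart)
qed

definition lattice_periodic :: "(real ^ 'n \<Rightarrow> 'b) \<Rightarrow> bool" where
  "lattice_periodic g \<longleftrightarrow> (\<forall>x. \<forall>k\<in>int_lattice. g (x + k) = g x)"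

lemma lattice_periodicD:
  assumes "lattice_periodic g" "k \<in> int_lattice"
  shows "g (x + k) = g x" "g (x - k) = g x"
  using assms(1) assms(2) int_lattice_uminus[OF assms(2)] unfolding lattice_periodic_def
  by (auto simp flip: diff_conv_add_uminus) (metis diff_conv_add_uminus)

text \<open>Translate \<open>x\<close> into the unit cube and \<open>y\<close> by the same lattice
  vector. At distance below 1 both lie in the cube with all coordinates between -1 and 2, so uniform
  continuity on one compact set suffices.\<close>

lemma lattice_periodic_uniformly_continuous:
  fixes g :: "real ^ 'n \<Rightarrow> 'b::metric_space"
  assumes per: "lattice_periodic g" and cont: "continuous_on UNIV g" and e: "0 < e"
  obtains \<delta> where "0 < \<delta>" "\<And>x y. dist x y < \<delta> \<Longrightarrow> dist (g x) (g y) < e"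
proof -
  let ?K = "cbox (- 1) (2 :: real ^ 'n)"
  have "uniformly_continuous_on ?K g"
    by (rule compact_uniformly_continuous[OF continuous_on_subset[OF cont] compact_cbox]) simp
  then obtain \<delta> where \<delta>: "\<delta> > 0" "\<And>x y. x \<in> ?K \<Longrightarrow> y \<in> ?K \<Longrightarrow> dist y x < \<delta> \<Longrightarrow> dist (g y) (g x) < e"
    unfolding uniformly_continuous_on_def using e by blast
  show ?thesis
  proof (rule that[of "min \<delta> 1"])
    fix x y :: "real ^ 'n" assume d: "dist x y < min \<delta> 1"
    obtain k where k: "k \<in> int_lattice" "x - k \<in> cbox 0 1" by (rule int_lattice_shift_unit_cube)
    have c: "\<bar>y $ i - x $ i\<bar> \<le> 1" for i
      using component_le_norm_cart[of "y - x" i] d by (simp add: dist_norm norm_minus_commute)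
    have x: "x - k \<in> ?K" using k(2) by (auto simp: mem_box_cart) (smt (verit))+
    have y: "y - k \<in> ?K" using k(2) c by (auto simp: mem_box_cart) (smt (verit))+
    have "dist (g (x - k)) (g (y - k)) < e"
      by (rule \<delta>(2)[OF y x]) (use d in \<open>simp add: dist_norm\<close>)
    then show "dist (g x) (g y) < e" using lattice_periodicD(2)[OF per k(1)] by simp
  qed (use \<delta> in simp)
qed

text \<open>A smooth periodic function that vanishes exactly on the lattice, in place of the squared
  distance to the lattice.\<close>

definition torus_gauge :: "real ^ 'n \<Rightarrow> real" where
  "torus_gauge y = (\<Sum>i\<in>UNIV. 1 - cos (2 * pi * y $ i))"

definition torus_grad :: "real ^ 'n \<Rightarrow> real ^ 'n" where
  "torus_grad y = (\<chi> i. 2 * pi * sin (2 * pi * y $ i))"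

lemma torus_gauge_nonneg: "0 \<le> torus_gauge y"
  unfolding torus_gauge_def by (intro sum_nonneg) simp

lemma torus_gauge_periodic: "lattice_periodic torus_gauge"
  unfolding lattice_periodic_def
proof (intro allI ballI)
  fix x k :: "real ^ 'n" assume k: "k \<in> int_lattice"
  have "cos (2 * pi * (x $ i + k $ i)) = cos (2 * pi * x $ i)" for i
  proof -
    obtain m :: int where m: "k $ i = of_int m" using k unfolding int_lattice_def by (auto elim: Ints_cases)
    have "2 * pi * (x $ i + k $ i) = 2 * pi * x $ i + 2 * pi * of_int m" by (simp add: m algebra_simps)
    then show ?thesis using cos_int_2pin[of m] sin_int_2pin[of m] by (simp only: cos_add mult_ac)
  qed
  then show "torus_gauge (x + k) = torus_gauge x" by (simp add: torus_gauge_def)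
qed

lemma torus_gauge_deriv: "(torus_gauge has_derivative (\<lambda>h. torus_grad y \<bullet> h)) (at y)" for y :: "real ^ 'n"
proof -
  have "((\<lambda>y::real^'n. 1 - cos (2 * pi * y $ i)) has_derivative (\<lambda>h. 2 * pi * sin (2 * pi * y $ i) * h $ i)) (at y)" for i
    by (auto intro!: derivative_eq_intros bounded_linear.has_derivative[OF bounded_linear_vec_nth] simp: algebra_simps)
  then have "((\<lambda>y::real^'n. \<Sum>i\<in>UNIV. 1 - cos (2 * pi * y $ i)) has_derivative (\<lambda>h. \<Sum>i\<in>UNIV. 2 * pi * sin (2 * pi * y $ i) * h $ i)) (at y)"
    by (intro has_derivative_sum) blast
  then show ?thesis by (simp add: torus_gauge_def[abs_def] torus_grad_def inner_vec_def)
qed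

lemma torus_gauge_cont: "continuous_on S torus_gauge"
  by (intro continuous_at_imp_continuous_on ballI has_derivative_continuous[OF torus_gauge_deriv])

text \<open>In the cube centred at 0 the only zero is the origin, so off a \<delta>-ball the
  function has a positive minimum. Rounding the coordinates moves every point into this
  cube.\<close>

lemma torus_gauge_small:
  assumes "0 < \<delta>"
  obtains s where "0 < s" "\<And>y :: real ^ 'n. torus_gauge y < s \<Longrightarrow> \<exists>k\<in>int_lattice. norm (y - k) < \<delta>"
proof -
  let ?B = "cbox (- (\<chi> i. 1 / 2)) (\<chi> i. 1 / 2) :: (real ^ 'n) set"
  let ?K = "?B \<inter> {y. \<delta> \<le> norm y}"
  have K: "compact ?K"
    by (intro compact_Int_closed compact_cbox closed_Collect_le continuous_intros)
  have pos: "0 < torus_gauge y" if y: "y \<in> ?K" for y :: "real ^ 'n"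
  proof (rule ccontr)
    assume "\<not> 0 < torus_gauge y"
    then have "torus_gauge y = 0" using torus_gauge_nonneg[of y] by simp
    then have c: "cos (2 * pi * y $ i) = 1" for i
      unfolding torus_gauge_def by (subst (asm) sum_nonneg_eq_0_iff) auto
    have "y $ i = 0" for i
    proof -
      obtain m :: int where "2 * pi * y $ i = real_of_int m * 2 * pi" using c[of i] unfolding cos_one_2pi_int by blast
      then have m: "y $ i = m" by simp
      moreover have "- (1 / 2) \<le> y $ i" "y $ i \<le> 1 / 2" using y by (auto simp: mem_box_cart)
      ultimately have "\<bar>m\<bar> < 1" by linarith
      then show ?thesis using m by simp
    qed
    then have "y = 0" by (simp add: vec_eq_iff)
    then show False using y assms by simp
  qed
  have "\<exists>s>0. \<forall>y\<in>?K. s \<le> torus_gauge y"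
  proof (cases "?K = {}")
    case False
    obtain y0 where "y0 \<in> ?K" "\<forall>y\<in>?K. torus_gauge y0 \<le> torus_gauge y"
      using continuous_attains_inf[OF K False torus_gauge_cont] by blast
    then show ?thesis using pos by blast
  qed (auto intro: exI[of _ 1])
  then obtain s where s: "s > 0" "\<forall>y\<in>?K. s \<le> torus_gauge y" by blast
  show ?thesis
  proof (rule that[OF s(1)])
    fix y :: "real ^ 'n" assume y: "torus_gauge y < s"
    obtain k where k: "k \<in> int_lattice" "y - k \<in> ?B" by (rule int_lattice_shift_centered_cube)
    have "torus_gauge (y - k) < s" using y lattice_periodicD(2)[OF torus_gauge_periodic k(1)] by simp
    then have "norm (y - k) < \<delta>" using s(2) k(2) by force
    then show "\<exists>k\<in>int_lattice. norm (y - k) < \<delta>" using k(1) by blast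
  qed
qed

section \<open>A periodic bump with Lipschitz gradient\<close>

lemma sin_lipschitz: "\<bar>sin x - sin y\<bar> \<le> \<bar>x - y\<bar>" for x y :: real
  using field_differentiable_bound[of UNIV sin cos 1 x y] by (auto intro: DERIV_subset[OF DERIV_sin])

lemma square_max_deriv: "((\<lambda>t::real. (max 0 t)\<^sup>2) has_real_derivative 2 * max 0 t) (at t)"
proof -
  consider "t > 0" | "t < 0" | "t = 0" by linarith
  then show ?thesis
  proof cases
    case 1
    have "((\<lambda>t::real. t\<^sup>2) has_real_derivative 2 * max 0 t) (at t)"
      using 1 by (auto intro!: derivative_eq_intros)
    then show ?thesis
      by (rule has_field_derivative_transform_within_open[of _ _ _ "{0<..}"]) (use 1 in auto)
  next
    case 2
    have "((\<lambda>t::real. 0) has_real_derivative 2 * max 0 t) (at t)" using 2 by simp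
    then show ?thesis
      by (rule has_field_derivative_transform_within_open[of _ _ _ "{..<0}"]) (use 2 in auto)
  next
    case 3
    have "(\<lambda>h::real. ((max 0 (0 + h))\<^sup>2 - (max 0 0)\<^sup>2) / h) \<midarrow>0\<rightarrow> 0"
    proof (rule Lim_null_comparison)
      show "\<forall>\<^sub>F h::real in at 0. norm (((max 0 (0 + h))\<^sup>2 - (max 0 0)\<^sup>2) / h) \<le> \<bar>h\<bar>"
        by (intro always_eventually allI) (auto simp: max_def power2_eq_square)
      show "(\<lambda>h::real. \<bar>h\<bar>) \<midarrow>0\<rightarrow> 0" by (rule tendsto_rabs_zero) simp
    qed
    then show ?thesis using 3 by (simp add: DERIV_def)
  qed
qed

text \<open>Squaring the positive part gives a C^1 function with Lipschitz gradient, the regularity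
  that \<open>DQ\<close> has to have.\<close>

definition torus_bump :: "real \<Rightarrow> real ^ 'n \<Rightarrow> real" where
  "torus_bump s y = (max 0 (s - torus_gauge y))\<^sup>2"

definition torus_bump_grad :: "real \<Rightarrow> real ^ 'n \<Rightarrow> real ^ 'n" where
  "torus_bump_grad s y = (- 2 * max 0 (s - torus_gauge y)) *\<^sub>R torus_grad y"

lemma torus_bump_deriv: "(torus_bump s has_derivative (\<lambda>h. torus_bump_grad s y \<bullet> h)) (at y)"
proof -
  have "((\<lambda>y. s - torus_gauge y) has_derivative (\<lambda>h. - (torus_grad y \<bullet> h))) (at y)"
    by (auto intro!: derivative_eq_intros torus_gauge_deriv)
  from has_derivative_compose[OF this square_max_deriv[unfolded has_field_derivative_def, of "s - torus_gauge y"]]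
  show ?thesis by (simp add: torus_bump_def[abs_def] torus_bump_grad_def)
qed

lemma torus_bump_nonneg: "0 \<le> torus_bump s y"
  by (simp add: torus_bump_def)

lemma torus_grad_bound: "norm (torus_grad (y :: real ^ 'n)) \<le> 2 * pi * real CARD('n)"
proof -
  have "norm (torus_grad y) \<le> (\<Sum>i\<in>UNIV. \<bar>torus_grad y $ i\<bar>)" by (rule norm_le_l1_cart)
  also have "\<dots> \<le> (\<Sum>i\<in>(UNIV::'n set). 2 * pi)"
    by (intro sum_mono) (simp add: torus_grad_def abs_mult)
  finally show ?thesis by (simp add: mult_ac)
qed

lemma torus_grad_lip: "norm (torus_grad (x :: real ^ 'n) - torus_grad y) \<le> (2 * pi)\<^sup>2 * real CARD('n) * dist x y"
proof -
  have "norm (torus_grad x - torus_grad y) \<le> (\<Sum>i\<in>UNIV. \<bar>(torus_grad x - torus_grad y) $ i\<bar>)" by (rule norm_le_l1_cart)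
  also have "\<dots> \<le> (\<Sum>i\<in>(UNIV::'n set). (2 * pi)\<^sup>2 * dist x y)"
  proof (rule sum_mono)
    fix i :: 'n
    have "\<bar>(torus_grad x - torus_grad y) $ i\<bar> = 2 * pi * \<bar>sin (2 * pi * x $ i) - sin (2 * pi * y $ i)\<bar>"
      by (simp add: torus_grad_def abs_mult flip: right_diff_distrib)
    also have "\<dots> \<le> 2 * pi * \<bar>2 * pi * x $ i - 2 * pi * y $ i\<bar>"
      by (intro mult_left_mono sin_lipschitz) auto
    also have "\<dots> = (2 * pi)\<^sup>2 * \<bar>(x - y) $ i\<bar>" by (simp add: abs_mult power2_eq_square flip: right_diff_distrib)
    also have "\<dots> \<le> (2 * pi)\<^sup>2 * dist x y"
      unfolding dist_norm by (intro mult_left_mono component_le_norm_cart) auto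
    finally show "\<bar>(torus_grad x - torus_grad y) $ i\<bar> \<le> (2 * pi)\<^sup>2 * dist x y" .
  qed
  finally show ?thesis by (simp add: mult_ac)
qed

lemma torus_gauge_lip: "\<bar>torus_gauge (x :: real ^ 'n) - torus_gauge y\<bar> \<le> 2 * pi * real CARD('n) * dist x y"
proof -
  have "norm (torus_gauge x - torus_gauge y) \<le> 2 * pi * real CARD('n) * norm (x - y)"
  proof (rule differentiable_bound[of UNIV _ "\<lambda>y h. torus_grad y \<bullet> h"])
    show "onorm (\<lambda>h. torus_grad z \<bullet> h) \<le> 2 * pi * real CARD('n)" for z :: "real ^ 'n"
    proof (rule onorm_bound)
      show "norm (torus_grad z \<bullet> h) \<le> 2 * pi * real CARD('n) * norm h" for h
        using Cauchy_Schwarz_ineq2[of "torus_grad z" h] mult_right_mono[OF torus_grad_bound[of z], of "norm h"] by simp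
    qed simp
  qed (use torus_gauge_deriv has_derivative_at_withinI in auto)
  then show ?thesis by (simp add: dist_norm)
qed

lemma torus_bump_grad_bdd_lip:
  assumes "0 < s"
  obtains B where "0 \<le> B" "\<And>y :: real ^ 'n. norm (torus_bump_grad s y) \<le> B"
    "\<And>x y :: real ^ 'n. norm (torus_bump_grad s x - torus_bump_grad s y) \<le> B * dist x y"
proof -
  interpret dist_on dist "UNIV :: (real ^ 'n) set" by unfold_locales auto
  define N where "N = 2 * pi * real CARD('n)"
  have 1: "bl (2 * (s + N)) (\<lambda>y. - 2 * max 0 (s - torus_gauge y))"
  proof (rule bdd_lipI)
    fix x y :: "real ^ 'n"
    show "norm (- 2 * max 0 (s - torus_gauge x)) \<le> 2 * (s + N)"
    proof -
      have "0 \<le> N" by (simp add: N_def)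
      then have "max 0 (s - torus_gauge x) \<le> s + N" using torus_gauge_nonneg[of x] assms by linarith
      then have "2 * max 0 (s - torus_gauge x) \<le> 2 * (s + N)" by (rule mult_left_mono) simp
      moreover have "norm (- 2 * max 0 (s - torus_gauge x)) = 2 * max 0 (s - torus_gauge x)" by (simp add: abs_mult)
      ultimately show ?thesis by (simp only:)
    qed
    have "\<bar>max 0 (s - torus_gauge x) - max 0 (s - torus_gauge y)\<bar> \<le> \<bar>torus_gauge x - torus_gauge y\<bar>" by linarith
    then have d: "\<bar>max 0 (s - torus_gauge x) - max 0 (s - torus_gauge y)\<bar> \<le> N * dist x y"
      using torus_gauge_lip[of x y] unfolding N_def by linarith
    have aux: "norm (- 2 * a - - 2 * b) \<le> 2 * c" if "\<bar>a - b\<bar> \<le> c" for a b c :: real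
      using that unfolding real_norm_def by linarith
    have "norm (- 2 * max 0 (s - torus_gauge x) - - 2 * max 0 (s - torus_gauge y)) \<le> 2 * (N * dist x y)"
      by (rule aux[OF d])
    also have "\<dots> \<le> 2 * (s + N) * dist x y" using assms by (simp add: distrib_right)
    finally show "norm (- 2 * max 0 (s - torus_gauge x) - - 2 * max 0 (s - torus_gauge y)) \<le> 2 * (s + N) * dist x y" .
  qed
  define N' where "N' = (2 * pi)\<^sup>2 * real CARD('n)"
  have N: "0 \<le> N" "0 \<le> N'" by (simp_all add: N_def N'_def)
  have 2: "bl (N + N') torus_grad"
  proof (rule bdd_lipI)
    fix x y :: "real ^ 'n"
    show "norm (torus_grad x) \<le> N + N'" using torus_grad_bound[of x] N by (simp add: N_def)
    have "N' * dist x y \<le> (N + N') * dist x y" by (intro mult_right_mono) (use N in auto)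
    then show "norm (torus_grad x - torus_grad y) \<le> (N + N') * dist x y"
      using torus_grad_lip[of x y] unfolding N'_def by linarith
  qed
  let ?B = "2 * (2 * (s + N)) * (N + N')"
  have grad: "bl ?B (torus_bump_grad s)"
    unfolding torus_bump_grad_def[abs_def] by (rule bl_scaleR[OF 1 2])
  have "0 \<le> ?B" using assms N by simp
  then show ?thesis
    by (rule that[OF _ bdd_lipD(1)[OF grad UNIV_I] bdd_lipD(2)[OF grad UNIV_I UNIV_I]])
qed

text \<open>A finite sum of bumps with coefficients \<open>g p\<close>. It is not divided by the sum
  S of the bumps, so it approximates S g rather than g; this suffices because a positive factor
  cancels in \<open>covec\<close>, and it keeps the derivative bounds elementary.\<close>

lemma smooth_periodic_approximation:
  fixes g :: "real ^ 'n \<Rightarrow> 'b::real_normed_vector"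
  assumes per: "lattice_periodic g" and cont: "continuous_on UNIV g" and \<epsilon>: "0 < \<epsilon>"
  obtains f Df B c where "\<And>x. (f has_derivative blinfun_apply (Df x)) (at x)"
    "0 < c" "\<And>x. \<exists>S\<ge>c. norm (f x - S *\<^sub>R g x) \<le> \<epsilon> * S"
    "\<And>x. norm (f x) \<le> B" "\<And>x. norm (Df x) \<le> B" "\<And>x y. norm (Df x - Df y) \<le> B * dist x y"
proof -
  obtain \<delta> where \<delta>: "0 < \<delta>" "\<And>x y. dist x y < \<delta> \<Longrightarrow> dist (g x) (g y) < \<epsilon>"
    using lattice_periodic_uniformly_continuous[OF per cont \<epsilon>] by blast
  obtain s where s: "0 < s" "\<And>y :: real ^ 'n. torus_gauge y < s \<Longrightarrow> \<exists>k\<in>int_lattice. norm (y - k) < \<delta>"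
    using torus_gauge_small[OF \<delta>(1)] by blast
  \<comment> \<open>The level s / 2, half of the cut-off, makes the bump at p at least (s / 2)^2 on
    \<open>U p\<close>; hence the lower bound s^2 / 4 for the sum.\<close>
  define U where "U p = {x :: real ^ 'n. torus_gauge (x - p) < s / 2}" for p
  have U: "open (U p)" for p
    unfolding U_def
    by (intro open_Collect_less continuous_intros continuous_on_compose2[OF torus_gauge_cont[of UNIV]]) auto
  have UU: "cbox 0 1 \<subseteq> (\<Union>p\<in>cbox 0 1. U p)" using s(1) by (auto simp: U_def torus_gauge_def)
  obtain T where T: "finite T" "cbox 0 1 \<subseteq> (\<Union>p\<in>T. U p)"
    using compactE_image[OF compact_cbox _ UU] U by metis
  have cover: "\<exists>p\<in>T. torus_gauge (x - p) < s / 2" for x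
  proof -
    obtain k where k: "k \<in> int_lattice" "x - k \<in> cbox 0 1" by (rule int_lattice_shift_unit_cube)
    then obtain p where p: "p \<in> T" "torus_gauge (x - k - p) < s / 2" using T(2) by (auto simp: U_def)
    have "torus_gauge (x - p - k) = torus_gauge (x - p)" by (rule lattice_periodicD(2)[OF torus_gauge_periodic k(1)])
    then have "torus_gauge (x - p) = torus_gauge (x - k - p)" by (simp add: algebra_simps)
    then show ?thesis using p by (intro bexI[of _ p]) simp_all
  qed
  define f where "f x = (\<Sum>p\<in>T. torus_bump s (x - p) *\<^sub>R g p)" for x
  define Df where "Df x = (\<Sum>p\<in>T. blinfun_scaleR_left (g p) o\<^sub>L blinfun_inner_right (torus_bump_grad s (x - p)))" for x
  define S where "S x = (\<Sum>p\<in>T. torus_bump s (x - p))" for x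
  have Df_apply: "Df x h = (\<Sum>p\<in>T. (torus_bump_grad s (x - p) \<bullet> h) *\<^sub>R g p)" for x h
    by (simp add: Df_def blinfun.sum_left)
  have df: "(f has_derivative blinfun_apply (Df x)) (at x)" for x
  proof -
    have "((\<lambda>x. torus_bump s (x - p)) has_derivative (\<lambda>h. torus_bump_grad s (x - p) \<bullet> h)) (at x)" for p
      by (rule has_derivative_compose[OF _ torus_bump_deriv]) (auto intro!: derivative_eq_intros)
    then show ?thesis unfolding f_def Df_apply[abs_def]
      by (intro has_derivative_sum has_derivative_scaleR_left)
  qed
  have S: "s\<^sup>2 / 4 \<le> S x" for x
  proof -
    obtain p where p: "p \<in> T" "torus_gauge (x - p) < s / 2" using cover by blast
    have "(s / 2)\<^sup>2 \<le> torus_bump s (x - p)"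
      unfolding torus_bump_def by (rule power_mono) (use p s in auto)
    also have "\<dots> \<le> S x" unfolding S_def by (rule member_le_sum) (use p T torus_bump_nonneg in auto)
    finally show ?thesis by (simp add: power2_eq_square)
  qed
  have approx: "norm (f x - S x *\<^sub>R g x) \<le> \<epsilon> * S x" for x
  proof -
    have "f x - S x *\<^sub>R g x = (\<Sum>p\<in>T. torus_bump s (x - p) *\<^sub>R (g p - g x))"
      by (simp add: f_def S_def scaleR_sum_left scaleR_right_diff_distrib sum_subtractf)
    also have "norm \<dots> \<le> (\<Sum>p\<in>T. \<epsilon> * torus_bump s (x - p))"
    proof (rule sum_norm_le)
      fix p assume "p \<in> T"
      show "norm (torus_bump s (x - p) *\<^sub>R (g p - g x)) \<le> \<epsilon> * torus_bump s (x - p)"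
      proof (cases "torus_gauge (x - p) < s")
        \<comment> \<open>Where the bump at p is nonzero, x lies within \<delta> of p up to a
          lattice vector, so g x is close to g p by periodicity.\<close>
        case True
        then obtain k where k: "k \<in> int_lattice" "norm (x - p - k) < \<delta>" using s(2) by blast
        have "dist (g (x - k)) (g p) < \<epsilon>" by (rule \<delta>(2)) (use k in \<open>simp add: dist_norm algebra_simps\<close>)
        then have "norm (g p - g x) \<le> \<epsilon>"
          using lattice_periodicD(2)[OF per k(1), of x] by (simp add: dist_norm norm_minus_commute)
        then have "torus_bump s (x - p) * norm (g p - g x) \<le> torus_bump s (x - p) * \<epsilon>"
          by (intro mult_left_mono torus_bump_nonneg)
        then show ?thesis using torus_bump_nonneg[of s "x - p"] by (simp add: mult.commute)
      next
        case False
        then show ?thesis by (simp add: torus_bump_def)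
      qed
    qed
    also have "\<dots> = \<epsilon> * S x" by (simp add: S_def sum_distrib_left)
    finally show ?thesis .
  qed
  obtain Bg where Bg: "0 \<le> Bg" "\<And>y :: real ^ 'n. norm (torus_bump_grad s y) \<le> Bg"
    "\<And>x y :: real ^ 'n. norm (torus_bump_grad s x - torus_bump_grad s y) \<le> Bg * dist x y"
    using torus_bump_grad_bdd_lip[OF s(1)] by blast
  define R where "R = (\<Sum>p\<in>T. norm (g p))"
  have R: "0 \<le> R" by (simp add: R_def sum_nonneg)
  have op: "norm (\<Sum>p\<in>T. (a p \<bullet> h) *\<^sub>R g p) \<le> b * R * norm h"
    if a: "\<And>p. norm (a p) \<le> b" for a :: "real ^ 'n \<Rightarrow> real ^ 'n" and b h
  proof -
    have "norm (\<Sum>p\<in>T. (a p \<bullet> h) *\<^sub>R g p) \<le> (\<Sum>p\<in>T. b * norm h * norm (g p))"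
    proof (rule sum_norm_le)
      fix p
      have "\<bar>a p \<bullet> h\<bar> \<le> b * norm h"
        using Cauchy_Schwarz_ineq2[of "a p" h] mult_right_mono[OF a[of p], of "norm h"] by simp
      then show "norm ((a p \<bullet> h) *\<^sub>R g p) \<le> b * norm h * norm (g p)" by (simp add: mult_right_mono)
    qed
    then show ?thesis by (simp add: R_def sum_distrib_left mult_ac)
  qed
  have f_bound: "norm (f x) \<le> s\<^sup>2 * R" for x
  proof -
    have "norm (f x) \<le> (\<Sum>p\<in>T. s\<^sup>2 * norm (g p))" unfolding f_def
    proof (rule sum_norm_le)
      fix p
      have "torus_bump s (x - p) \<le> s\<^sup>2" unfolding torus_bump_def
        by (rule power_mono) (use s torus_gauge_nonneg[of "x - p"] in auto)
      then show "norm (torus_bump s (x - p) *\<^sub>R g p) \<le> s\<^sup>2 * norm (g p)"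
        using torus_bump_nonneg[of s "x - p"] by (simp add: mult_right_mono)
    qed
    then show ?thesis by (simp add: R_def sum_distrib_left)
  qed
  have Df_bound: "norm (Df x) \<le> Bg * R" for x
    by (rule norm_blinfun_bound) (use Bg R op[of "\<lambda>p. torus_bump_grad s (x - p)" Bg] in \<open>auto simp: Df_apply\<close>)
  have Df_lip: "norm (Df x - Df y) \<le> Bg * R * dist x y" for x y
  proof (rule norm_blinfun_bound)
    show "norm ((Df x - Df y) h) \<le> Bg * R * dist x y * norm h" for h
    proof -
      have "(Df x - Df y) h = (\<Sum>p\<in>T. ((torus_bump_grad s (x - p) - torus_bump_grad s (y - p)) \<bullet> h) *\<^sub>R g p)"
        by (simp add: blinfun.diff_left Df_apply inner_diff_left scaleR_left_diff_distrib sum_subtractf)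
      also have "norm \<dots> \<le> (Bg * dist x y) * R * norm h"
      proof (rule op)
        show "norm (torus_bump_grad s (x - p) - torus_bump_grad s (y - p)) \<le> Bg * dist x y" for p
          using Bg(3)[of "x - p" "y - p"] by (simp add: dist_norm)
      qed
      finally show ?thesis by (simp add: mult_ac)
    qed
  qed (use Bg R in simp)
  define B where "B = s\<^sup>2 * R + Bg * R"
  have B: "s\<^sup>2 * R \<le> B" "Bg * R \<le> B" using Bg R by (auto simp: B_def)
  show ?thesis
  proof (rule that[OF df])
    show "0 < s\<^sup>2 / 4" using s(1) by simp
    show "\<exists>S'\<ge>s\<^sup>2 / 4. norm (f x - S' *\<^sub>R g x) \<le> \<epsilon> * S'" for x using S approx by blast
    show "norm (f x) \<le> B" for x using f_bound[of x] B by linarith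
    show "norm (Df x) \<le> B" for x using Df_bound[of x] B by linarith
    show "norm (Df x - Df y) \<le> B * dist x y" for x y
      using Df_lip[of x y] mult_right_mono[OF B(2), of "dist x y"] by simp
  qed
qed

section \<open>Splittings and cones\<close>

locale cone_splitting =
  fixes \<mu> :: real and E Fs :: "real ^ 'n \<Rightarrow> (real ^ 'n) set"
  assumes mu: "0 < \<mu>" "\<mu> < 1"
    and E_field: "continuous_subspace_field E" and F_field: "continuous_subspace_field Fs"
    and F_dim: "dim (Fs x) = 1" and inter: "E x \<inter> Fs x = {0}"
    and sum: "\<exists>a\<in>E x. \<exists>b\<in>Fs x. v = a + b"
    and periodic: "k \<in> int_lattice \<Longrightarrow> E (x + k) = E x" "k \<in> int_lattice \<Longrightarrow> Fs (x + k) = Fs x"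
begin

lemma sub: "subspace (E x)" "subspace (Fs x)"
  using E_field F_field by (auto simp: continuous_subspace_field_def)

text \<open>The projection onto \<open>Fs x\<close> along \<open>E x\<close>.\<close>

definition piF :: "real ^ 'n \<Rightarrow> real ^ 'n \<Rightarrow> real ^ 'n" where
  "piF x v = (SOME b. b \<in> Fs x \<and> v - b \<in> E x)"

lemma piF: "piF x v \<in> Fs x" "v - piF x v \<in> E x"
proof -
  obtain a b where "a \<in> E x" "b \<in> Fs x" "v = a + b" using sum by blast
  then have "b \<in> Fs x \<and> v - b \<in> E x" by simp
  then have "piF x v \<in> Fs x \<and> v - piF x v \<in> E x" unfolding piF_def by (rule someI)
  then show "piF x v \<in> Fs x" "v - piF x v \<in> E x" by auto
qed

lemma piF_unique: assumes "b \<in> Fs x" "v - b \<in> E x" shows "piF x v = b"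
proof -
  have "piF x v - b \<in> Fs x" using sub(2) piF(1) assms(1) by (rule subspace_diff)
  moreover have "(v - b) - (v - piF x v) \<in> E x" using sub(1) assms(2) piF(2) by (rule subspace_diff)
  ultimately have "piF x v - b \<in> E x \<inter> Fs x" by simp
  then show ?thesis using inter by auto
qed

lemma piF_linear: "linear (piF x)"
proof (rule linearI)
  fix v w r
  show "piF x (v + w) = piF x v + piF x w"
  proof (rule piF_unique)
    have "(v - piF x v) + (w - piF x w) \<in> E x" by (intro subspace_add sub piF)
    then show "v + w - (piF x v + piF x w) \<in> E x" by (simp add: algebra_simps)
  qed (intro subspace_add sub piF)
  show "piF x (r *\<^sub>R v) = r *\<^sub>R piF x v"
  proof (rule piF_unique)
    have "r *\<^sub>R (v - piF x v) \<in> E x" by (intro subspace_scale sub piF)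
    then show "r *\<^sub>R v - r *\<^sub>R piF x v \<in> E x" by (simp add: algebra_simps)
  qed (intro subspace_scale sub piF)
qed

lemmas piF_simps = linear_add[OF piF_linear] linear_diff[OF piF_linear] linear_cmul[OF piF_linear] linear_0[OF piF_linear]

lemma piF_F: "b \<in> Fs x \<Longrightarrow> piF x b = b"
  by (rule piF_unique) (use sub subspace_0 in auto)

lemma cone_s_iff: "v \<in> cone_s \<mu> E Fs x \<longleftrightarrow> norm (piF x v) \<le> \<mu> * norm (v - piF x v)"
proof
  assume "v \<in> cone_s \<mu> E Fs x"
  then obtain a b where ab: "v = a + b" "a \<in> E x" "b \<in> Fs x" "norm b \<le> \<mu> * norm a" by (auto simp: cone_s_def)
  then have "piF x v = b" by (intro piF_unique) auto
  then show "norm (piF x v) \<le> \<mu> * norm (v - piF x v)" using ab by simp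
next
  assume "norm (piF x v) \<le> \<mu> * norm (v - piF x v)"
  then show "v \<in> cone_s \<mu> E Fs x" unfolding cone_s_def using piF(1)[of x v] piF(2)[of v x]
    by (intro CollectI exI[of _ "v - piF x v"] exI[of _ "piF x v"]) simp
qed

lemma cone_u_iff: "v \<in> cone_u \<mu> E Fs x \<longleftrightarrow> norm (v - piF x v) \<le> \<mu> * norm (piF x v)"
proof
  assume "v \<in> cone_u \<mu> E Fs x"
  then obtain a b where ab: "v = a + b" "a \<in> E x" "b \<in> Fs x" "norm a \<le> \<mu> * norm b" by (auto simp: cone_u_def)
  then have "piF x v = b" by (intro piF_unique) auto
  then show "norm (v - piF x v) \<le> \<mu> * norm (piF x v)" using ab by simp
next
  assume "norm (v - piF x v) \<le> \<mu> * norm (piF x v)"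
  then show "v \<in> cone_u \<mu> E Fs x" unfolding cone_u_def using piF(1)[of x v] piF(2)[of v x]
    by (intro CollectI exI[of _ "v - piF x v"] exI[of _ "piF x v"]) simp
qed

lemma closed_cone_s: "closed (cone_s \<mu> E Fs x)"
proof -
  have "cone_s \<mu> E Fs x = {v. norm (piF x v) \<le> \<mu> * norm (v - piF x v)}" using cone_s_iff by blast
  then show ?thesis
    by (simp only:) (intro closed_Collect_le continuous_intros linear_continuous_on[OF linear_conv_bounded_linear[THEN iffD1, OF piF_linear]])
qed

lemma zero_in_cones: "0 \<in> cone_s \<mu> E Fs x" "0 \<in> cone_u \<mu> E Fs x"
  by (simp_all add: cone_s_iff cone_u_iff piF_simps)

lemma cone_u_scaleR: "w \<in> cone_u \<mu> E Fs x \<Longrightarrow> r *\<^sub>R w \<in> cone_u \<mu> E Fs x"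
  unfolding cone_u_iff piF_simps scaleR_diff_right[symmetric] norm_scaleR mult.left_commute[of \<mu>]
  by (rule mult_left_mono) auto

lemma cone_u_norm_le: "w \<in> cone_u \<mu> E Fs x \<Longrightarrow> norm w \<le> 2 * norm (piF x w)"
proof -
  assume w: "w \<in> cone_u \<mu> E Fs x"
  have "norm w \<le> norm (w - piF x w) + norm (piF x w)" using norm_triangle_ineq[of "w - piF x w" "piF x w"] by simp
  also have "\<dots> \<le> \<mu> * norm (piF x w) + norm (piF x w)" using w by (simp add: cone_u_iff)
  also have "\<mu> * norm (piF x w) \<le> 1 * norm (piF x w)" by (intro mult_right_mono) (use mu in auto)
  finally show ?thesis by simp
qed

section \<open>Orthogonal projections attached to the splitting\<close>

definition PE :: "real ^ 'n \<Rightarrow> (real ^ 'n) \<Rightarrow>\<^sub>L (real ^ 'n)" where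
  "PE = (SOME P. (\<forall>x. is_orth_proj (E x) (blinfun_apply (P x))) \<and> continuous_on UNIV P)"
definition PF :: "real ^ 'n \<Rightarrow> (real ^ 'n) \<Rightarrow>\<^sub>L (real ^ 'n)" where
  "PF = (SOME P. (\<forall>x. is_orth_proj (Fs x) (blinfun_apply (P x))) \<and> continuous_on UNIV P)"
text \<open>The orthogonal projection onto the complement of \<open>E x\<close>; this is the
  continuous field that gets smoothed.\<close>

definition Qc :: "real ^ 'n \<Rightarrow> (real ^ 'n) \<Rightarrow>\<^sub>L (real ^ 'n)" where
  "Qc x = id_blinfun - PE x"

lemma PE: "is_orth_proj (E x) (blinfun_apply (PE x))" "continuous_on UNIV PE"
proof -
  have "\<exists>P. (\<forall>x. is_orth_proj (E x) (blinfun_apply (P x))) \<and> continuous_on UNIV P"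
    using E_field by (simp add: continuous_subspace_field_def)
  from someI_ex[OF this] show "is_orth_proj (E x) (blinfun_apply (PE x))" "continuous_on UNIV PE"
    unfolding PE_def by blast+
qed

lemma PF: "is_orth_proj (Fs x) (blinfun_apply (PF x))" "continuous_on UNIV PF"
proof -
  have "\<exists>P. (\<forall>x. is_orth_proj (Fs x) (blinfun_apply (P x))) \<and> continuous_on UNIV P"
    using F_field by (simp add: continuous_subspace_field_def)
  from someI_ex[OF this] show "is_orth_proj (Fs x) (blinfun_apply (PF x))" "continuous_on UNIV PF"
    unfolding PF_def by blast+
qed

lemma lattice_periodic_proj: "lattice_periodic PE" "lattice_periodic PF"
proof -
  have "PE (x + k) = PE x" "PF (x + k) = PF x" if k: "k \<in> int_lattice" for x k
    using is_orth_proj_unique[OF PE(1)[of "x + k", unfolded periodic(1)[OF k]] PE(1)[of x]]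
      is_orth_proj_unique[OF PF(1)[of "x + k", unfolded periodic(2)[OF k]] PF(1)[of x]]
    by (simp_all add: blinfun_apply_inject)
  then show "lattice_periodic PE" "lattice_periodic PF" by (simp_all add: lattice_periodic_def)
qed

lemma Qc_cont: "continuous_on UNIV Qc" and Qc_periodic: "lattice_periodic Qc"
  using PE(2) lattice_periodic_proj(1) unfolding Qc_def[abs_def] lattice_periodic_def by (auto intro: continuous_intros)

lemma PF_F: "b \<in> Fs x \<Longrightarrow> PF x b = b"
proof -
  assume b: "b \<in> Fs x"
  have "PF x b \<in> Fs x" using PF(1) by (simp add: is_orth_proj_def)
  then have "b - PF x b \<in> Fs x" by (intro subspace_diff sub b)
  then have "(b - PF x b) \<bullet> (b - PF x b) = 0" using PF(1)[of x] unfolding is_orth_proj_def by blast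
  then show ?thesis by simp
qed

lemma PF_in: "PF x v \<in> Fs x" using PF(1) by (simp add: is_orth_proj_def)

lemma Qc_orth: "w \<in> E x \<Longrightarrow> Qc x v \<bullet> w = 0"
  using PE(1)[of x] by (simp add: Qc_def is_orth_proj_def blinfun.diff_left)

lemma Qc_diff_in: "v - Qc x v \<in> E x"
  using PE(1)[of x] by (simp add: Qc_def is_orth_proj_def blinfun.diff_left)

lemma Qc_E: "w \<in> E x \<Longrightarrow> Qc x w = 0"
proof -
  assume w: "w \<in> E x"
  have "w - (w - Qc x w) \<in> E x" by (intro subspace_diff sub w Qc_diff_in)
  then have "Qc x w \<bullet> Qc x w = 0" using Qc_orth[of "Qc x w" x w] by simp
  then show ?thesis by simp
qed

lemma Qc_piF: "Qc x (piF x v) = Qc x v"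
  using Qc_E[OF piF(2)[of v x]] by (simp add: blinfun.diff_right)

lemma Qc_inner: "Qc x v \<bullet> Qc x w = Qc x v \<bullet> w"
  using Qc_orth[OF Qc_diff_in[of w x], of v] by (simp add: inner_diff_right)

lemma Qc_norm_le: "norm (Qc x v) \<le> norm v"
proof -
  have "norm (Qc x v) * norm (Qc x v) = Qc x v \<bullet> v"
    using Qc_inner[of x v v] by (simp add: power2_norm_eq_inner flip: power2_eq_square)
  also have "\<dots> \<le> norm (Qc x v) * norm v" by (rule norm_cauchy_schwarz)
  finally show ?thesis by (cases "Qc x v = 0") auto
qed

text \<open>With \<open>Fs x\<close> described as the fixed space of \<open>PF x\<close>, the unit
  vectors of \<open>Fs\<close> over the unit cube form a compact set. On it \<open>Qc\<close> has no
  zero, since such a vector would lie in \<open>E x\<close> too. Periodicity carries the bound to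
  all base points.\<close>

lemma Qc_transversal:
  obtains c where "0 < c" "c \<le> 1" "\<And>x f. f \<in> Fs x \<Longrightarrow> c * norm f \<le> norm (Qc x f)"
proof -
  let ?K = "(cbox 0 1 \<times> sphere 0 1) \<inter> {p :: (real ^ 'n) \<times> (real ^ 'n). PF (fst p) (snd p) = snd p}"
  have cPF: "continuous_on S (\<lambda>p :: (real ^ 'n) \<times> (real ^ 'n). PF (fst p) (snd p))" for S
    by (intro continuous_intros continuous_on_compose2[OF PF(2)]) auto
  have cQ: "continuous_on S (\<lambda>p :: (real ^ 'n) \<times> (real ^ 'n). norm (Qc (fst p) (snd p)))" for S
    by (intro continuous_intros continuous_on_compose2[OF Qc_cont]) auto
  have K: "compact ?K"
    by (intro compact_Int_closed compact_Times compact_cbox compact_sphere closed_Collect_eq cPF continuous_intros)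
  have pos: "0 < norm (Qc (fst p) (snd p))" if p: "p \<in> ?K" for p
  proof (rule ccontr)
    assume "\<not> 0 < norm (Qc (fst p) (snd p))"
    then have "snd p - Qc (fst p) (snd p) = snd p" by simp
    then have "snd p \<in> E (fst p)" using Qc_diff_in by metis
    moreover have "snd p \<in> Fs (fst p)" using p PF_in[of "fst p" "snd p"] by simp
    ultimately have "snd p = 0" using inter by blast
    then show False using p by auto
  qed
  have "\<exists>c>0. \<forall>p\<in>?K. c \<le> norm (Qc (fst p) (snd p))"
  proof (cases "?K = {}")
    case False
    obtain p0 where "p0 \<in> ?K" "\<forall>p\<in>?K. norm (Qc (fst p0) (snd p0)) \<le> norm (Qc (fst p) (snd p))"
      using continuous_attains_inf[OF K False cQ] by blast
    then show ?thesis using pos by blast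
  qed (auto intro: exI[of _ 1])
  then obtain c where c: "c > 0" "\<And>p. p \<in> ?K \<Longrightarrow> c \<le> norm (Qc (fst p) (snd p))" by blast
  show ?thesis
  proof (rule that[of "min c 1"])
    fix x f assume f: "f \<in> Fs x"
    show "min c 1 * norm f \<le> norm (Qc x f)"
    proof (cases "f = 0")
      case False
      obtain k where k: "k \<in> int_lattice" "x - k \<in> cbox 0 1" by (rule int_lattice_shift_unit_cube)
      define e where "e = f /\<^sub>R norm f"
      have "e \<in> Fs x" unfolding e_def by (intro subspace_scale sub f)
      moreover have "PF (x - k) = PF x" "Qc (x - k) = Qc x"
        using lattice_periodicD(2)[OF lattice_periodic_proj(2) k(1)] lattice_periodicD(2)[OF Qc_periodic k(1)] by auto
      moreover have "norm e = 1" using False by (simp add: e_def)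
      ultimately have "c \<le> norm (Qc x e)" using c(2)[of "(x - k, e)"] k(2) PF_F[of e x] by simp
      then have "min c 1 * norm f \<le> norm (Qc x e) * norm f" by (intro mult_right_mono) auto
      also have "\<dots> = norm (Qc x f)" using False by (simp add: e_def blinfun.scaleR_right)
      finally show ?thesis .
    qed (simp add: blinfun.zero_right)
  qed (use c in auto)
qed

section \<open>Quantitative cone estimates\<close>

context
  fixes c :: real
  assumes c: "0 < c" "c \<le> 1" "\<And>x f. f \<in> Fs x \<Longrightarrow> c * norm f \<le> norm (Qc x f)"
begin

lemma piF_bound: "c * norm (piF x v) \<le> norm (Qc x v)" "c * norm (piF x v) \<le> norm v"
  using c(3)[OF piF(1), of x v] Qc_norm_le[of x v] by (simp_all add: Qc_piF)

text \<open>With h = k + w the two cone inequalities give |wF| \<le> |hF| + \<mu> |hE| + \<mu>^2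
  |wF|, and the last term is absorbed because \<mu> < 1. The components of h cost 1 / c. The 6 is 3
  from |h| and twice |hF|, times 2 from \<open>cone_u_norm_le\<close>.\<close>

lemma cone_separation:
  assumes "k \<in> cone_s \<mu> E Fs x" "w \<in> cone_u \<mu> E Fs x"
  shows "norm w \<le> 6 / (c * (1 - \<mu>\<^sup>2)) * norm (k + w)"
proof -
  let ?kF = "piF x k" and ?wF = "piF x w" let ?kE = "k - ?kF" and ?wE = "w - ?wF"
  let ?h = "k + w" let ?hF = "piF x ?h" let ?hE = "?h - ?hF"
  have hF: "?hF = ?kF + ?wF" and hE: "?hE = ?kE + ?wE" by (simp_all add: piF_simps)
  have k: "norm ?kF \<le> \<mu> * norm ?kE" and w: "norm ?wE \<le> \<mu> * norm ?wF"
    using assms by (simp_all add: cone_s_iff cone_u_iff)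
  have wF: "norm ?wF \<le> norm ?hF + norm ?kF" unfolding hF by (metis add_diff_cancel_left' norm_triangle_ineq4)
  have kE: "norm ?kE \<le> norm ?hE + norm ?wE" unfolding hE by (metis add_diff_cancel_right' norm_triangle_ineq4)
  have 0: "norm ?kF \<le> \<mu> * (norm ?hE + \<mu> * norm ?wF)"
    by (rule order_trans[OF k]) (intro mult_left_mono order_trans[OF kE] add_left_mono w, use mu in auto)
  have m1: "\<mu> * norm ?hE \<le> norm ?hE" using mult_right_mono[of \<mu> 1 "norm ?hE"] mu by simp
  have "(1 - \<mu>\<^sup>2) * norm ?wF \<le> norm ?hF + norm ?hE"
    using wF 0 m1 by (simp add: algebra_simps power2_eq_square)
  also have "norm ?hE \<le> norm ?h + norm ?hF" by (rule norm_triangle_ineq4)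
  finally have "(1 - \<mu>\<^sup>2) * norm ?wF \<le> 2 * norm ?hF + norm ?h" by simp
  then have "c * ((1 - \<mu>\<^sup>2) * norm ?wF) \<le> c * (2 * norm ?hF + norm ?h)" by (rule mult_left_mono) (use c in simp)
  also have "\<dots> = 2 * (c * norm ?hF) + c * norm ?h" by (simp add: algebra_simps)
  also have "\<dots> \<le> 2 * norm ?h + 1 * norm ?h"
    by (intro add_mono mult_left_mono mult_right_mono piF_bound c) auto
  finally have 1: "c * (1 - \<mu>\<^sup>2) * norm ?wF \<le> 3 * norm ?h" by simp
  have m2: "0 < 1 - \<mu>\<^sup>2" using mu by (simp add: power_less_one_iff abs_square_less_1)
  have p: "0 < c * (1 - \<mu>\<^sup>2)" using m2 c by simp
  have "c * (1 - \<mu>\<^sup>2) * norm w \<le> c * (1 - \<mu>\<^sup>2) * (2 * norm ?wF)"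
    by (intro mult_left_mono cone_u_norm_le assms) (use p in auto)
  also have "\<dots> = 2 * (c * (1 - \<mu>\<^sup>2) * norm ?wF)" by simp
  also have "\<dots> \<le> 2 * (3 * norm ?h)" by (rule mult_left_mono[OF 1]) simp
  also have "\<dots> = 6 * norm ?h" by simp
  finally show ?thesis using p by (simp add: field_simps)
qed

text \<open>On the unstable cone the exact projection has Qc w . w = |Qc w|^2 \<ge> c^2 |w|^2 / 4,
  and the tolerance takes away at most half of this.\<close>

lemma approx_Q_pos:
  assumes w: "w \<in> cone_u \<mu> E Fs x" and S: "s0 \<le> S" "0 < s0" and Q: "norm (Qf - S *\<^sub>R Qc x) \<le> \<mu> * c\<^sup>2 / 8 * S"
  shows "(norm w)\<^sup>2 \<le> 8 / (s0 * c\<^sup>2) * (Qf w \<bullet> w)"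
proof -
  have "c * norm w \<le> c * (2 * norm (piF x w))" by (intro mult_left_mono cone_u_norm_le w) (use c in auto)
  then have "c * norm w \<le> 2 * norm (Qc x w)" using piF_bound(1)[of x w] by linarith
  then have "(c * norm w)\<^sup>2 \<le> (2 * norm (Qc x w))\<^sup>2" by (rule power_mono) (use c in auto)
  then have 1: "c\<^sup>2 * (norm w)\<^sup>2 \<le> 4 * (Qc x w \<bullet> w)"
    using Qc_inner[of x w w] by (simp add: power_mult_distrib power2_norm_eq_inner)
  have "\<bar>(Qf - S *\<^sub>R Qc x) w \<bullet> w\<bar> \<le> norm ((Qf - S *\<^sub>R Qc x) w) * norm w" by (rule Cauchy_Schwarz_ineq2)
  also have "\<dots> \<le> (\<mu> * c\<^sup>2 / 8 * S * norm w) * norm w"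
    by (intro mult_right_mono order_trans[OF norm_blinfun] Q) auto
  also have "\<dots> = \<mu> * (c\<^sup>2 / 8 * S * (norm w)\<^sup>2)" by (simp add: power2_eq_square)
  also have "\<dots> \<le> 1 * (c\<^sup>2 / 8 * S * (norm w)\<^sup>2)" by (intro mult_right_mono) (use mu S in auto)
  finally have "\<bar>(Qf - S *\<^sub>R Qc x) w \<bullet> w\<bar> \<le> c\<^sup>2 / 8 * S * (norm w)\<^sup>2" by simp
  moreover have "(Qf - S *\<^sub>R Qc x) w \<bullet> w = Qf w \<bullet> w - S * (Qc x w \<bullet> w)"
    by (simp add: blinfun.diff_left blinfun.scaleR_left inner_diff_left)
  moreover have "S * (c\<^sup>2 * (norm w)\<^sup>2) \<le> S * (4 * (Qc x w \<bullet> w))" by (rule mult_left_mono[OF 1]) (use S in simp)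
  moreover have "S * (c2 * n) / 8 \<le> a" if "\<bar>a - S * b\<bar> \<le> c2 / 8 * S * n" "S * (c2 * n) \<le> S * (4 * b)" for a b c2 n :: real
    using that(1)[unfolded abs_le_iff] that(2) by (simp add: algebra_simps)
  ultimately have "S * (c\<^sup>2 * (norm w)\<^sup>2) / 8 \<le> Qf w \<bullet> w" by metis
  moreover have "s0 * (c\<^sup>2 * (norm w)\<^sup>2) \<le> S * (c\<^sup>2 * (norm w)\<^sup>2)" by (intro mult_right_mono S) auto
  ultimately have "s0 * (c\<^sup>2 * (norm w)\<^sup>2) \<le> 8 * (Qf w \<bullet> w)" by linarith
  then show ?thesis using S c by (simp add: field_simps)
qed

lemma F_line:
  assumes "f \<in> Fs x" "f \<noteq> 0" "g \<in> Fs x"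
  obtains t where "g = t *\<^sub>R f"
proof -
  have "span {f} = Fs x"
  proof (rule dim_eq_span[THEN trans])
    show "{f} \<subseteq> Fs x" using assms by simp
    show "dim (Fs x) \<le> dim {f}" using F_dim[of x] assms(2) by (simp add: dim_singleton)
    show "span (Fs x) = Fs x" using sub(2) by (simp add: span_eq_iff)
  qed
  then have "g \<in> span {f}" using assms(3) by simp
  then show ?thesis using that by (auto simp: span_singleton)
qed

text \<open>As \<open>Fs x\<close> is a line, the unstable component of \<open>v\<close> is t times
  that of \<open>w\<close>, so Qc w . v = t |Qc w|^2. This number differs from 0 only by the
  approximation error, which bounds the unstable component of \<open>v\<close> by \<mu> / 4 times
  |v|. The factor \<mu> in the tolerance is there to reach the stable cone.\<close>

lemma approx_Q_kernel:
  assumes w: "w \<in> cone_u \<mu> E Fs x" "w \<noteq> 0" and S: "0 < S" and Q: "norm (Qf - S *\<^sub>R Qc x) \<le> \<mu> * c\<^sup>2 / 8 * S"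
    and 0: "Qf w \<bullet> v = 0"
  shows "v \<in> cone_s \<mu> E Fs x"
proof -
  let ?wF = "piF x w" and ?vF = "piF x v"
  have wF: "?wF \<noteq> 0" using cone_u_norm_le[OF w(1)] w(2) by auto
  then obtain t where t: "?vF = t *\<^sub>R ?wF" using F_line[OF piF(1) _ piF(1)] by metis
  have "Qc x w \<bullet> v = Qc x w \<bullet> ?vF" using Qc_orth[OF piF(2)[of v x], of w] by (simp add: inner_diff_right)
  also have "\<dots> = t * (norm (Qc x w))\<^sup>2"
    unfolding t using Qc_inner[of x w ?wF] by (simp add: Qc_piF power2_norm_eq_inner)
  finally have Qwv: "Qc x w \<bullet> v = t * (norm (Qc x w))\<^sup>2" .
  have "S * (Qc x w \<bullet> v) = - ((Qf - S *\<^sub>R Qc x) w \<bullet> v)"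
    using 0 by (simp add: blinfun.diff_left blinfun.scaleR_left inner_diff_left)
  then have "S * \<bar>Qc x w \<bullet> v\<bar> = \<bar>(Qf - S *\<^sub>R Qc x) w \<bullet> v\<bar>" by (metis S abs_minus_cancel abs_mult abs_of_pos)
  also have "\<dots> \<le> norm ((Qf - S *\<^sub>R Qc x) w) * norm v" by (rule Cauchy_Schwarz_ineq2)
  also have "\<dots> \<le> (\<mu> * c\<^sup>2 / 8 * S * norm w) * norm v"
    by (intro mult_right_mono order_trans[OF norm_blinfun] Q) auto
  also have "\<dots> = S * (\<mu> * c\<^sup>2 / 8 * norm w * norm v)" by simp
  finally have "\<bar>Qc x w \<bullet> v\<bar> \<le> \<mu> * c\<^sup>2 / 8 * norm w * norm v" using S by (simp only: mult_le_cancel_left_pos)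
  also have "\<dots> \<le> \<mu> * c\<^sup>2 / 8 * (2 * norm ?wF) * norm v"
    by (intro mult_right_mono mult_left_mono cone_u_norm_le w) (use mu in auto)
  finally have 1: "\<bar>t\<bar> * (norm (Qc x w))\<^sup>2 \<le> \<mu> * c\<^sup>2 / 4 * norm ?wF * norm v" by (simp add: Qwv abs_mult)
  have "(c * norm ?wF)\<^sup>2 \<le> (norm (Qc x w))\<^sup>2" by (intro power_mono piF_bound) (use c in auto)
  then have "\<bar>t\<bar> * (c * norm ?wF)\<^sup>2 \<le> \<bar>t\<bar> * (norm (Qc x w))\<^sup>2" by (rule mult_left_mono) simp
  with 1 have "(c\<^sup>2 * norm ?wF) * (\<bar>t\<bar> * norm ?wF) \<le> (c\<^sup>2 * norm ?wF) * (\<mu> / 4 * norm v)"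
    by (simp add: power2_eq_square mult_ac)
  moreover have "0 < c\<^sup>2 * norm ?wF" using c wF by simp
  ultimately have vF: "norm ?vF \<le> \<mu> / 4 * norm v" unfolding t by (simp only: mult_le_cancel_left_pos norm_scaleR)
  have "norm v \<le> norm (v - ?vF) + norm ?vF" using norm_triangle_ineq[of "v - ?vF" ?vF] by simp
  moreover have "\<mu> / 4 * norm v \<le> 1 / 4 * norm v" by (intro mult_right_mono) (use mu in auto)
  ultimately have "norm v \<le> 2 * norm (v - ?vF)" using vF norm_ge_zero[of v] by linarith
  then have "\<mu> / 4 * norm v \<le> \<mu> / 4 * (2 * norm (v - ?vF))" by (rule mult_left_mono) (use mu in simp)
  also have "\<dots> \<le> \<mu> * norm (v - ?vF)" using mu by simp
  finally show ?thesis unfolding cone_s_iff using vF by linarith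
qed

text \<open>A unit vector of \<open>Fs x0\<close> is almost fixed by \<open>PF x\<close> for x near
  x0, with a radius independent of x0 by uniform continuity. An error of \<mu> c / 4 makes its
  \<open>E\<close> component at most \<mu> / 2 and its \<open>Fs\<close> component at least 1 / 2.
  The cap 1 / 2 on the radius is for \<open>C1_holder_projection_field\<close>.\<close>

lemma local_unstable_vector:
  obtains \<rho> where "0 < \<rho>" "\<rho> \<le> 1 / 2"
    "\<And>x0. \<exists>u. norm u = 1 \<and> (\<forall>x\<in>ball x0 \<rho>. u \<in> cone_u \<mu> E Fs x)"
proof -
  define e where "e = \<mu> * c / 4"
  have e: "0 < e" using mu c by (simp add: e_def)
  obtain \<delta> where \<delta>: "0 < \<delta>" "\<And>x y. dist x y < \<delta> \<Longrightarrow> dist (PF x) (PF y) < e"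
    using lattice_periodic_uniformly_continuous[OF lattice_periodic_proj(2) PF(2) e] by blast
  show ?thesis
  proof (rule that[of "min \<delta> (1 / 2)"])
    fix x0
    have "\<not> Fs x0 \<subseteq> {0}"
    proof
      assume "Fs x0 \<subseteq> {0}"
      then have "dim (Fs x0) = 0" by (simp only: dim_eq_0)
      then show False using F_dim[of x0] by (simp only:)
    qed
    then obtain f where f: "f \<in> Fs x0" "f \<noteq> 0" by blast
    define u where "u = f /\<^sub>R norm f"
    have u: "u \<in> Fs x0" "norm u = 1" using f subspace_scale[OF sub(2)] by (auto simp: u_def)
    have "u \<in> cone_u \<mu> E Fs x" if x: "x \<in> ball x0 (min \<delta> (1 / 2))" for x
    proof -
      define r where "r = u - PF x u"
      have "r = (PF x0 - PF x) u" using PF_F[OF u(1)] by (simp add: r_def blinfun.diff_left)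
      then have "norm r \<le> dist (PF x0) (PF x) * norm u" by (simp add: dist_norm norm_blinfun)
      also have "\<dots> \<le> e" using \<delta>(2)[of x0 x] x u by simp
      finally have r: "norm r \<le> \<mu> * c / 4" by (simp add: e_def)
      have "u - piF x u = r - piF x r" by (simp add: r_def piF_simps piF_F[OF PF_in])
      then have "norm (u - piF x u) \<le> norm r + norm (piF x r)" by (simp add: norm_triangle_ineq4)
      then have "c * norm (u - piF x u) \<le> c * (norm r + norm (piF x r))" by (rule mult_left_mono) (use c in simp)
      also have "\<dots> = c * norm r + c * norm (piF x r)" by (simp add: algebra_simps)
      also have "\<dots> \<le> 1 * norm r + norm r" by (intro add_mono mult_right_mono piF_bound c) auto
      also have "\<dots> \<le> c * (\<mu> / 2)" using r by (simp add: mult.commute)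
      finally have 1: "norm (u - piF x u) \<le> \<mu> / 2" using c by simp
      have "norm u \<le> norm (u - piF x u) + norm (piF x u)" using norm_triangle_ineq[of "u - piF x u" "piF x u"] by simp
      then have "1 / 2 \<le> norm (piF x u)" using 1 u mu by linarith
      then have "\<mu> * (1 / 2) \<le> \<mu> * norm (piF x u)" by (rule mult_left_mono) (use mu in simp)
      then show ?thesis unfolding cone_u_iff using 1 by linarith
    qed
    then show "\<exists>u. norm u = 1 \<and> (\<forall>x\<in>ball x0 (min \<delta> (1 / 2)). u \<in> cone_u \<mu> E Fs x)" using u(2) by blast
  qed (use \<delta> in auto)
qed

end

end

section \<open>The stable bundle\<close>

lemma fwd_bwd:
  assumes "\<And>n x. G n (F n x) = x" "\<And>n x. F n (G n x) = x"
  shows "bwd G n (fwd F n x) = x" "fwd F n (bwd G n x) = x"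
proof -
  show "bwd G n (fwd F n x) = x" by (induction n) (simp_all add: assms)
  show "fwd F n (bwd G n x) = x" by (induction n arbitrary: x) (simp_all add: assms)
qed

locale cone_sequence = cone_splitting \<mu> E Fs
  for \<mu> :: real and E Fs :: "real ^ 'n \<Rightarrow> (real ^ 'n) set" +
  fixes \<eta> :: real and F G :: "nat \<Rightarrow> real ^ 'n \<Rightarrow> real ^ 'n"
    and D1 :: "nat \<Rightarrow> real ^ 'n \<Rightarrow> (real ^ 'n) \<Rightarrow>\<^sub>L (real ^ 'n)"
  assumes eta: "1 < \<eta>"
    and inverse: "\<And>n x. G n (F n x) = x" "\<And>n x. F n (G n x) = x"
    and F_deriv: "\<And>n x. (F n has_derivative blinfun_apply (D1 n x)) (at x)"
    and G_diff: "\<And>n x. G n differentiable (at x)"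
    and u_inv: "\<And>n x v. v \<in> cone_u \<mu> E Fs x - {0} \<Longrightarrow> Dm (F n) x v \<in> interior (cone_u \<mu> E Fs (F n x))"
    and s_inv: "\<And>n x v. v \<in> cone_s \<mu> E Fs x - {0} \<Longrightarrow> Dm (G n) x v \<in> interior (cone_s \<mu> E Fs (G n x))"
    and u_exp: "\<And>n x v. v \<in> cone_u \<mu> E Fs x \<Longrightarrow> norm (Dm (F n) x v) \<ge> \<eta> * norm v"
    and s_exp: "\<And>n x v. v \<in> cone_s \<mu> E Fs x \<Longrightarrow> norm (Dm (G n) x v) \<ge> \<eta> * norm v"
begin

abbreviation "Ks \<equiv> cone_s \<mu> E Fs"
abbreviation "Ku \<equiv> cone_u \<mu> E Fs"

lemma Dm_F: "Dm (F n) x = blinfun_apply (D1 n x)"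
  using frechet_derivative_at[OF F_deriv] by metis

lemma G_deriv: "(G n has_derivative Dm (G n) x) (at x)"
  using G_diff frechet_derivative_works by blast

lemma Dm_G_F: "Dm (G n) (F n x) (D1 n x v) = v"
proof -
  have "((\<lambda>x. G n (F n x)) has_derivative (\<lambda>v. Dm (G n) (F n x) (D1 n x v))) (at x)"
    by (rule has_derivative_compose[OF F_deriv G_deriv])
  then have "((\<lambda>x. x) has_derivative (\<lambda>v. Dm (G n) (F n x) (D1 n x v))) (at x)"
    by (simp add: inverse)
  from has_derivative_unique[OF this has_derivative_ident] show ?thesis by metis
qed

lemma Ku_image: "w \<in> Ku x \<Longrightarrow> D1 n x w \<in> Ku (F n x)"
  using u_inv[of w x n] zero_in_cones(2) interior_subset[of "Ku (F n x)"]
  by (cases "w = 0") (auto simp: Dm_F)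

text \<open>The condition on the inverse map at the image of \<open>v\<close>, whose derivative
  leads back to \<open>v\<close>. A vanishing image is treated apart because strict invariance
  concerns nonzero vectors.\<close>

lemma Ks_preimage:
  assumes "D1 n x v \<in> Ks (F n x)"
  shows "v \<in> Ks x" "\<eta> * norm (D1 n x v) \<le> norm v"
proof -
  show "\<eta> * norm (D1 n x v) \<le> norm v" using s_exp[OF assms, of n] by (simp add: Dm_G_F)
  show "v \<in> Ks x"
  proof (cases "D1 n x v = 0")
    case True
    then have "v = 0" using Dm_G_F[of n x v] linear_0[OF has_derivative_linear[OF G_deriv]] by metis
    then show ?thesis by (simp add: zero_in_cones)
  next
    case False
    then have "Dm (G n) (F n x) (D1 n x v) \<in> interior (Ks (G n (F n x)))" using s_inv assms by blast
    then show ?thesis using interior_subset[of "Ks x"] by (auto simp: Dm_G_F inverse)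
  qed
qed

lemmas fwd_deriv = has_derivative_fwd[of F D1, OF F_deriv]

lemma bwd_deriv: "(bwd G n has_derivative Dm (bwd G n) x) (at x)"
proof -
  have "bwd G n differentiable (at x)" for x
  proof (induction n arbitrary: x)
    case 0
    show ?case by (simp add: id_def)
  next
    case (Suc n)
    show ?case unfolding bwd.simps by (rule differentiable_chain_at[OF G_diff Suc])
  qed
  then show ?thesis using frechet_derivative_works by blast
qed

text \<open>The derivatives of the forward and backward compositions are mutually inverse, so the
  image of the cone under one is its preimage under the other. The intersection starts at n = 1;
  time 0 is recovered from time 1 by backward invariance of the stable cones.\<close>

lemma stable_space_eq: "stable_space \<mu> E Fs F G x = tangent_stable F D1 Ks x"
proof -
  let ?A = "\<lambda>n. blprod (\<lambda>k. D1 k (fwd F k x)) n"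
  have inv1: "Dm (bwd G n) (fwd F n x) (?A n v) = v" for n v
  proof -
    have "((\<lambda>x. bwd G n (fwd F n x)) has_derivative (\<lambda>v. Dm (bwd G n) (fwd F n x) (?A n v))) (at x)"
      by (rule has_derivative_compose[OF fwd_deriv bwd_deriv])
    then have "((\<lambda>x. x) has_derivative (\<lambda>v. Dm (bwd G n) (fwd F n x) (?A n v))) (at x)"
      by (simp add: fwd_bwd(1)[OF inverse])
    from has_derivative_unique[OF this has_derivative_ident] show ?thesis by metis
  qed
  have inv2: "?A n (Dm (bwd G n) (fwd F n x) v) = v" for n v
  proof -
    have "((\<lambda>y. fwd F n (bwd G n y)) has_derivative (\<lambda>v. ?A n (Dm (bwd G n) (fwd F n x) v))) (at (fwd F n x))"
      by (rule has_derivative_compose[OF bwd_deriv]) (simp add: fwd_bwd(1)[OF inverse] fwd_deriv)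
    then have "((\<lambda>y. y) has_derivative (\<lambda>v. ?A n (Dm (bwd G n) (fwd F n x) v))) (at (fwd F n x))"
      by (simp add: fwd_bwd(2)[OF inverse])
    from has_derivative_unique[OF this has_derivative_ident] show ?thesis by metis
  qed
  have img: "v \<in> Dm (bwd G n) (fwd F n x) ` Ks (fwd F n x) \<longleftrightarrow> ?A n v \<in> Ks (fwd F n x)" for n v
    using inv1[of n v] inv2[of n] by force
  have zero: "?A 0 v \<in> Ks (fwd F 0 x)" if "\<forall>n\<in>{1..}. ?A n v \<in> Ks (fwd F n x)" for v
  proof -
    have "?A 1 v \<in> Ks (fwd F 1 x)" using that by (rule bspec) simp
    then show ?thesis using Ks_preimage(1)[of 0 x v] by simp
  qed
  have "(\<forall>n\<in>{1..}. ?A n v \<in> Ks (fwd F n x)) \<longleftrightarrow> (\<forall>n. ?A n v \<in> Ks (fwd F n x))" for v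
  proof (intro iffI allI)
    fix n assume *: "\<forall>n\<in>{1..}. ?A n v \<in> Ks (fwd F n x)"
    show "?A n v \<in> Ks (fwd F n x)"
    proof (cases "n = 0")
      case False
      then have "n \<in> {1..}" by simp
      then show ?thesis by (rule bspec[OF *])
    qed (simp only: zero[OF *])
  qed simp
  then show ?thesis unfolding stable_space_def by (auto simp: img)
qed

lemma cone_smooth_seq:
  assumes D1_deriv: "\<And>n x. (D1 n has_derivative blinfun_apply (D2 n x)) (at x)"
    and D2_cont: "\<And>n. continuous_on UNIV (D2 n)"
    and bounds: "\<And>n x. norm (D1 n x) \<le> M0" "\<And>n x. norm (D2 n x) \<le> M0"
  obtains Qf DQ C M \<rho> where "smooth_seq F D1 D2 Qf DQ Ks Ku \<eta> C M" "M0 \<le> M"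
    "\<And>x y. norm (DQ x - DQ y) \<le> M * dist x y"
    "0 < \<rho>" "\<rho> \<le> 1 / 2" "\<And>x0. \<exists>u. norm u = 1 \<and> (\<forall>x\<in>ball x0 \<rho>. u \<in> Ku x)"
proof -
  obtain c where c: "0 < c" "c \<le> 1" "\<And>x f. f \<in> Fs x \<Longrightarrow> c * norm f \<le> norm (Qc x f)"
    using Qc_transversal by blast
  \<comment> \<open>The tolerance under which \<open>approx_Q_pos\<close> and
    \<open>approx_Q_kernel\<close> both apply.\<close>
  have eps: "0 < \<mu> * c\<^sup>2 / 8" using mu c by simp
  obtain Qf DQ B s0 where Q: "\<And>x. (Qf has_derivative blinfun_apply (DQ x)) (at x)"
    "0 < s0" "\<And>x. \<exists>S\<ge>s0. norm (Qf x - S *\<^sub>R Qc x) \<le> \<mu> * c\<^sup>2 / 8 * S"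
    "\<And>x. norm (Qf x) \<le> B" "\<And>x. norm (DQ x) \<le> B" "\<And>x y. norm (DQ x - DQ y) \<le> B * dist x y"
    by (rule smooth_periodic_approximation[OF Qc_periodic Qc_cont eps]) (rule that)
  obtain \<rho> where \<rho>: "0 < \<rho>" "\<rho> \<le> 1 / 2" "\<And>x0. \<exists>u. norm u = 1 \<and> (\<forall>x\<in>ball x0 \<rho>. u \<in> Ku x)"
    using local_unstable_vector[OF c] by blast
  define C where "C = Max {1, 6 / (c * (1 - \<mu>\<^sup>2)), 8 / (s0 * c\<^sup>2), B}"
  have C: "1 \<le> C" "6 / (c * (1 - \<mu>\<^sup>2)) \<le> C" "8 / (s0 * c\<^sup>2) \<le> C" "B \<le> C"
    unfolding C_def by (intro Max_ge; simp)+
  define M where "M = Max {1, M0, B}"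
  have M: "1 \<le> M" "M0 \<le> M" "B \<le> M" unfolding M_def by (intro Max_ge; simp)+
  have pos: "(norm w)\<^sup>2 \<le> C * (Qf x w \<bullet> w)" if w: "w \<in> Ku x" for w x
  proof -
    obtain S where S: "S \<ge> s0" "norm (Qf x - S *\<^sub>R Qc x) \<le> \<mu> * c\<^sup>2 / 8 * S" using Q(3) by blast
    have 1: "(norm w)\<^sup>2 \<le> 8 / (s0 * c\<^sup>2) * (Qf x w \<bullet> w)"
      by (rule approx_Q_pos[OF c w S(1) Q(2) S(2)])
    \<comment> \<open>The constant may be enlarged to \<open>C\<close> only once the inner product
      is known to be nonnegative, and this follows from the estimate \<open>1\<close>
      itself.\<close>
    have p: "0 < 8 / (s0 * c\<^sup>2)" using Q(2) c by simp
    have "0 \<le> 8 / (s0 * c\<^sup>2) * (Qf x w \<bullet> w)" by (rule order_trans[OF _ 1]) simp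
    then have "0 \<le> Qf x w \<bullet> w" using p by (simp only: zero_le_mult_iff) linarith
    then have "8 / (s0 * c\<^sup>2) * (Qf x w \<bullet> w) \<le> C * (Qf x w \<bullet> w)" by (intro mult_right_mono C)
    then show ?thesis using 1 by linarith
  qed
  have ker: "v \<in> Ks x" if "w \<in> Ku x" "w \<noteq> 0" "Qf x w \<bullet> v = 0" for w v x
  proof -
    obtain S where S: "S \<ge> s0" "norm (Qf x - S *\<^sub>R Qc x) \<le> \<mu> * c\<^sup>2 / 8 * S" using Q(3) by blast
    have S0: "0 < S" using S(1) Q(2) by linarith
    show ?thesis using approx_Q_kernel[OF c that(1,2) S0 S(2) that(3)] .
  qed
  have sep: "norm w \<le> C * norm (v + w)" if "v \<in> Ks x" "w \<in> Ku x" for v w x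
  proof -
    have "6 / (c * (1 - \<mu>\<^sup>2)) * norm (v + w) \<le> C * norm (v + w)" by (intro mult_right_mono C) simp
    then show ?thesis using cone_separation[OF c that] by linarith
  qed
  have "smooth_seq F D1 D2 Qf DQ Ks Ku \<eta> C M"
  proof (rule smooth_seq.intro)
    show "(F n has_derivative D1 n x) (at x)" for n x by (rule F_deriv)
    show "(D1 n has_derivative D2 n x) (at x)" for n x by (rule D1_deriv)
    show "continuous_on UNIV (D2 n)" for n by (rule D2_cont)
    show "(Qf has_derivative DQ x) (at x)" for x by (rule Q(1))
    have "B-lipschitz_on UNIV DQ"
      by (rule lipschitz_onI) (use Q(6) order_trans[OF norm_ge_zero Q(4)] in \<open>auto simp: dist_norm\<close>)
    then show "continuous_on UNIV DQ" by (rule lipschitz_on_continuous_on)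
    show "norm (D1 n x) \<le> M" "norm (D2 n x) \<le> M" "norm (DQ x) \<le> M" for n x
      using bounds[of n x] Q(5)[of x] M by linarith+
    show "1 \<le> M" by (rule M)
    show "closed (Ks x)" for x by (rule closed_cone_s)
    show "dominated_seq (\<lambda>k. D1 k (fwd F k x)) (\<lambda>k. Qf (fwd F k x)) (\<lambda>k. Ks (fwd F k x)) (\<lambda>k. Ku (fwd F k x)) \<eta> C" for x
    proof
      show "1 < \<eta>" by (rule eta)
      show "1 \<le> C" by (rule C)
      fix n v w r
      show "w \<in> Ku (fwd F n x) \<Longrightarrow> D1 n (fwd F n x) w \<in> Ku (fwd F (Suc n) x)"
        using Ku_image by simp
      show "w \<in> Ku (fwd F n x) \<Longrightarrow> \<eta> * norm w \<le> norm (D1 n (fwd F n x) w)"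
        using u_exp[of w "fwd F n x" n] by (simp add: Dm_F)
      show "D1 n (fwd F n x) v \<in> Ks (fwd F (Suc n) x) \<Longrightarrow> v \<in> Ks (fwd F n x)"
        "D1 n (fwd F n x) v \<in> Ks (fwd F (Suc n) x) \<Longrightarrow> \<eta> * norm (D1 n (fwd F n x) v) \<le> norm v"
        using Ks_preimage by simp_all
      show "w \<in> Ku (fwd F n x) \<Longrightarrow> r *\<^sub>R w \<in> Ku (fwd F n x)" by (rule cone_u_scaleR)
      show "v \<in> Ks (fwd F n x) \<Longrightarrow> w \<in> Ku (fwd F n x) \<Longrightarrow> norm w \<le> C * norm (v + w)" by (rule sep)
      show "w \<in> Ku (fwd F n x) \<Longrightarrow> (norm w)\<^sup>2 \<le> C * (Qf (fwd F n x) w \<bullet> w)" by (rule pos)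
      show "norm (Qf (fwd F n x)) \<le> C" using Q(4) C(4) order_trans by blast
      show "w \<in> Ku (fwd F n x) \<Longrightarrow> w \<noteq> 0 \<Longrightarrow> Qf (fwd F n x) w \<bullet> v = 0 \<Longrightarrow> v \<in> Ks (fwd F n x)" by (rule ker)
    qed
  qed
  moreover have "norm (DQ x - DQ y) \<le> M * dist x y" for x y
    using Q(6)[of x y] mult_right_mono[OF M(3), of "dist x y"] by simp
  ultimately show ?thesis using that M(2) \<rho> by blast
qed

lemma stable_space_C1:
  assumes "\<And>n x. (D1 n has_derivative blinfun_apply (D2 n x)) (at x)" "\<And>n. continuous_on UNIV (D2 n)"
    and "\<And>n x. norm (D1 n x) \<le> M0" "\<And>n x. norm (D2 n x) \<le> M0"
  shows "C1_subspace_field (stable_space \<mu> E Fs F G)"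
proof -
  obtain Qf DQ C M \<rho> where *: "smooth_seq F D1 D2 Qf DQ Ks Ku \<eta> C M"
    "0 < \<rho>" "\<And>x0. \<exists>u. norm u = 1 \<and> (\<forall>x\<in>ball x0 \<rho>. u \<in> Ku x)"
    by (rule cone_smooth_seq[OF assms]) (rule that)
  have "stable_space \<mu> E Fs F G = tangent_stable F D1 Ks" using stable_space_eq by blast
  then show ?thesis using C1_projection_field[OF *] by (simp only:)
qed

lemma stable_space_C1_holder:
  assumes "\<And>n x. (D1 n has_derivative blinfun_apply (D2 n x)) (at x)"
    and D2_deriv: "\<And>n x. (D2 n has_derivative blinfun_apply (D3 n x)) (at x)"
    and "\<And>n x. norm (D1 n x) \<le> M0" "\<And>n x. norm (D2 n x) \<le> M0" and D3: "\<And>n x. norm (D3 n x) \<le> M0"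
  shows "\<exists>\<beta>. 0 < \<beta> \<and> \<beta> < 1 \<and> C1_holder_subspace_field \<beta> (stable_space \<mu> E Fs F G)"
proof -
  have cont: "continuous_on UNIV (D2 n)" for n
    by (intro continuous_at_imp_continuous_on ballI has_derivative_continuous[OF D2_deriv])
  obtain Qf DQ C M \<rho> where *: "smooth_seq F D1 D2 Qf DQ Ks Ku \<eta> C M" "M0 \<le> M"
    "\<And>x y. norm (DQ x - DQ y) \<le> M * dist x y"
    "0 < \<rho>" "\<rho> \<le> 1 / 2" "\<And>x0. \<exists>u. norm u = 1 \<and> (\<forall>x\<in>ball x0 \<rho>. u \<in> Ku x)"
    using cone_smooth_seq[OF assms(1) cont assms(3,4)] by blast
  have lip: "norm (D2 n x - D2 n y) \<le> M * dist x y" for n x y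
  proof -
    have "norm (D2 n x - D2 n y) \<le> M0 * norm (x - y)"
      by (rule differentiable_bound[of UNIV "D2 n" "\<lambda>x. blinfun_apply (D3 n x)"])
        (use D2_deriv D3 in \<open>auto simp: norm_blinfun.rep_eq[symmetric]\<close>)
    also have "\<dots> \<le> M * norm (x - y)" by (intro mult_right_mono *) simp
    finally show ?thesis by (simp add: dist_norm)
  qed
  have seq: "smooth_seq_lip F D1 D2 Qf DQ Ks Ku \<eta> C M"
    unfolding smooth_seq_lip_def smooth_seq_lip_axioms_def using *(1,3) lip by blast
  have "stable_space \<mu> E Fs F G = tangent_stable F D1 Ks" using stable_space_eq by blast
  then show ?thesis using C1_holder_projection_field[OF seq *(4-6)] by (simp only:)
qed

end

theorem theorem4:
  fixes F G :: "nat \<Rightarrow> real ^ 'n \<Rightarrow> real ^ 'n"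
    and \<mu> \<eta> :: real
    and E Fs :: "real ^ 'n \<Rightarrow> (real ^ 'n) set"
  assumes d_gt_1: "CARD('n) > 1"
    and inverse: "\<And>n x. G n (F n x) = x" "\<And>n x. F n (G n x) = x"
    and lift: "\<And>n. torus_lift (F n)" "\<And>n. torus_lift (G n)"
    and C1: "\<And>n. \<exists>D. C1_map (F n) D" "\<And>n. \<exists>D. C1_map (G n) D"
    and anosov: "\<And>n. anosov (F n) (G n)"
    and cones: "common_cone_condition \<mu> \<eta> E Fs F G"
  shows "((\<exists>M. \<forall>n.
             (\<exists>D1 D2. C1_map (F n) D1 \<and> C1_map D1 D2 \<and>
                (\<forall>x. norm (D1 x) \<le> M \<and> norm (D2 x) \<le> M)) \<and>
             (\<exists>D1 D2. C1_map (G n) D1 \<and> C1_map D1 D2 \<and>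
                (\<forall>x. norm (D1 x) \<le> M \<and> norm (D2 x) \<le> M)))
          \<longrightarrow> C1_subspace_field (stable_space \<mu> E Fs F G))
       \<and> ((\<exists>M. \<forall>n.
             (\<exists>D1 D2 D3. C1_map (F n) D1 \<and> C1_map D1 D2 \<and> C1_map D2 D3 \<and>
                (\<forall>x. norm (D1 x) \<le> M \<and> norm (D2 x) \<le> M \<and> norm (D3 x) \<le> M)) \<and>
             (\<exists>D1 D2 D3. C1_map (G n) D1 \<and> C1_map D1 D2 \<and> C1_map D2 D3 \<and>
                (\<forall>x. norm (D1 x) \<le> M \<and> norm (D2 x) \<le> M \<and> norm (D3 x) \<le> M)))
          \<longrightarrow> (\<exists>\<beta>. 0 < \<beta> \<and> \<beta> < 1 \<and> C1_holder_subspace_field \<beta> (stable_space \<mu> E Fs F G)))"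
proof -
  have split: "cone_splitting \<mu> E Fs"
    using cones unfolding common_cone_condition_def by unfold_locales blast+
  have G_diff: "G n differentiable (at x)" for n x
    using C1(2)[of n] unfolding C1_map_def differentiable_def by blast
  \<comment> \<open>Kept general in \<open>D1\<close>, because the two halves of the theorem obtain
    the derivatives from different hypotheses.\<close>
  have seq: "cone_sequence \<mu> E Fs \<eta> F G D1"
    if D1: "\<And>n x. (F n has_derivative blinfun_apply (D1 n x)) (at x)" for D1
  proof -
    have eta: "1 < \<eta>" using cones unfolding common_cone_condition_def by blast
    have inv: "\<forall>n x. (\<forall>v \<in> cone_u \<mu> E Fs x - {0}. Dm (F n) x v \<in> interior (cone_u \<mu> E Fs (F n x))) \<and>
        (\<forall>v \<in> cone_s \<mu> E Fs x - {0}. Dm (G n) x v \<in> interior (cone_s \<mu> E Fs (G n x))) \<and>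
        (\<forall>v \<in> cone_u \<mu> E Fs x. norm (Dm (F n) x v) \<ge> \<eta> * norm v) \<and>
        (\<forall>v \<in> cone_s \<mu> E Fs x. norm (Dm (G n) x v) \<ge> \<eta> * norm v)"
      using cones unfolding common_cone_condition_def by (elim exE conjE) simp
    show ?thesis
      by (intro cone_sequence.intro split cone_sequence_axioms.intro eta inverse D1 G_diff) (use inv in blast)+
  qed
  show ?thesis
  proof (intro conjI impI)
    assume "\<exists>M. \<forall>n.
             (\<exists>D1 D2. C1_map (F n) D1 \<and> C1_map D1 D2 \<and>
                (\<forall>x. norm (D1 x) \<le> M \<and> norm (D2 x) \<le> M)) \<and>
             (\<exists>D1 D2. C1_map (G n) D1 \<and> C1_map D1 D2 \<and>
                (\<forall>x. norm (D1 x) \<le> M \<and> norm (D2 x) \<le> M))"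
    then obtain M where "\<forall>n. \<exists>D1 D2. C1_map (F n) D1 \<and> C1_map D1 D2 \<and>
                (\<forall>x. norm (D1 x) \<le> M \<and> norm (D2 x) \<le> M)" by blast
    then obtain D1 D2 where D: "\<And>n. C1_map (F n) (D1 n)" "\<And>n. C1_map (D1 n) (D2 n)"
      "\<And>n x. norm (D1 n x) \<le> M" "\<And>n x. norm (D2 n x) \<le> M" by metis
    interpret cone_sequence \<mu> E Fs \<eta> F G D1
      using D(1) by (intro seq) (simp add: C1_map_def)
    have "\<And>n x. (D1 n has_derivative blinfun_apply (D2 n x)) (at x)" "\<And>n. continuous_on UNIV (D2 n)"
      using D(2) by (simp_all add: C1_map_def)
    then show "C1_subspace_field (stable_space \<mu> E Fs F G)"
      by (rule stable_space_C1[OF _ _ D(3,4)])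
  next
    assume "\<exists>M. \<forall>n.
             (\<exists>D1 D2 D3. C1_map (F n) D1 \<and> C1_map D1 D2 \<and> C1_map D2 D3 \<and>
                (\<forall>x. norm (D1 x) \<le> M \<and> norm (D2 x) \<le> M \<and> norm (D3 x) \<le> M)) \<and>
             (\<exists>D1 D2 D3. C1_map (G n) D1 \<and> C1_map D1 D2 \<and> C1_map D2 D3 \<and>
                (\<forall>x. norm (D1 x) \<le> M \<and> norm (D2 x) \<le> M \<and> norm (D3 x) \<le> M))"
    then obtain M where "\<forall>n. \<exists>D1 D2 D3. C1_map (F n) D1 \<and> C1_map D1 D2 \<and> C1_map D2 D3 \<and>
                (\<forall>x. norm (D1 x) \<le> M \<and> norm (D2 x) \<le> M \<and> norm (D3 x) \<le> M)" by blast
    then obtain D1 D2 D3 where D: "\<And>n. C1_map (F n) (D1 n)" "\<And>n. C1_map (D1 n) (D2 n)" "\<And>n. C1_map (D2 n) (D3 n)"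
      "\<And>n x. norm (D1 n x) \<le> M" "\<And>n x. norm (D2 n x) \<le> M" "\<And>n x. norm (D3 n x) \<le> M" by metis
    interpret cone_sequence \<mu> E Fs \<eta> F G D1
      using D(1) by (intro seq) (simp add: C1_map_def)
    have "\<And>n x. (D1 n has_derivative blinfun_apply (D2 n x)) (at x)" "\<And>n x. (D2 n has_derivative blinfun_apply (D3 n x)) (at x)"
      using D(2,3) by (simp_all add: C1_map_def)
    then show "\<exists>\<beta>. 0 < \<beta> \<and> \<beta> < 1 \<and> C1_holder_subspace_field \<beta> (stable_space \<mu> E Fs F G)"
      by (rule stable_space_C1_holder[OF _ _ D(4-6)])
  qed
qed

end
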